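(* Let $\mathcal D$ be a compactly generated triangulated category and let $\mathcal I$ be an idempotent two-sided ideal of $\mathcal D^c$ with $\mathcal I[1]=\mathcal I$. There exists a triangulated TTF triple $(\mathcal X,\mathcal Y,\mathcal Z)$ on $\mathcal D$ such that: 1) $\mathcal X=\mathrm{Tria}(\mathcal P)$, for a certain set $\mathcal P$ of Milnor colimits of sequences of morphisms of $\mathcal I$. 2) $\mathcal Y=\mathcal I^\perp$. 3) A morphism of $\mathcal D^c$ belongs to $\mathcal I$ if and only if it factors through an object of $\mathcal P$.
   Context: $\mathcal D$ compactly generated: it has small coproducts and a set of compact objects (objects $P$ with $\mathcal D(P,?)$ preserving small coproducts) such that $M=0$ whenever all shifts of these objects have no non-zero morphisms to $M$. $\mathcal D^c$ is the full subcategory of compact objects. A two-sided ideal of $\mathcal D^c$ is a class $\mathcal I$ of morphisms such that $\mathcal I\cap\mathcal D^c(M,N)$ is a subgroup for all $M,N$ and $hgf\in\mathcal I$ whenever $g\in\mathcal I$ and $f,g,h$ are composable; it is idempotent if $\mathcal I=\mathcal I^2$; $\mathcal I[1]$ is the class of all $f[1]$ with $f\in\mathcal I$. $\mathcal I^\perp$ is the class of objects $Y$ of $\mathcal D$ with $\mathcal D(f,Y)=0$ for all $f\in\mathcal I$. $\mathrm{Tria}(\mathcal P)$ is the smallest full triangulated subcategory of $\mathcal D$ containing $\mathcal P$ and closed under small coproducts. The Milnor colimit of a sequence $M_0\xrightarrow{f_0}M_1\xrightarrow{f_1}M_2\to\cdots$ is the object $C$ (unique up to non-unique isomorphism) in a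 triangle $\coprod_{n\ge0}M_n\xrightarrow{1-\sigma}\coprod_{n\ge0}M_n\to C\to\coprod_{n\ge0}M_n[1]$, where $\sigma$ has components $M_n\xrightarrow{f_n}M_{n+1}\to\coprod_pM_p$. A t-structure is a pair $(\mathcal U,\mathcal V[1])$ with $\mathcal U,\mathcal V$ strictly full, $\mathcal D(U,V)=0$ for $U\in\mathcal U$, $V\in\mathcal V$, $\mathcal U[1]\subseteq\mathcal U$, $\mathcal V[-1]\subseteq\mathcal V$, and each $M$ in a triangle $M_{\mathcal U}\to M\to M^{\mathcal V}\to M_{\mathcal U}[1]$ with $M_{\mathcal U}\in\mathcal U$, $M^{\mathcal V}\in\mathcal V$. A triangulated TTF triple is a triple $(\mathcal X,\mathcal Y,\mathcal Z)$ of full subcategories with $(\mathcal X,\mathcal Y)$ and $(\mathcal Y,\mathcal Z)$ t-structures. *)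

theory Defs
  imports "HOL-Algebra.Product_Groups" "HOL-Algebra.Free_Abelian_Groups" "HOL-Algebra.Generated_Groups"
begin

text \<open>
  Set-theoretic size: a set is small if its cardinality is below a fixed uncountable strongly
  inaccessible cardinal \<open>\<kappa>\<close>, that is, if it is equipotent to an element of a Grothendieck
  universe containing the set of natural numbers. The cardinal is carried by an arbitrary
  type \<open>'u\<close>. Every small set is equipotent to a subset of \<open>'u\<close>, so it is enough to use
  subsets of \<open>'u\<close> as index sets of small coproducts. (Bounding sizes by the cardinality of a
  type would not do: a locally small category with coproducts of all sizes up to \<open>|'u|\<close> is
  a preorder, since these bounds are not closed under power sets.)
\<close>

definition inaccessible_cardinal :: "'u rel \<Rightarrow> bool" where
  "inaccessible_cardinal \<kappa> \<longleftrightarrow>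
     Card_order \<kappa> \<and> natLeq <o \<kappa> \<and> regularCard \<kappa> \<and>
     (\<forall>A :: 'u set. |A| <o \<kappa> \<longrightarrow> |Pow A| <o \<kappa>)"

definition small :: "'u rel \<Rightarrow> 'a set \<Rightarrow> bool" where
  "small \<kappa> A \<longleftrightarrow> |A| <o \<kappa>"


section \<open>Triangulated categories\<close>

text \<open>
  \<open>Sh\<close> and \<open>ShM\<close> are the action of the shift \<open>[1]\<close> on objects and on morphisms. A triple
  \<open>(f, g, h)\<close> in \<open>Tri\<close> is a distinguished triangle \<open>A \<rightarrow> B \<rightarrow> C \<rightarrow> A[1]\<close>.
\<close>

record ('o, 'm) triang_data =
  Obj :: "'o set"
  Arr :: "'m set"
  Dom :: "'m \<Rightarrow> 'o"
  Cod :: "'m \<Rightarrow> 'o"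
  Ident :: "'o \<Rightarrow> 'm"
  Comp :: "'m \<Rightarrow> 'm \<Rightarrow> 'm"  (infixr \<open>\<cdot>\<index>\<close> 70)
  Add :: "'m \<Rightarrow> 'm \<Rightarrow> 'm"
  Zero :: "'o \<Rightarrow> 'o \<Rightarrow> 'm"
  Sh :: "'o \<Rightarrow> 'o"
  ShM :: "'m \<Rightarrow> 'm"
  Tri :: "('m \<times> 'm \<times> 'm) set"

definition Hom :: "('o, 'm) triang_data \<Rightarrow> 'o \<Rightarrow> 'o \<Rightarrow> 'm set" where
  "Hom D A B = {f \<in> Arr D. Dom D f = A \<and> Cod D f = B}"

text \<open>The abelian group of morphisms, in the multiplicative notation of \<open>monoid\<close> records.\<close>

definition hom_group :: "('o, 'm) triang_data \<Rightarrow> 'o \<Rightarrow> 'o \<Rightarrow> 'm monoid" where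
  "hom_group D A B = \<lparr>carrier = Hom D A B, mult = Add D, one = Zero D A B\<rparr>"

definition neg :: "('o, 'm) triang_data \<Rightarrow> 'm \<Rightarrow> 'm" where
  "neg D f = inv\<^bsub>hom_group D (Dom D f) (Cod D f)\<^esub> f"

definition iso_arr :: "('o, 'm) triang_data \<Rightarrow> 'o \<Rightarrow> 'o \<Rightarrow> 'm \<Rightarrow> bool" where
  "iso_arr D A B f \<longleftrightarrow>
     f \<in> Hom D A B \<and> (\<exists>g \<in> Hom D B A. g \<cdot>\<^bsub>D\<^esub> f = Ident D A \<and> f \<cdot>\<^bsub>D\<^esub> g = Ident D B)"

definition zero_object :: "('o, 'm) triang_data \<Rightarrow> 'o \<Rightarrow> bool" where
  "zero_object D Z \<longleftrightarrow>
     Z \<in> Obj D \<and> (\<forall>A \<in> Obj D. (\<exists>!f. f \<in> Hom D A Z) \<and> (\<exists>!f. f \<in> Hom D Z A))"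

locale category =
  fixes D :: "('o, 'm) triang_data" (structure)
  assumes Dom_obj: "f \<in> Arr D \<Longrightarrow> Dom D f \<in> Obj D"
    and Cod_obj: "f \<in> Arr D \<Longrightarrow> Cod D f \<in> Obj D"
    and Ident_hom: "A \<in> Obj D \<Longrightarrow> Ident D A \<in> Hom D A A"
    and Comp_hom: "\<lbrakk>f \<in> Hom D A B; g \<in> Hom D B C\<rbrakk> \<Longrightarrow> g \<cdot> f \<in> Hom D A C"
    and Comp_Ident: "f \<in> Hom D A B \<Longrightarrow> f \<cdot> Ident D A = f"
    and Ident_Comp: "f \<in> Hom D A B \<Longrightarrow> Ident D B \<cdot> f = f"
    and Comp_assoc: "\<lbrakk>f \<in> Hom D A B; g \<in> Hom D B C; h \<in> Hom D C E\<rbrakk> \<Longrightarrow>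
      (h \<cdot> g) \<cdot> f = h \<cdot> (g \<cdot> f)"

locale additive_category = category +
  assumes hom_comm_group: "\<lbrakk>A \<in> Obj D; B \<in> Obj D\<rbrakk> \<Longrightarrow> comm_group (hom_group D A B)"
    and Comp_Add_left: "\<lbrakk>f \<in> Hom D A B; g \<in> Hom D B C; g' \<in> Hom D B C\<rbrakk> \<Longrightarrow>
      Add D g g' \<cdot> f = Add D (g \<cdot> f) (g' \<cdot> f)"
    and Comp_Add_right: "\<lbrakk>f \<in> Hom D A B; f' \<in> Hom D A B; g \<in> Hom D B C\<rbrakk> \<Longrightarrow>
      g \<cdot> Add D f f' = Add D (g \<cdot> f) (g \<cdot> f')"
    and ex_zero_object: "\<exists>Z. zero_object D Z"
    and ex_biproduct: "\<lbrakk>A \<in> Obj D; B \<in> Obj D\<rbrakk> \<Longrightarrow>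
      \<exists>S \<in> Obj D. \<exists>i \<in> Hom D A S. \<exists>j \<in> Hom D B S. \<exists>p \<in> Hom D S A. \<exists>q \<in> Hom D S B.
        p \<cdot> i = Ident D A \<and> q \<cdot> j = Ident D B \<and>
        p \<cdot> j = Zero D B A \<and> q \<cdot> i = Zero D A B \<and>
        Add D (i \<cdot> p) (j \<cdot> q) = Ident D S"

text \<open>
  The shift is an automorphism of the additive category. \<open>TR4\<close> is the octahedral axiom.
\<close>

locale triangulated_category = additive_category +
  assumes Sh_bij: "bij_betw (Sh D) (Obj D) (Obj D)"
    and ShM_bij: "bij_betw (ShM D) (Arr D) (Arr D)"
    and ShM_hom: "f \<in> Hom D A B \<Longrightarrow> ShM D f \<in> Hom D (Sh D A) (Sh D B)"
    and ShM_Ident: "A \<in> Obj D \<Longrightarrow> ShM D (Ident D A) = Ident D (Sh D A)"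
    and ShM_Comp: "\<lbrakk>f \<in> Hom D A B; g \<in> Hom D B C\<rbrakk> \<Longrightarrow> ShM D (g \<cdot> f) = ShM D g \<cdot> ShM D f"
    and ShM_Add: "\<lbrakk>f \<in> Hom D A B; f' \<in> Hom D A B\<rbrakk> \<Longrightarrow>
      ShM D (Add D f f') = Add D (ShM D f) (ShM D f')"
    and Tri_composable: "(f, g, h) \<in> Tri D \<Longrightarrow>
      \<exists>A B C. f \<in> Hom D A B \<and> g \<in> Hom D B C \<and> h \<in> Hom D C (Sh D A)"
    and TR1_iso: "\<lbrakk>(f, g, h) \<in> Tri D;
        f \<in> Hom D A B; g \<in> Hom D B C; h \<in> Hom D C (Sh D A);
        f' \<in> Hom D A' B'; g' \<in> Hom D B' C'; h' \<in> Hom D C' (Sh D A');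
        iso_arr D A A' a; iso_arr D B B' b; iso_arr D C C' c;
        b \<cdot> f = f' \<cdot> a; c \<cdot> g = g' \<cdot> b; ShM D a \<cdot> h = h' \<cdot> c\<rbrakk> \<Longrightarrow>
      (f', g', h') \<in> Tri D"
    and TR1_Ident: "\<lbrakk>A \<in> Obj D; zero_object D Z\<rbrakk> \<Longrightarrow>
      (Ident D A, Zero D A Z, Zero D Z (Sh D A)) \<in> Tri D"
    and TR1_cone: "f \<in> Arr D \<Longrightarrow> \<exists>g h. (f, g, h) \<in> Tri D"
    and TR2: "\<lbrakk>f \<in> Hom D A B; g \<in> Hom D B C; h \<in> Hom D C (Sh D A)\<rbrakk> \<Longrightarrow>
      (f, g, h) \<in> Tri D \<longleftrightarrow> (g, h, neg D (ShM D f)) \<in> Tri D"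
    and TR3: "\<lbrakk>(f, g, h) \<in> Tri D; (f', g', h') \<in> Tri D;
        a \<in> Hom D (Dom D f) (Dom D f'); b \<in> Hom D (Cod D f) (Cod D f');
        b \<cdot> f = f' \<cdot> a\<rbrakk> \<Longrightarrow>
      \<exists>c \<in> Hom D (Cod D g) (Cod D g'). c \<cdot> g = g' \<cdot> b \<and> ShM D a \<cdot> h = h' \<cdot> c"
    and TR4: "\<lbrakk>f \<in> Hom D A B; g \<in> Hom D B C;
        (f, u, u') \<in> Tri D; (g, v, v') \<in> Tri D; (g \<cdot> f, w, w') \<in> Tri D\<rbrakk> \<Longrightarrow>
      \<exists>p \<in> Hom D (Cod D u) (Cod D w). \<exists>q \<in> Hom D (Cod D w) (Cod D v).
        (p, q, ShM D u \<cdot> v') \<in> Tri D \<and>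
        p \<cdot> u = w \<cdot> g \<and> w' \<cdot> p = u' \<and> q \<cdot> w = v \<and> v' \<cdot> q = ShM D f \<cdot> w'"

definition shift_power :: "('o, 'm) triang_data \<Rightarrow> int \<Rightarrow> 'o \<Rightarrow> 'o" where
  "shift_power D n A =
     (if n \<ge> 0 then (Sh D ^^ nat n) A else (inv_into (Obj D) (Sh D) ^^ nat (- n)) A)"


section \<open>Coproducts and compact generation\<close>

definition is_coproduct ::
  "('o, 'm) triang_data \<Rightarrow> 'i set \<Rightarrow> ('i \<Rightarrow> 'o) \<Rightarrow> 'o \<Rightarrow> ('i \<Rightarrow> 'm) \<Rightarrow> bool" where
  "is_coproduct D J X S \<iota> \<longleftrightarrow>
     S \<in> Obj D \<and> (\<forall>j \<in> J. X j \<in> Obj D \<and> \<iota> j \<in> Hom D (X j) S) \<and>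
     (\<forall>T \<in> Obj D. \<forall>f. (\<forall>j \<in> J. f j \<in> Hom D (X j) T) \<longrightarrow>
        (\<exists>!u. u \<in> Hom D S T \<and> (\<forall>j \<in> J. u \<cdot>\<^bsub>D\<^esub> \<iota> j = f j)))"

definition has_small_coproducts :: "'u rel \<Rightarrow> ('o, 'm) triang_data \<Rightarrow> bool" where
  "has_small_coproducts \<kappa> D \<longleftrightarrow>
     (\<forall>(J :: 'u set) X. small \<kappa> J \<and> (\<forall>j \<in> J. X j \<in> Obj D) \<longrightarrow> (\<exists>S \<iota>. is_coproduct D J X S \<iota>))"

text \<open>
  Preservation of coproducts by \<open>D(P, ?)\<close>: for each small coproduct, the canonical map
  from the direct sum of the groups \<open>D(P, X j)\<close> to \<open>D(P, S)\<close>, which sends a finitely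
  supported family \<open>g\<close> to the sum of the \<open>\<iota> j \<cdot> g j\<close>, is an isomorphism.
\<close>

definition compact_object :: "'u rel \<Rightarrow> ('o, 'm) triang_data \<Rightarrow> 'o \<Rightarrow> bool" where
  "compact_object \<kappa> D P \<longleftrightarrow>
     P \<in> Obj D \<and>
     (\<forall>(J :: 'u set) X S \<iota>. small \<kappa> J \<and> is_coproduct D J X S \<iota> \<longrightarrow>
        (\<lambda>g. gfinprod (hom_group D P S) (\<lambda>j. \<iota> j \<cdot>\<^bsub>D\<^esub> g j) J)
          \<in> iso (sum_group J (\<lambda>j. hom_group D P (X j))) (hom_group D P S))"

definition compact_arrows :: "'u rel \<Rightarrow> ('o, 'm) triang_data \<Rightarrow> 'm set" where
  "compact_arrows \<kappa> D =
     {f \<in> Arr D. compact_object \<kappa> D (Dom D f) \<and> compact_object \<kappa> D (Cod D f)}"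

locale compactly_generated_category = triangulated_category D
  for \<kappa> :: "'u rel" and D :: "('o, 'm) triang_data" (structure) +
  assumes locally_small: "\<lbrakk>A \<in> Obj D; B \<in> Obj D\<rbrakk> \<Longrightarrow> small \<kappa> (Hom D A B)"
    and small_coproducts: "has_small_coproducts \<kappa> D"
    and ex_generators: "\<exists>G. small \<kappa> G \<and> (\<forall>P \<in> G. compact_object \<kappa> D P) \<and>
      (\<forall>M \<in> Obj D.
        (\<forall>P \<in> G. \<forall>n. Hom D (shift_power D n P) M = {Zero D (shift_power D n P) M}) \<longrightarrow>
        zero_object D M)"


section \<open>Ideals of the category of compact objects\<close>

definition compact_ideal :: "'u rel \<Rightarrow> ('o, 'm) triang_data \<Rightarrow> 'm set \<Rightarrow> bool" where
  "compact_ideal \<kappa> D I \<longleftrightarrow>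
     I \<subseteq> compact_arrows \<kappa> D \<and>
     (\<forall>M N. compact_object \<kappa> D M \<and> compact_object \<kappa> D N \<longrightarrow>
        subgroup (I \<inter> Hom D M N) (hom_group D M N)) \<and>
     (\<forall>f \<in> compact_arrows \<kappa> D. \<forall>g \<in> I. \<forall>h \<in> compact_arrows \<kappa> D.
        Cod D f = Dom D g \<and> Cod D g = Dom D h \<longrightarrow> h \<cdot>\<^bsub>D\<^esub> g \<cdot>\<^bsub>D\<^esub> f \<in> I)"

text \<open>The product of the ideal with itself: the finite sums of composites of two morphisms of \<open>I\<close>.\<close>

definition ideal_square :: "'u rel \<Rightarrow> ('o, 'm) triang_data \<Rightarrow> 'm set \<Rightarrow> 'm set" where
  "ideal_square \<kappa> D I =
     {k \<in> compact_arrows \<kappa> D. k \<in> generate (hom_group D (Dom D k) (Cod D k))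
        {g \<cdot>\<^bsub>D\<^esub> f | f g. f \<in> I \<and> g \<in> I \<and>
           Dom D f = Dom D k \<and> Cod D f = Dom D g \<and> Cod D g = Cod D k}}"

definition idempotent_ideal :: "'u rel \<Rightarrow> ('o, 'm) triang_data \<Rightarrow> 'm set \<Rightarrow> bool" where
  "idempotent_ideal \<kappa> D I \<longleftrightarrow> I = ideal_square \<kappa> D I"

definition right_orthogonal :: "('o, 'm) triang_data \<Rightarrow> 'm set \<Rightarrow> 'o set" where
  "right_orthogonal D I =
     {Y \<in> Obj D. \<forall>f \<in> I. \<forall>u \<in> Hom D (Cod D f) Y. u \<cdot>\<^bsub>D\<^esub> f = Zero D (Dom D f) Y}"


section \<open>Subcategories, t-structures and Milnor colimits\<close>

text \<open>Full subcategories are given by their sets of objects.\<close>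

definition strictly_full :: "('o, 'm) triang_data \<Rightarrow> 'o set \<Rightarrow> bool" where
  "strictly_full D U \<longleftrightarrow>
     U \<subseteq> Obj D \<and> (\<forall>A \<in> U. \<forall>B \<in> Obj D. (\<exists>f. iso_arr D A B f) \<longrightarrow> B \<in> U)"

definition triangulated_subcategory :: "('o, 'm) triang_data \<Rightarrow> 'o set \<Rightarrow> bool" where
  "triangulated_subcategory D T \<longleftrightarrow>
     strictly_full D T \<and> T \<noteq> {} \<and>
     (\<forall>A \<in> Obj D. Sh D A \<in> T \<longleftrightarrow> A \<in> T) \<and>
     (\<forall>f g h. (f, g, h) \<in> Tri D \<and> Dom D f \<in> T \<and> Cod D f \<in> T \<longrightarrow> Cod D g \<in> T)"

definition closed_under_small_coproducts :: "'u rel \<Rightarrow> ('o, 'm) triang_data \<Rightarrow> 'o set \<Rightarrow> bool" where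
  "closed_under_small_coproducts \<kappa> D T \<longleftrightarrow>
     (\<forall>(J :: 'u set) X S \<iota>. small \<kappa> J \<and> is_coproduct D J X S \<iota> \<and> (\<forall>j \<in> J. X j \<in> T) \<longrightarrow> S \<in> T)"

definition Tria :: "'u rel \<Rightarrow> ('o, 'm) triang_data \<Rightarrow> 'o set \<Rightarrow> 'o set" where
  "Tria \<kappa> D P =
     \<Inter> {T. triangulated_subcategory D T \<and> closed_under_small_coproducts \<kappa> D T \<and> P \<subseteq> T}"

text \<open>\<open>t_structure D U W\<close> says that \<open>(U, W)\<close> is a t-structure; in the pair \<open>(U, V[1])\<close>, \<open>W\<close> is \<open>V[1]\<close>.\<close>

definition t_structure :: "('o, 'm) triang_data \<Rightarrow> 'o set \<Rightarrow> 'o set \<Rightarrow> bool" where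
  "t_structure D U W \<longleftrightarrow>
     (\<exists>V. W = Sh D ` V \<and> strictly_full D U \<and> strictly_full D V \<and>
        (\<forall>A \<in> U. \<forall>B \<in> V. Hom D A B = {Zero D A B}) \<and>
        Sh D ` U \<subseteq> U \<and> {B \<in> Obj D. Sh D B \<in> V} \<subseteq> V \<and>
        (\<forall>M \<in> Obj D. \<exists>f g h. (f, g, h) \<in> Tri D \<and> Dom D f \<in> U \<and> Cod D f = M \<and> Cod D g \<in> V))"

definition TTF_triple :: "('o, 'm) triang_data \<Rightarrow> 'o set \<Rightarrow> 'o set \<Rightarrow> 'o set \<Rightarrow> bool" where
  "TTF_triple D X Y Z \<longleftrightarrow> t_structure D X Y \<and> t_structure D Y Z"

definition Milnor_colimit ::
  "('o, 'm) triang_data \<Rightarrow> (nat \<Rightarrow> 'o) \<Rightarrow> (nat \<Rightarrow> 'm) \<Rightarrow> 'o \<Rightarrow> bool" where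
  "Milnor_colimit D M f C \<longleftrightarrow>
     (\<forall>n. f n \<in> Hom D (M n) (M (Suc n))) \<and>
     (\<exists>S \<iota> \<sigma> g h. is_coproduct D UNIV M S \<iota> \<and> \<sigma> \<in> Hom D S S \<and>
        (\<forall>n. \<sigma> \<cdot>\<^bsub>D\<^esub> \<iota> n = \<iota> (Suc n) \<cdot>\<^bsub>D\<^esub> f n) \<and>
        (Add D (Ident D S) (neg D \<sigma>), g, h) \<in> Tri D \<and> Cod D g = C)"

definition factors_through :: "('o, 'm) triang_data \<Rightarrow> 'm \<Rightarrow> 'o \<Rightarrow> bool" where
  "factors_through D f P \<longleftrightarrow>
     (\<exists>a \<in> Hom D (Dom D f) P. \<exists>b \<in> Hom D P (Cod D f). f = b \<cdot>\<^bsub>D\<^esub> a)"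

end

theory Submission
  imports Defs
begin

text \<open>
  For a small set \<open>Q\<close> of objects and an object \<open>M\<close>, build \<open>X \<rightarrow> M\<close> as the Milnor colimit of a
  sequence that starts with the coproduct of all maps \<open>C \<rightarrow> M\<close>, \<open>C \<in> Q\<close>, and at each step cones off
  all maps from \<open>Q\<close> that become zero in \<open>M\<close>. Three choices of \<open>Q\<close> give the theorem.

  If \<open>Q\<close> is a small set of compact objects that contains the shifts of the generators and is closed
  under cones and finite sums, then \<open>X \<rightarrow> M\<close> is split, and following a map from a compact object
  back through the construction shows that every compact object is a retract of a member of \<open>Q\<close>.
  Hence the ideal is determined by a small set of its morphisms. As \<open>I = I\<^sup>2\<close>, each of them
  factors as an infinite composition in \<open>I\<close>, hence through a Milnor colimit; these form \<open>P\<close>.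

  If \<open>Q = P\<close>, the cone of \<open>X \<rightarrow> M\<close> lies in \<open>Y = I\<^sup>\<bottom>\<close>: write a morphism of \<open>I\<close> as a composite \<open>b a\<close>
  in \<open>I\<close>; for a map \<open>u\<close> to the cone, \<open>u b\<close> lifts to \<open>M\<close> and then \<open>u b a = 0\<close>. The same splitting
  shows that \<open>Y\<close> is closed under extensions.

  Finally, the reflections into \<open>Y\<close> of the compact generators are compact relative to \<open>Y\<close> and
  generate it, so taking their shifts as \<open>Q\<close> gives the triangles of the second t-structure.
\<close>

section \<open>Additive categories\<close>

text \<open>Members of \<open>P\<close> are in general not compact, so a map from one of them into a
  Milnor colimit need not come from a finite stage, and kernels of maps out of \<open>P\<close> are
  not killed in the limit. What survives is weaker: a map from a relatively compact object that
  vanishes in \<open>M\<close> becomes zero after composition with a morphism factoring through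
  \<open>Q\<close>. Annihilating a map into the cone costs two such morphisms, one for the component
  in \<open>X[1]\<close> and one for the lift to \<open>M\<close>; a morphism of an idempotent ideal
  supplies both. When \<open>Q\<close> is shift-closed and consists of relatively compact objects,
  identities serve and the cone is orthogonal to \<open>Q\<close>. The detour through a small set of
  compact objects is forced by size: compact objects are only essentially small, and choosing a
  Milnor colimit for every morphism of \<open>I\<close> need not give a small set. Compactness
  relative to a localizing class occurs because a reflection into \<open>Y\<close> need not be
  compact in the whole category, although Hom out of it commutes with coproducts of members of
  \<open>Y\<close>. These are coproducts of the ambient category, as \<open>Y\<close> is closed
  under them.\<close>

context category
begin

lemma Hom_iff: "f \<in> Hom D A B \<longleftrightarrow> f \<in> Arr D \<and> Dom D f = A \<and> Cod D f = B"
  by (simp add: Hom_def)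

lemma Hom_objs:
  assumes "f \<in> Hom D A B"
  shows "A \<in> Obj D" and Hom_cod_obj: "B \<in> Obj D"
  using assms Dom_obj Cod_obj by (auto simp: Hom_iff)

declare Dom_obj [simp] Cod_obj [simp]

lemma Comp_Arr [simp]:
  assumes "f \<in> Arr D" "g \<in> Arr D" "Cod D f = Dom D g"
  shows "g \<cdot> f \<in> Arr D" "Dom D (g \<cdot> f) = Dom D f" "Cod D (g \<cdot> f) = Cod D g"
  using Comp_hom[of f "Dom D f" "Dom D g" g "Cod D g"] assms by (auto simp: Hom_iff)

lemma Ident_Arr [simp]:
  assumes "A \<in> Obj D"
  shows "Ident D A \<in> Arr D" "Dom D (Ident D A) = A" "Cod D (Ident D A) = A"
  using Ident_hom[OF assms] by (auto simp: Hom_iff)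

lemma Comp_Ident_eq [simp]: "f \<in> Arr D \<Longrightarrow> Dom D f = A \<Longrightarrow> f \<cdot> Ident D A = f"
  using Comp_Ident by (auto simp: Hom_iff)

lemma Ident_Comp_eq [simp]: "f \<in> Arr D \<Longrightarrow> Cod D f = A \<Longrightarrow> Ident D A \<cdot> f = f"
  using Ident_Comp by (auto simp: Hom_iff)

lemma Comp_assoc_eq [simp]:
  "\<lbrakk>f \<in> Arr D; g \<in> Arr D; h \<in> Arr D; Cod D f = Dom D g; Cod D g = Dom D h\<rbrakk> \<Longrightarrow>
    (h \<cdot> g) \<cdot> f = h \<cdot> g \<cdot> f"
  using Comp_assoc by (auto simp: Hom_iff)

text \<open>Composites are normalized to the right, so an equation for \<open>g \<cdot> f\<close> no
  longer matches inside a longer composite; this form applies it in front of a tail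
  \<open>x\<close>.\<close>

lemma Comp_reassoc:
  assumes "g \<cdot> f = k" "f \<in> Hom D A B" "g \<in> Hom D B C" "x \<in> Hom D E A"
  shows "g \<cdot> f \<cdot> x = k \<cdot> x"
  using Comp_assoc[of x E A f B g C] assms by simp

end

context additive_category
begin

abbreviation add (infixl \<open>\<boxplus>\<close> 65) where "f \<boxplus> g \<equiv> Add D f g"
abbreviation sub (infixl \<open>\<boxminus>\<close> 65) where "f \<boxminus> g \<equiv> Add D f (neg D g)"

lemma hom_group_simps [simp]:
  "carrier (hom_group D A B) = Hom D A B" "mult (hom_group D A B) = Add D"
  "one (hom_group D A B) = Zero D A B"
  by (simp_all add: hom_group_def)

lemma Zero_Arr [simp]:
  assumes "A \<in> Obj D" "B \<in> Obj D"
  shows "Zero D A B \<in> Arr D" "Dom D (Zero D A B) = A" "Cod D (Zero D A B) = B"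
proof -
  interpret comm_group "hom_group D A B" using hom_comm_group assms .
  show "Zero D A B \<in> Arr D" "Dom D (Zero D A B) = A" "Cod D (Zero D A B) = B"
    using one_closed by (auto simp: Hom_iff)
qed

lemma Add_Arr [simp]:
  assumes "f \<in> Arr D" "g \<in> Arr D" "Dom D f = Dom D g" "Cod D f = Cod D g"
  shows "f \<boxplus> g \<in> Arr D" "Dom D (f \<boxplus> g) = Dom D g" "Cod D (f \<boxplus> g) = Cod D g"
proof -
  interpret comm_group "hom_group D (Dom D g) (Cod D g)" using hom_comm_group assms by simp
  show "f \<boxplus> g \<in> Arr D" "Dom D (f \<boxplus> g) = Dom D g" "Cod D (f \<boxplus> g) = Cod D g"
    using m_closed[of f g] assms by (auto simp: Hom_iff)
qed

lemma neg_Arr [simp]: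
  assumes "f \<in> Arr D"
  shows "neg D f \<in> Arr D" "Dom D (neg D f) = Dom D f" "Cod D (neg D f) = Cod D f"
proof -
  interpret comm_group "hom_group D (Dom D f) (Cod D f)" using hom_comm_group assms by simp
  show "neg D f \<in> Arr D" "Dom D (neg D f) = Dom D f" "Cod D (neg D f) = Cod D f"
    using inv_closed[of f] assms by (auto simp: Hom_iff neg_def)
qed

lemma Add_assoc_eq:
  assumes "f \<in> Hom D A B" "g \<in> Hom D A B" "h \<in> Hom D A B"
  shows "(f \<boxplus> g) \<boxplus> h = f \<boxplus> (g \<boxplus> h)"
proof -
  interpret comm_group "hom_group D A B" using hom_comm_group Hom_objs[OF assms(1)] .
  show ?thesis using m_assoc assms by simp
qed

lemma Add_commute:
  assumes "f \<in> Hom D A B" "g \<in> Hom D A B"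
  shows "f \<boxplus> g = g \<boxplus> f"
proof -
  interpret comm_group "hom_group D A B" using hom_comm_group Hom_objs[OF assms(1)] .
  show ?thesis using m_comm assms by simp
qed

lemma Add_Zero [simp]:
  assumes "f \<in> Arr D" "Dom D f = A" "Cod D f = B"
  shows "f \<boxplus> Zero D A B = f" "Zero D A B \<boxplus> f = f"
proof -
  interpret comm_group "hom_group D A B" using hom_comm_group assms by auto
  show "f \<boxplus> Zero D A B = f" "Zero D A B \<boxplus> f = f"
    using l_one[of f] r_one[of f] assms by (auto simp: Hom_iff)
qed

lemma sub_self [simp]:
  assumes "f \<in> Arr D"
  shows "f \<boxminus> f = Zero D (Dom D f) (Cod D f)" "neg D f \<boxplus> f = Zero D (Dom D f) (Cod D f)"
proof -
  interpret comm_group "hom_group D (Dom D f) (Cod D f)" using hom_comm_group assms by auto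
  show "f \<boxminus> f = Zero D (Dom D f) (Cod D f)" "neg D f \<boxplus> f = Zero D (Dom D f) (Cod D f)"
    using r_inv[of f] l_inv[of f] assms by (auto simp: Hom_iff neg_def)
qed

lemma neg_unique:
  assumes "f \<in> Hom D A B" "g \<in> Hom D A B" "f \<boxplus> g = Zero D A B"
  shows "g = neg D f"
proof -
  interpret comm_group "hom_group D A B" using hom_comm_group Hom_objs[OF assms(1)] .
  show ?thesis using inv_unique'[of f g] m_comm[of f g] assms
    by (auto simp: neg_def Hom_iff)
qed

lemma Add_sub_cancel [simp]:
  assumes "f \<in> Arr D" "g \<in> Arr D" "Dom D f = Dom D g" "Cod D f = Cod D g"
  shows "f \<boxminus> g \<boxplus> g = f" "f \<boxplus> (g \<boxminus> f) = g" "g \<boxplus> (f \<boxminus> g) = f"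
proof -
  have 1: "f \<boxminus> g \<boxplus> g = f" if "f \<in> Arr D" "g \<in> Arr D" "Dom D f = Dom D g" "Cod D f = Cod D g" for f g
    using Add_assoc_eq[of f "Dom D f" "Cod D f" "neg D g" g] that by (simp add: Hom_iff)
  then have 2: "g \<boxplus> (f \<boxminus> g) = f" if "f \<in> Arr D" "g \<in> Arr D" "Dom D f = Dom D g" "Cod D f = Cod D g" for f g
    using Add_commute[of g "Dom D f" "Cod D f" "f \<boxminus> g"] that by (simp add: Hom_iff)
  from 1 2 assms show "f \<boxminus> g \<boxplus> g = f" "f \<boxplus> (g \<boxminus> f) = g" "g \<boxplus> (f \<boxminus> g) = f" by auto
qed

lemma sub_eq_Zero_iff:
  assumes "f \<in> Hom D A B" "g \<in> Hom D A B"
  shows "f \<boxminus> g = Zero D A B \<longleftrightarrow> f = g"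
proof
  assume "f \<boxminus> g = Zero D A B"
  then have "f \<boxminus> g \<boxplus> g = Zero D A B \<boxplus> g" by simp
  then show "f = g" using assms by (simp add: Hom_iff del: Add_sub_cancel(2,3))
qed (use assms in \<open>simp add: Hom_iff\<close>)

lemma Comp_Add_left_eq [simp]:
  "\<lbrakk>f \<in> Arr D; g \<in> Arr D; g' \<in> Arr D; Cod D f = Dom D g; Dom D g = Dom D g'; Cod D g = Cod D g'\<rbrakk> \<Longrightarrow>
    (g \<boxplus> g') \<cdot> f = g \<cdot> f \<boxplus> g' \<cdot> f"
  using Comp_Add_left[of f "Dom D f" "Dom D g" g "Cod D g" g'] by (simp add: Hom_iff)

lemma Comp_Add_right_eq [simp]:
  "\<lbrakk>f \<in> Arr D; f' \<in> Arr D; g \<in> Arr D; Cod D f = Dom D g; Dom D f = Dom D f'; Cod D f = Cod D f'\<rbrakk> \<Longrightarrow>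
    g \<cdot> (f \<boxplus> f') = g \<cdot> f \<boxplus> g \<cdot> f'"
  using Comp_Add_right[of f "Dom D f" "Dom D g" f' g "Cod D g"] by (simp add: Hom_iff)

text \<open>Cancellation in the Hom group. This is how the additive operations (composition on
  either side and the shift) are seen to preserve zero.\<close>

lemma Add_idem_Zero:
  assumes "f \<in> Hom D A B" "f \<boxplus> f = f"
  shows "f = Zero D A B"
proof -
  have "f = f \<boxplus> f \<boxminus> f"
    using Add_assoc_eq[of f A B f "neg D f"] assms(1) by (simp add: Hom_iff)
  also have "\<dots> = Zero D A B"
    using assms by (simp add: Hom_iff)
  finally show ?thesis .
qed

lemma Comp_Zero [simp]:
  assumes "f \<in> Arr D" "X \<in> Obj D"
  shows "A = Cod D f \<Longrightarrow> Zero D A X \<cdot> f = Zero D (Dom D f) X"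
    and "A = Dom D f \<Longrightarrow> f \<cdot> Zero D X A = Zero D X (Cod D f)"
proof -
  assume A: "A = Cod D f"
  have "Zero D A X \<cdot> f \<boxplus> Zero D A X \<cdot> f = (Zero D A X \<boxplus> Zero D A X) \<cdot> f"
    using assms A by (simp del: Add_Zero)
  also have "\<dots> = Zero D A X \<cdot> f" using assms A by simp
  finally show "Zero D A X \<cdot> f = Zero D (Dom D f) X"
    by (intro Add_idem_Zero) (use assms A in \<open>simp_all add: Hom_iff\<close>)
next
  assume A: "A = Dom D f"
  have "f \<cdot> Zero D X A \<boxplus> f \<cdot> Zero D X A = f \<cdot> (Zero D X A \<boxplus> Zero D X A)"
    using assms A by (simp del: Add_Zero)
  also have "\<dots> = f \<cdot> Zero D X A" using assms A by simp
  finally show "f \<cdot> Zero D X A = Zero D X (Cod D f)"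
    by (intro Add_idem_Zero) (use assms A in \<open>simp_all add: Hom_iff\<close>)
qed

lemma Comp_neg_left [simp]:
  assumes "f \<in> Arr D" "g \<in> Arr D" "Cod D f = Dom D g"
  shows "neg D g \<cdot> f = neg D (g \<cdot> f)"
proof (rule neg_unique)
  have "g \<cdot> f \<boxplus> neg D g \<cdot> f = (g \<boxminus> g) \<cdot> f"
    using assms by (simp del: sub_self)
  also have "\<dots> = Zero D (Dom D f) (Cod D g)" using assms by simp
  finally show "g \<cdot> f \<boxplus> neg D g \<cdot> f = Zero D (Dom D f) (Cod D g)" .
qed (use assms in \<open>simp_all add: Hom_iff\<close>)

lemma Comp_neg_right [simp]:
  assumes "f \<in> Arr D" "g \<in> Arr D" "Cod D f = Dom D g"
  shows "g \<cdot> neg D f = neg D (g \<cdot> f)"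
proof (rule neg_unique)
  have "g \<cdot> f \<boxplus> g \<cdot> neg D f = g \<cdot> (f \<boxminus> f)"
    using assms by (simp del: sub_self)
  also have "\<dots> = Zero D (Dom D f) (Cod D g)" using assms by simp
  finally show "g \<cdot> f \<boxplus> g \<cdot> neg D f = Zero D (Dom D f) (Cod D g)" .
qed (use assms in \<open>simp_all add: Hom_iff\<close>)

lemma neg_neg [simp]: "f \<in> Arr D \<Longrightarrow> neg D (neg D f) = f"
  using neg_unique[of "neg D f" "Dom D f" "Cod D f" f] by (simp add: Hom_iff)

lemma neg_inject: "\<lbrakk>neg D f = neg D g; f \<in> Arr D; g \<in> Arr D\<rbrakk> \<Longrightarrow> f = g"
  using neg_neg by metis

lemma neg_Zero [simp]: "A \<in> Obj D \<Longrightarrow> B \<in> Obj D \<Longrightarrow> neg D (Zero D A B) = Zero D A B"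
  using neg_unique[of "Zero D A B" A B "Zero D A B"] by (simp add: Hom_iff)

lemma zero_object_Hom:
  assumes "zero_object D Z"
  shows "f \<in> Hom D A Z \<Longrightarrow> f = Zero D A Z" "f \<in> Hom D Z A \<Longrightarrow> f = Zero D Z A"
proof -
  have Z: "Z \<in> Obj D" using assms by (simp add: zero_object_def)
  show "f = Zero D A Z" if "f \<in> Hom D A Z"
    using assms that Hom_objs[OF that] Z by (auto simp: zero_object_def Hom_iff)
  show "f = Zero D Z A" if "f \<in> Hom D Z A"
    using assms that Hom_objs[OF that] Z by (auto simp: zero_object_def Hom_iff)
qed

lemma zero_objectI:
  assumes "Z \<in> Obj D" "Ident D Z = Zero D Z Z"
  shows "zero_object D Z"
proof -
  have 1: "f = Zero D A Z" if "f \<in> Hom D A Z" for f A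
    using Ident_Comp[OF that] that assms by (auto simp: Hom_iff)
  have 2: "f = Zero D Z A" if "f \<in> Hom D Z A" for f A
    using Comp_Ident[OF that] that assms by (auto simp: Hom_iff)
  show ?thesis unfolding zero_object_def
  proof (intro conjI ballI)
    fix A assume "A \<in> Obj D"
    then have "Zero D A Z \<in> Hom D A Z" "Zero D Z A \<in> Hom D Z A"
      using assms(1) by (simp_all add: Hom_iff)
    with 1 2 show "\<exists>!f. f \<in> Hom D A Z" "\<exists>!f. f \<in> Hom D Z A" by blast+
  qed (fact assms(1))
qed

end

section \<open>Triangulated categories\<close>

context triangulated_category
begin

lemma Sh_obj [simp]: "A \<in> Obj D \<Longrightarrow> Sh D A \<in> Obj D"
  using Sh_bij by (auto simp: bij_betw_def)

lemma Sh_inj: "\<lbrakk>Sh D A = Sh D B; A \<in> Obj D; B \<in> Obj D\<rbrakk> \<Longrightarrow> A = B"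
  using Sh_bij by (auto simp: bij_betw_def inj_on_def)

lemma Sh_inv:
  assumes "A \<in> Obj D"
  shows "inv_into (Obj D) (Sh D) A \<in> Obj D" "Sh D (inv_into (Obj D) (Sh D) A) = A"
  using assms Sh_bij by (simp_all add: bij_betw_def inv_into_into f_inv_into_f)

lemma Sh_surj:
  assumes "B \<in> Obj D" obtains A where "A \<in> Obj D" "Sh D A = B"
  using Sh_inv[OF assms] that by blast

lemma ShM_Arr [simp]:
  assumes "f \<in> Arr D"
  shows "ShM D f \<in> Arr D" "Dom D (ShM D f) = Sh D (Dom D f)" "Cod D (ShM D f) = Sh D (Cod D f)"
  using ShM_hom[of f "Dom D f" "Cod D f"] assms by (auto simp: Hom_iff)

lemma ShM_Comp_eq [simp]:
  "\<lbrakk>f \<in> Arr D; g \<in> Arr D; Cod D f = Dom D g\<rbrakk> \<Longrightarrow> ShM D (g \<cdot> f) = ShM D g \<cdot> ShM D f"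
  using ShM_Comp by (simp add: Hom_iff)

lemma ShM_inj: "\<lbrakk>ShM D f = ShM D g; f \<in> Arr D; g \<in> Arr D\<rbrakk> \<Longrightarrow> f = g"
  using ShM_bij by (auto simp: bij_betw_def inj_on_def)

text \<open>Bijectivity of the shift on arrows gives a preimage; its injectivity on objects then
  fixes domain and codomain.\<close>

lemma ShM_full:
  assumes "v \<in> Hom D (Sh D A) (Sh D B)" "A \<in> Obj D" "B \<in> Obj D"
  obtains w where "w \<in> Hom D A B" "ShM D w = v"
proof -
  obtain w where w: "w \<in> Arr D" "ShM D w = v"
    using assms(1) ShM_bij by (metis bij_betw_def imageE Hom_iff)
  then have "Dom D w = A" "Cod D w = B"
    using assms Sh_inj[of "Dom D w" A] Sh_inj[of "Cod D w" B] ShM_Arr[of w]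
    by (auto simp: Hom_iff)
  with w that show ?thesis by (simp add: Hom_iff)
qed

lemma ShM_Zero [simp]:
  assumes "A \<in> Obj D" "B \<in> Obj D"
  shows "ShM D (Zero D A B) = Zero D (Sh D A) (Sh D B)"
proof -
  have "ShM D (Zero D A B) \<boxplus> ShM D (Zero D A B) = ShM D (Zero D A B)"
    using ShM_Add[of "Zero D A B" A B "Zero D A B"] assms by (simp add: Hom_iff del: ShM_Arr)
  then show ?thesis
    by (intro Add_idem_Zero) (use assms in \<open>simp_all add: Hom_iff\<close>)
qed

lemma ShM_eq_Zero:
  assumes "f \<in> Hom D A B" "ShM D f = Zero D (Sh D A) (Sh D B)"
  shows "f = Zero D A B"
  using ShM_inj[of f "Zero D A B"] assms Hom_objs[OF assms(1)] by (simp add: Hom_iff)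

lemma zero_object_unSh:
  assumes "Z \<in> Obj D" "zero_object D (Sh D Z)"
  shows "zero_object D Z"
proof (rule zero_objectI)
  have "ShM D (Ident D Z) = Zero D (Sh D Z) (Sh D Z)"
    using zero_object_Hom(1)[OF assms(2), of "ShM D (Ident D Z)" "Sh D Z"] assms(1)
    by (simp add: Hom_iff)
  then show "Ident D Z = Zero D Z Z"
    using ShM_eq_Zero[of "Ident D Z" Z Z] assms(1) by (simp add: Hom_iff)
qed (fact assms(1))

section \<open>Triangles with named vertices and exactness of Hom functors\<close>

definition tri :: "'a \<Rightarrow> 'a \<Rightarrow> 'a \<Rightarrow> 'b \<Rightarrow> 'b \<Rightarrow> 'b \<Rightarrow> bool" where
  "tri A B C f g h \<longleftrightarrow>
     (f, g, h) \<in> Tri D \<and> f \<in> Hom D A B \<and> g \<in> Hom D B C \<and> h \<in> Hom D C (Sh D A)"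

lemma triD:
  assumes "tri A B C f g h"
  shows "(f, g, h) \<in> Tri D" "f \<in> Hom D A B" "g \<in> Hom D B C" "h \<in> Hom D C (Sh D A)"
    "A \<in> Obj D" "B \<in> Obj D" "C \<in> Obj D"
  using assms by (auto simp: tri_def Hom_iff)

lemma Tri_tri: "(f, g, h) \<in> Tri D \<Longrightarrow> tri (Dom D f) (Cod D f) (Cod D g) f g h"
  using Tri_composable[of f g h] by (auto simp: tri_def Hom_iff)

lemma tri_cone:
  assumes "f \<in> Hom D A B" obtains C g h where "tri A B C f g h"
  using TR1_cone[of f] Tri_tri assms by (fastforce simp: Hom_iff)

lemma tri_rotate: "tri A B C f g h \<Longrightarrow> tri B C (Sh D A) g h (neg D (ShM D f))"
  using TR2[of f A B g C h] by (auto simp: tri_def Hom_iff)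

text \<open>The shift is an automorphism and not just an equivalence, so a rotation can be undone on
  the nose. The sign in \<open>ShM D k = neg D h\<close> cancels the one that the rotation axiom
  puts on the shifted first map.\<close>

lemma tri_rotate_back:
  assumes "tri A B C f g h"
  obtains C' k where "C' \<in> Obj D" "Sh D C' = C" "ShM D k = neg D h" "tri C' A B k f g"
proof -
  obtain C' where C': "C' \<in> Obj D" "Sh D C' = C" using Sh_surj triD[OF assms] by blast
  have "neg D h \<in> Hom D (Sh D C') (Sh D A)" using triD(4)[OF assms] C' by (simp add: Hom_iff)
  then obtain k where k: "k \<in> Hom D C' A" "ShM D k = neg D h"
    using ShM_full C' triD(5)[OF assms] by metis
  have "tri C' A B k f g"
    unfolding tri_def using TR2[of k C' A f B g] triD[OF assms] C' k by (auto simp: Hom_iff)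
  with that C' k show ?thesis by blast
qed

lemma tri_Ident:
  assumes "A \<in> Obj D" "zero_object D Z"
  shows "tri A A Z (Ident D A) (Zero D A Z) (Zero D Z (Sh D A))"
  using TR1_Ident[OF assms] assms by (simp add: tri_def Hom_iff zero_object_def)

lemma tri_map:
  assumes "tri A B C f g h" "tri A' B' C' f' g' h'"
    "a \<in> Hom D A A'" "b \<in> Hom D B B'" "b \<cdot> f = f' \<cdot> a"
  obtains c where "c \<in> Hom D C C'" "c \<cdot> g = g' \<cdot> b" "ShM D a \<cdot> h = h' \<cdot> c"
  using TR3[of f g h f' g' h' a b] assms that by (auto simp: tri_def Hom_iff)

text \<open>Comparison with the triangle on the identity of \<open>A\<close>, whose third vertex is
  zero: the filled-in map exhibits \<open>g \<cdot> f\<close> as factoring through a zero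
  object.\<close>

lemma tri_comp_Zero:
  assumes "tri A B C f g h"
  shows "g \<cdot> f = Zero D A C"
proof -
  obtain Z where Z: "zero_object D Z" using ex_zero_object by blast
  note T = triD[OF assms]
  obtain c where c: "c \<in> Hom D Z C" "c \<cdot> Zero D A Z = g \<cdot> f"
    by (rule tri_map[OF tri_Ident[OF T(5) Z] assms, of "Ident D A" f])
      (use T in \<open>auto simp: Hom_iff\<close>)
  then show ?thesis using T Z by (auto simp: Hom_iff zero_object_def)
qed

lemma tri_comp_Zero2: "tri A B C f g h \<Longrightarrow> h \<cdot> g = Zero D B (Sh D A)"
  using tri_comp_Zero tri_rotate by blast

lemma tri_comp_Zero3:
  assumes "tri A B C f g h"
  shows "ShM D f \<cdot> h = Zero D C (Sh D B)"
proof -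
  have 1: "neg D (ShM D f) \<cdot> h = Zero D C (Sh D B)"
    using tri_comp_Zero2[OF tri_rotate[OF assms]] .
  have "neg D (neg D (ShM D f) \<cdot> h) = ShM D f \<cdot> h"
    using triD[OF assms] by (simp add: Hom_iff)
  with 1 show ?thesis using triD[OF assms] by (simp add: Hom_iff)
qed

text \<open>The target of the comparison is a triangle \<open>Z' -> X -> X\<close> with identity in
  the middle and \<open>Z'\<close> zero; the third map supplied by the axiom is then the
  extension.\<close>

lemma tri_extend:
  assumes "tri A B C f g h" "u \<in> Hom D B X" "u \<cdot> f = Zero D A X"
  obtains w where "w \<in> Hom D C X" "w \<cdot> g = u"
proof -
  obtain Z where Z: "zero_object D Z" using ex_zero_object by blast
  note T = triD[OF assms(1)]
  have X: "X \<in> Obj D" using Hom_objs assms(2) by blast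
  obtain Z' k where Z': "Z' \<in> Obj D" "Sh D Z' = Z" and
    t: "tri Z' X X k (Ident D X) (Zero D X Z)"
    using tri_rotate_back[OF tri_Ident[OF X Z]] by metis
  have "zero_object D Z'" using zero_object_unSh Z Z' by blast
  then have k: "k = Zero D Z' X" using zero_object_Hom(2) triD(2)[OF t] by blast
  show ?thesis
    by (rule tri_map[OF assms(1) t, of "Zero D A Z'" u])
      (use T assms(2,3) X Z' k that in \<open>auto simp: Hom_iff\<close>)
qed

text \<open>The axiom supplies only a third map, while a first map is wanted here. Both triangles
  are therefore rotated once, the lift is found in shifted form, and the shift is removed.\<close>

lemma tri_lift:
  assumes "tri A B C f g h" "u \<in> Hom D X B" "g \<cdot> u = Zero D X C"
  obtains w where "w \<in> Hom D X A" "f \<cdot> w = u"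
proof -
  obtain Z where Z: "zero_object D Z" using ex_zero_object by blast
  have Zo: "Z \<in> Obj D" using Z by (simp add: zero_object_def)
  note T = triD[OF assms(1)]
  have X: "X \<in> Obj D" using Hom_objs assms(2) by blast
  obtain c where c: "c \<in> Hom D (Sh D X) (Sh D A)"
    "ShM D u \<cdot> neg D (ShM D (Ident D X)) = neg D (ShM D f) \<cdot> c"
    by (rule tri_map[OF tri_rotate[OF tri_Ident[OF X Z]] tri_rotate[OF assms(1)], of u "Zero D Z C"])
      (use T assms(2,3) X Zo in \<open>auto simp: Hom_iff\<close>)
  obtain w where w: "w \<in> Hom D X A" "ShM D w = c" using ShM_full c(1) X T by metis
  have "neg D (ShM D u) = neg D (ShM D (f \<cdot> w))"
    using c w assms(2) T X by (auto simp: Hom_iff ShM_Ident)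
  then have "ShM D u = ShM D (f \<cdot> w)"
    by (rule neg_inject) (use w(1) assms(2) T in \<open>simp_all add: Hom_iff\<close>)
  then have "u = f \<cdot> w" by (rule ShM_inj) (use w assms(2) T in \<open>auto simp: Hom_iff\<close>)
  with w that show ?thesis by blast
qed

lemma tri_extend2:
  assumes "tri A B C f g h" "u \<in> Hom D C X" "u \<cdot> g = Zero D B X"
  obtains w where "w \<in> Hom D (Sh D A) X" "w \<cdot> h = u"
  using tri_extend[OF tri_rotate[OF assms(1)] assms(2,3)] that by blast

lemma tri_lift2:
  assumes "tri A B C f g h" "u \<in> Hom D X C" "h \<cdot> u = Zero D X (Sh D A)"
  obtains w where "w \<in> Hom D X B" "g \<cdot> w = u"
  using tri_lift[OF tri_rotate[OF assms(1)] assms(2,3)] that by blast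

lemma tri_map_left:
  assumes "tri A B C f g h" "tri A' B' C' f' g' h'"
    "b \<in> Hom D B B'" "c \<in> Hom D C C'" "c \<cdot> g = g' \<cdot> b"
  obtains a where "a \<in> Hom D A A'" "b \<cdot> f = f' \<cdot> a" "ShM D a \<cdot> h = h' \<cdot> c"
proof -
  note T = triD[OF assms(1)] and T' = triD[OF assms(2)]
  obtain a' where a': "a' \<in> Hom D (Sh D A) (Sh D A')" "a' \<cdot> h = h' \<cdot> c"
    "ShM D b \<cdot> neg D (ShM D f) = neg D (ShM D f') \<cdot> a'"
    by (rule tri_map[OF tri_rotate[OF assms(1)] tri_rotate[OF assms(2)] assms(3,4,5)])
  obtain a where a: "a \<in> Hom D A A'" "ShM D a = a'" using ShM_full a'(1) T T' by metis
  have "neg D (ShM D (b \<cdot> f)) = neg D (ShM D (f' \<cdot> a))"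
    using a' a assms(3) T T' by (auto simp: Hom_iff)
  then have "ShM D (b \<cdot> f) = ShM D (f' \<cdot> a)"
    by (rule neg_inject) (use a(1) assms(3) T T' in \<open>simp_all add: Hom_iff\<close>)
  then have "b \<cdot> f = f' \<cdot> a"
    by (rule ShM_inj) (use a assms(3) T T' in \<open>auto simp: Hom_iff\<close>)
  with a a' that show ?thesis by blast
qed

text \<open>With zero cone the identity of \<open>B\<close> lifts along \<open>f\<close>. Having
  \<open>B\<close> as a retract of \<open>A\<close> is the form in which vanishing cones are
  exploited later.\<close>

lemma tri_zero_cone_section:
  assumes "tri A B C f g h" "zero_object D C"
  obtains s where "s \<in> Hom D B A" "f \<cdot> s = Ident D B"
proof (rule tri_lift[OF assms(1), of "Ident D B" B])
  note T = triD[OF assms(1)]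
  show "Ident D B \<in> Hom D B B" using T by (simp add: Hom_iff)
  show "g \<cdot> Ident D B = Zero D B C"
    using T zero_object_Hom(1)[OF assms(2) T(3)] by (simp add: Hom_iff)
qed (use that in blast)

end

section \<open>Coproducts\<close>

lemma is_coproductD:
  assumes "is_coproduct D J X S \<iota>"
  shows "S \<in> Obj D" "j \<in> J \<Longrightarrow> X j \<in> Obj D" "j \<in> J \<Longrightarrow> \<iota> j \<in> Hom D (X j) S"
  using assms by (auto simp: is_coproduct_def)

lemma is_coproduct_ex:
  assumes "is_coproduct D J X S \<iota>" "T \<in> Obj D" "\<And>j. j \<in> J \<Longrightarrow> f j \<in> Hom D (X j) T"
  obtains u where "u \<in> Hom D S T" "\<And>j. j \<in> J \<Longrightarrow> u \<cdot>\<^bsub>D\<^esub> \<iota> j = f j"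
  using assms unfolding is_coproduct_def by metis

text \<open>The definitions quantify over index sets in \<open>'u\<close> only; coproducts indexed
  by naturals or by sets of morphisms are carried there along a bijection.\<close>

lemma is_coproduct_reindex:
  assumes "is_coproduct D J X S \<iota>" "bij_betw r J' J"
  shows "is_coproduct D J' (X \<circ> r) S (\<iota> \<circ> r)"
  unfolding is_coproduct_def
proof (intro conjI ballI allI impI)
  have r: "r j \<in> J" if "j \<in> J'" for j using assms(2) that by (auto simp: bij_betw_def)
  note C = is_coproductD[OF assms(1)]
  show "S \<in> Obj D" by (fact C)
  show "(X \<circ> r) j \<in> Obj D" "(\<iota> \<circ> r) j \<in> Hom D ((X \<circ> r) j) S" if "j \<in> J'" for j
    using C r that by auto
  fix T f assume T: "T \<in> Obj D" "\<forall>j\<in>J'. f j \<in> Hom D ((X \<circ> r) j) T"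
  let ?g = "\<lambda>j. f (inv_into J' r j)"
  have inv: "inv_into J' r (r j) = j" if "j \<in> J'" for j
    using assms(2) that by (simp add: bij_betw_def inv_into_f_f)
  have J: "J = r ` J'" using assms(2) by (simp add: bij_betw_def)
  have "\<forall>j\<in>J. ?g j \<in> Hom D (X j) T" using T(2) inv by (auto simp: J)
  then have "\<exists>!u. u \<in> Hom D S T \<and> (\<forall>j\<in>J. u \<cdot>\<^bsub>D\<^esub> \<iota> j = ?g j)"
    using assms(1) T(1) by (simp add: is_coproduct_def)
  then show "\<exists>!u. u \<in> Hom D S T \<and> (\<forall>j\<in>J'. u \<cdot>\<^bsub>D\<^esub> (\<iota> \<circ> r) j = f j)"
    by (simp add: J inv)
qed

context category
begin

lemma is_coproduct_eqI:
  assumes "is_coproduct D J X S \<iota>" "u \<in> Hom D S T" "v \<in> Hom D S T"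
    "\<And>j. j \<in> J \<Longrightarrow> u \<cdot> \<iota> j = v \<cdot> \<iota> j"
  shows "u = v"
proof -
  note C = is_coproductD[OF assms(1)]
  have "\<forall>f. (\<forall>j\<in>J. f j \<in> Hom D (X j) T) \<longrightarrow>
      (\<exists>!u. u \<in> Hom D S T \<and> (\<forall>j\<in>J. u \<cdot> \<iota> j = f j))"
    using assms(1) Hom_cod_obj[OF assms(3)] by (simp add: is_coproduct_def)
  then have "\<exists>!w. w \<in> Hom D S T \<and> (\<forall>j\<in>J. w \<cdot> \<iota> j = v \<cdot> \<iota> j)"
    using Comp_hom[OF C(3) assms(3)] by simp
  then show ?thesis using assms by (elim ex1E) metis
qed

end

context additive_category
begin

text \<open>A finite sum of maps through the summands of a coproduct is encoded as a map fixed by the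
  idempotent that cuts the coproduct down to finitely many summands, so that no sums have to be
  manipulated.\<close>

definition is_cut :: "'i set \<Rightarrow> 'a \<Rightarrow> ('i \<Rightarrow> 'b) \<Rightarrow> 'i set \<Rightarrow> 'b \<Rightarrow> bool" where
  "is_cut J S \<iota> F e \<longleftrightarrow>
     e \<in> Hom D S S \<and> (\<forall>j\<in>J. e \<cdot> \<iota> j = (if j \<in> F then \<iota> j else Zero D (Dom D (\<iota> j)) S))"

definition is_proj :: "'i set \<Rightarrow> ('i \<Rightarrow> 'a) \<Rightarrow> 'a \<Rightarrow> ('i \<Rightarrow> 'b) \<Rightarrow> 'i \<Rightarrow> 'b \<Rightarrow> bool" where
  "is_proj J X S \<iota> k p \<longleftrightarrow>
     p \<in> Hom D S (X k) \<and> (\<forall>j\<in>J. p \<cdot> \<iota> j = (if j = k then Ident D (X k) else Zero D (X j) (X k)))"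

definition fin_supp :: "'i set \<Rightarrow> 'a \<Rightarrow> ('i \<Rightarrow> 'b) \<Rightarrow> 'b \<Rightarrow> bool" where
  "fin_supp J S \<iota> u \<longleftrightarrow> (\<exists>F e. finite F \<and> F \<subseteq> J \<and> is_cut J S \<iota> F e \<and> e \<cdot> u = u)"

lemma is_cut_ex:
  assumes "is_coproduct D J X S \<iota>" obtains e where "is_cut J S \<iota> F e"
proof -
  note C = is_coproductD[OF assms]
  obtain e where "e \<in> Hom D S S"
    "\<And>j. j \<in> J \<Longrightarrow> e \<cdot> \<iota> j = (if j \<in> F then \<iota> j else Zero D (Dom D (\<iota> j)) S)"
    by (rule is_coproduct_ex[OF assms C(1), of "\<lambda>j. if j \<in> F then \<iota> j else Zero D (Dom D (\<iota> j)) S"])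
      (use C in \<open>auto simp: Hom_iff\<close>)
  with that show ?thesis by (auto simp: is_cut_def)
qed

lemma is_proj_ex:
  assumes "is_coproduct D J X S \<iota>" "k \<in> J" obtains p where "is_proj J X S \<iota> k p"
proof -
  note C = is_coproductD[OF assms(1)]
  obtain p where "p \<in> Hom D S (X k)"
    "\<And>j. j \<in> J \<Longrightarrow> p \<cdot> \<iota> j = (if j = k then Ident D (X k) else Zero D (X j) (X k))"
    by (rule is_coproduct_ex[OF assms(1) C(2)[OF assms(2)],
          of "\<lambda>j. if j = k then Ident D (X k) else Zero D (X j) (X k)"])
      (use C assms(2) in \<open>auto simp: Hom_iff\<close>)
  with that show ?thesis by (auto simp: is_proj_def)
qed

lemma is_cut_mono:
  assumes "is_coproduct D J X S \<iota>" "is_cut J S \<iota> F e" "is_cut J S \<iota> G e'" "F \<subseteq> G"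
  shows "e' \<cdot> e = e"
proof (rule is_coproduct_eqI[OF assms(1)])
  have H: "e \<in> Hom D S S" "e' \<in> Hom D S S" using assms(2,3) by (simp_all add: is_cut_def)
  then show "e' \<cdot> e \<in> Hom D S S" "e \<in> Hom D S S" by (auto intro: Comp_hom)
  note C = is_coproductD[OF assms(1)]
  fix j assume j: "j \<in> J"
  have "(e' \<cdot> e) \<cdot> \<iota> j = e' \<cdot> e \<cdot> \<iota> j"
    using H C(3)[OF j] by (simp add: Hom_iff)
  moreover have "e \<cdot> \<iota> j = (if j \<in> F then \<iota> j else Zero D (X j) S)"
    "e' \<cdot> \<iota> j = (if j \<in> G then \<iota> j else Zero D (X j) S)"
    using assms(2,3) C(3)[OF j] j by (auto simp: is_cut_def Hom_iff)
  ultimately show "(e' \<cdot> e) \<cdot> \<iota> j = e \<cdot> \<iota> j"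
    using H C(1) C(2)[OF j] assms(4) by (auto simp: Hom_iff)
qed

lemma is_cut_empty:
  assumes "is_coproduct D J X S \<iota>" "is_cut J S \<iota> {} e"
  shows "e = Zero D S S"
proof (rule is_coproduct_eqI[OF assms(1)])
  note C = is_coproductD[OF assms(1)]
  show "e \<in> Hom D S S" "Zero D S S \<in> Hom D S S"
    using assms(2) C(1) by (simp_all add: is_cut_def Hom_iff)
  fix j assume "j \<in> J"
  then show "e \<cdot> \<iota> j = Zero D S S \<cdot> \<iota> j"
    using assms(2) C(1) C(3)[of j] by (simp add: is_cut_def Hom_iff)
qed

lemma is_cut_insert:
  assumes "is_coproduct D J X S \<iota>" "is_cut J S \<iota> F e" "is_cut J S \<iota> (insert k F) e'"
    "is_proj J X S \<iota> k p" "k \<notin> F" "k \<in> J"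
  shows "e' = \<iota> k \<cdot> p \<boxplus> e"
proof (rule is_coproduct_eqI[OF assms(1)])
  note C = is_coproductD[OF assms(1)]
  have H: "e \<in> Hom D S S" "e' \<in> Hom D S S" "p \<in> Hom D S (X k)"
    using assms(2-4) by (simp_all add: is_cut_def is_proj_def)
  show "e' \<in> Hom D S S" by (fact H)
  show "\<iota> k \<cdot> p \<boxplus> e \<in> Hom D S S"
    using H C(1) C(3)[OF assms(6)] by (simp add: Hom_iff)
  fix j assume j: "j \<in> J"
  have eqs: "e \<cdot> \<iota> j = (if j \<in> F then \<iota> j else Zero D (X j) S)"
    "e' \<cdot> \<iota> j = (if j = k \<or> j \<in> F then \<iota> j else Zero D (X j) S)"
    "p \<cdot> \<iota> j = (if j = k then Ident D (X k) else Zero D (X j) (X k))"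
    using assms(2-4) C(3)[OF j] j by (simp_all add: is_cut_def is_proj_def Hom_iff)
  have "(\<iota> k \<cdot> p \<boxplus> e) \<cdot> \<iota> j = \<iota> k \<cdot> p \<cdot> \<iota> j \<boxplus> e \<cdot> \<iota> j"
    using H C(1) C(2,3)[OF j] C(2,3)[OF assms(6)] by (simp add: Hom_iff)
  then show "e' \<cdot> \<iota> j = (\<iota> k \<cdot> p \<boxplus> e) \<cdot> \<iota> j"
    using H C(1) C(2,3)[OF j] C(2,3)[OF assms(6)] assms(5) unfolding eqs
    by (auto simp: Hom_iff)
qed

text \<open>Since the cut at a finite set is a sum of the maps \<open>\<iota> j \<cdot> p j\<close>, a finitely supported morphism
  is controlled by its components.\<close>

lemma is_cut_comp_induct:
  assumes C: "is_coproduct D J X S \<iota>" and F: "finite F" "F \<subseteq> J" and e: "is_cut J S \<iota> F e"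
    and u: "u \<in> Hom D B S"
    and Z: "Zero D B S \<in> K"
    and A: "\<And>v w. \<lbrakk>v \<in> K; w \<in> K; v \<in> Hom D B S; w \<in> Hom D B S\<rbrakk> \<Longrightarrow> v \<boxplus> w \<in> K"
    and I: "\<And>j p. \<lbrakk>j \<in> F; is_proj J X S \<iota> j p\<rbrakk> \<Longrightarrow> \<iota> j \<cdot> p \<cdot> u \<in> K"
  shows "e \<cdot> u \<in> K"
  using F e I
proof (induction F arbitrary: e rule: finite_induct)
  case empty
  then have "e = Zero D S S" using is_cut_empty[OF C] by blast
  then have "e \<cdot> u = Zero D B S"
    using u is_coproductD(1)[OF C] by (simp add: Hom_iff)
  then show ?case using Z by simp
next
  case (insert k F)
  obtain p where p: "is_proj J X S \<iota> k p" using is_proj_ex[OF C] insert by blast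
  obtain e0 where e0: "is_cut J S \<iota> F e0" using is_cut_ex[OF C] by blast
  note D = is_coproductD[OF C]
  have k: "k \<in> J" using insert by blast
  have H: "e0 \<in> Hom D S S" "p \<in> Hom D S (X k)"
    using e0 p by (simp_all add: is_cut_def is_proj_def)
  have K: "e0 \<cdot> u \<in> K" "\<iota> k \<cdot> p \<cdot> u \<in> K" using insert e0 p by blast+
  have "e = \<iota> k \<cdot> p \<boxplus> e0" using is_cut_insert[OF C e0 _ p] insert k by blast
  then have "e \<cdot> u = \<iota> k \<cdot> p \<cdot> u \<boxplus> e0 \<cdot> u"
    using u H D(1) D(2,3)[OF k] by (simp add: Hom_iff)
  then show ?case
    using A[OF K(2,1)] u H D(1) D(2,3)[OF k] by (simp add: Hom_iff)
qed

text \<open>Projections of a coproduct are not assumed to be jointly monic. Finite support makes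
  them so for \<open>u\<close>, because the cut fixing \<open>u\<close> is a finite sum of maps that
  begin with projections.\<close>

lemma fin_supp_eq_Zero:
  assumes C: "is_coproduct D J X S \<iota>" and "fin_supp J S \<iota> u" and u: "u \<in> Hom D B S"
    and z: "\<And>j p. \<lbrakk>j \<in> J; is_proj J X S \<iota> j p\<rbrakk> \<Longrightarrow> p \<cdot> u = Zero D B (X j)"
  shows "u = Zero D B S"
proof -
  obtain F e where F: "finite F" "F \<subseteq> J" and e: "is_cut J S \<iota> F e" and eu: "e \<cdot> u = u"
    using assms(2) by (auto simp: fin_supp_def)
  note D = is_coproductD[OF C]
  have "e \<cdot> u \<in> {Zero D B S}"
  proof (rule is_cut_comp_induct[OF C F e u])
    fix j p assume j: "j \<in> F" "is_proj J X S \<iota> j p"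
    then have "j \<in> J" using F by blast
    then show "\<iota> j \<cdot> p \<cdot> u \<in> {Zero D B S}"
      using z[OF _ j(2)] D(2,3)[of j] Hom_objs[OF u] by (auto simp: Hom_iff)
  qed (use Hom_objs[OF u] in \<open>auto simp: Hom_iff\<close>)
  then show ?thesis using eu by simp
qed

lemma fin_supp_comp:
  assumes "is_coproduct D J X S \<iota>" "fin_supp J S \<iota> u" "u \<in> Hom D B S" "w \<in> Hom D A B"
  shows "fin_supp J S \<iota> (u \<cdot> w)"
proof -
  obtain F e where e: "finite F" "F \<subseteq> J" "is_cut J S \<iota> F e" "e \<cdot> u = u"
    using assms(2) by (auto simp: fin_supp_def)
  have "e \<cdot> u \<cdot> w = u \<cdot> w"
    by (rule Comp_reassoc[OF e(4) assms(3)]) (use e assms in \<open>auto simp: is_cut_def\<close>)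
  then show ?thesis using e by (auto simp: fin_supp_def)
qed

text \<open>The cut at the union of both finite sets fixes \<open>e \<cdot> u\<close> and the
  remainder, hence their sum. Compactness of extensions and biproducts uses this after treating the
  remainder separately.\<close>

lemma fin_supp_extend:
  assumes C: "is_coproduct D J X S \<iota>" and u: "u \<in> Hom D B S"
    and e: "is_cut J S \<iota> F e" "finite F" "F \<subseteq> J" and v: "fin_supp J S \<iota> (u \<boxminus> e \<cdot> u)"
  shows "fin_supp J S \<iota> u"
proof -
  obtain G e' where e': "finite G" "G \<subseteq> J" "is_cut J S \<iota> G e'"
    and eq: "e' \<cdot> (u \<boxminus> e \<cdot> u) = u \<boxminus> e \<cdot> u"
    using v by (auto simp: fin_supp_def)
  obtain d where d: "is_cut J S \<iota> (F \<union> G) d" using is_cut_ex[OF C] by blast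
  have H: "e \<in> Hom D S S" "e' \<in> Hom D S S" "d \<in> Hom D S S"
    using e e' d by (auto simp: is_cut_def)
  have "d \<cdot> e = e" "d \<cdot> e' = e'" using is_cut_mono[OF C _ d] e e' by auto
  moreover define w where "w = u \<boxminus> e \<cdot> u"
  ultimately have w: "w \<in> Hom D B S" and 1: "d \<cdot> e \<cdot> u = e \<cdot> u" and 2: "d \<cdot> e' \<cdot> w = e' \<cdot> w"
    using Comp_reassoc[of d e e S S S u B] Comp_reassoc[of d e' e' S S S w B] H u
    by (simp_all add: Hom_iff)
  have ew: "e' \<cdot> w = w" using eq by (simp add: w_def)
  have uw: "u = e \<cdot> u \<boxplus> w"
    unfolding w_def by (use H u in \<open>simp add: Hom_iff\<close>)
  have "d \<cdot> (e \<cdot> u \<boxplus> w) = d \<cdot> e \<cdot> u \<boxplus> d \<cdot> w"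
    by (rule Comp_Add_right_eq) (use H u w in \<open>auto simp: Hom_iff\<close>)
  then have "d \<cdot> u = u" using 1 2 ew uw by simp
  then show ?thesis using d e e' by (auto simp: fin_supp_def intro!: exI[of _ "F \<union> G"])
qed

lemma fin_supp_reindex:
  assumes "fin_supp J' S (\<iota> \<circ> r) u" "bij_betw r J' J"
  shows "fin_supp J S \<iota> u"
proof -
  obtain F e where e: "finite F" "F \<subseteq> J'" "is_cut J' S (\<iota> \<circ> r) F e" "e \<cdot> u = u"
    using assms(1) by (auto simp: fin_supp_def)
  have r: "inj_on r J'" "J = r ` J'" using assms(2) by (auto simp: bij_betw_def)
  have "is_cut J S \<iota> (r ` F) e"
    unfolding is_cut_def
  proof (intro conjI ballI)
    fix j assume "j \<in> J"
    then obtain i where i: "i \<in> J'" "j = r i" using r by blast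
    have "j \<in> r ` F \<longleftrightarrow> i \<in> F" using i r(1) e(2) by (auto simp: inj_on_def)
    then show "e \<cdot> \<iota> j = (if j \<in> r ` F then \<iota> j else Zero D (Dom D (\<iota> j)) S)"
      using e(3) i by (simp add: is_cut_def)
  qed (use e(3) in \<open>simp add: is_cut_def\<close>)
  moreover have "finite (r ` F)" "r ` F \<subseteq> J" using e(1,2) r by auto
  ultimately show ?thesis using e(4) unfolding fin_supp_def by blast
qed

end

section \<open>Coproducts and finite support under the shift\<close>

context triangulated_category
begin

lemma is_coproduct_Sh:
  assumes "is_coproduct D J X S \<iota>"
  shows "is_coproduct D J (Sh D \<circ> X) (Sh D S) (ShM D \<circ> \<iota>)"
  unfolding is_coproduct_def
proof (intro conjI ballI allI impI)
  note C = is_coproductD[OF assms]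
  show "Sh D S \<in> Obj D" "\<And>j. j \<in> J \<Longrightarrow> (Sh D \<circ> X) j \<in> Obj D"
    "\<And>j. j \<in> J \<Longrightarrow> (ShM D \<circ> \<iota>) j \<in> Hom D ((Sh D \<circ> X) j) (Sh D S)"
    using C ShM_hom by auto
  fix T f assume T: "T \<in> Obj D" and f: "\<forall>j\<in>J. f j \<in> Hom D ((Sh D \<circ> X) j) T"
  obtain T' where T': "T' \<in> Obj D" "Sh D T' = T" using Sh_surj T by blast
  have "\<exists>g. g \<in> Hom D (X j) T' \<and> ShM D g = f j" if "j \<in> J" for j
    using ShM_full[of "f j" "X j" T'] f that C(2)[OF that] T' unfolding comp_def by metis
  then obtain g where g: "\<And>j. j \<in> J \<Longrightarrow> g j \<in> Hom D (X j) T' \<and> ShM D (g j) = f j" by metis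
  obtain u where u: "u \<in> Hom D S T'" "\<And>j. j \<in> J \<Longrightarrow> u \<cdot> \<iota> j = g j"
    using is_coproduct_ex[OF assms T'(1), of g] g by blast
  show "\<exists>!u. u \<in> Hom D (Sh D S) T \<and> (\<forall>j\<in>J. u \<cdot> (ShM D \<circ> \<iota>) j = f j)"
  proof (rule ex1I[of _ "ShM D u"])
    show "ShM D u \<in> Hom D (Sh D S) T \<and> (\<forall>j\<in>J. ShM D u \<cdot> (ShM D \<circ> \<iota>) j = f j)"
      using u g T' ShM_Comp[OF C(3) u(1)] ShM_hom[OF u(1)] by auto
    fix v assume v: "v \<in> Hom D (Sh D S) T \<and> (\<forall>j\<in>J. v \<cdot> (ShM D \<circ> \<iota>) j = f j)"
    obtain w where w: "w \<in> Hom D S T'" "ShM D w = v"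
      using ShM_full[of v S T'] v C T' by auto
    have "w = u"
    proof (rule is_coproduct_eqI[OF assms w(1) u(1)])
      fix j assume j: "j \<in> J"
      have "ShM D (w \<cdot> \<iota> j) = ShM D (u \<cdot> \<iota> j)"
        using v w u g j ShM_Comp[OF C(3)[OF j] w(1)] by auto
      then show "w \<cdot> \<iota> j = u \<cdot> \<iota> j"
        by (rule ShM_inj) (use w u C(3)[OF j] in \<open>auto simp: Hom_iff\<close>)
    qed
    then show "v = ShM D u" using w by simp
  qed
qed

lemma is_coproduct_unSh:
  assumes C: "is_coproduct D J X S \<iota>"
  obtains X' S' \<iota>' where "is_coproduct D J X' S' \<iota>'" "Sh D S' = S"
    "\<And>j. j \<in> J \<Longrightarrow> Sh D (X' j) = X j" "\<And>j. j \<in> J \<Longrightarrow> ShM D (\<iota>' j) = \<iota> j"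
proof -
  note CC = is_coproductD[OF C]
  obtain S' where S': "S' \<in> Obj D" "Sh D S' = S" using Sh_surj CC(1) by blast
  have "\<exists>A. j \<in> J \<longrightarrow> A \<in> Obj D \<and> Sh D A = X j" for j using Sh_surj CC(2) by metis
  then obtain X' where X': "\<And>j. j \<in> J \<Longrightarrow> X' j \<in> Obj D \<and> Sh D (X' j) = X j" by metis
  have "\<exists>i. j \<in> J \<longrightarrow> i \<in> Hom D (X' j) S' \<and> ShM D i = \<iota> j" for j
    using ShM_full[of "\<iota> j" "X' j" S'] CC(3)[of j] X'[of j] S' by metis
  then obtain \<iota>' where \<iota>': "\<And>j. j \<in> J \<Longrightarrow> \<iota>' j \<in> Hom D (X' j) S' \<and> ShM D (\<iota>' j) = \<iota> j" by metis
  have "is_coproduct D J X' S' \<iota>'"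
    unfolding is_coproduct_def
  proof (intro conjI ballI allI impI)
    fix T f assume T: "T \<in> Obj D" and f: "\<forall>j\<in>J. f j \<in> Hom D (X' j) T"
    obtain u where u: "u \<in> Hom D S (Sh D T)" "\<And>j. j \<in> J \<Longrightarrow> u \<cdot> \<iota> j = ShM D (f j)"
      by (rule is_coproduct_ex[OF C, of "Sh D T" "\<lambda>j. ShM D (f j)"])
        (use T f X' ShM_hom in fastforce)+
    obtain w where w: "w \<in> Hom D S' T" "ShM D w = u" using ShM_full[of u S' T] u S' T by metis
    show "\<exists>!u. u \<in> Hom D S' T \<and> (\<forall>j\<in>J. u \<cdot> \<iota>' j = f j)"
    proof (rule ex1I[of _ w])
      have "w \<cdot> \<iota>' j = f j" if "j \<in> J" for j
        by (rule ShM_inj) (use u(2)[OF that] w \<iota>'[OF that] f that in \<open>auto simp: Hom_iff\<close>)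
      with w show "w \<in> Hom D S' T \<and> (\<forall>j\<in>J. w \<cdot> \<iota>' j = f j)" by blast
      fix v assume v: "v \<in> Hom D S' T \<and> (\<forall>j\<in>J. v \<cdot> \<iota>' j = f j)"
      have "ShM D v = u"
      proof (rule is_coproduct_eqI[OF C _ u(1)])
        show "ShM D v \<in> Hom D S (Sh D T)" using v S' ShM_hom by blast
        fix j assume j: "j \<in> J"
        have "ShM D (v \<cdot> \<iota>' j) = ShM D v \<cdot> \<iota> j" using ShM_Comp \<iota>'[OF j] v by metis
        then show "ShM D v \<cdot> \<iota> j = u \<cdot> \<iota> j" using u(2)[OF j] v j by simp
      qed
      then have "ShM D v = ShM D w" using w by simp
      moreover have "v \<in> Arr D" "w \<in> Arr D" using v w by (simp_all add: Hom_def)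
      ultimately show "v = w" by (rule ShM_inj)
    qed
  qed (use S' X' \<iota>' in auto)
  with that S' X' \<iota>' show ?thesis by blast
qed

lemma fin_supp_Sh:
  assumes "fin_supp J S \<iota> u" "u \<in> Hom D B S" "\<And>j. j \<in> J \<Longrightarrow> \<iota> j \<in> Hom D (X j) S"
  shows "fin_supp J (Sh D S) (ShM D \<circ> \<iota>) (ShM D u)"
proof -
  obtain F e where e: "finite F" "F \<subseteq> J" "is_cut J S \<iota> F e" "e \<cdot> u = u"
    using assms(1) by (auto simp: fin_supp_def)
  have eH: "e \<in> Hom D S S" using e(3) by (simp add: is_cut_def)
  have "is_cut J (Sh D S) (ShM D \<circ> \<iota>) F (ShM D e)"
    unfolding is_cut_def
  proof (intro conjI ballI)
    fix j assume j: "j \<in> J"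
    have "ShM D e \<cdot> ShM D (\<iota> j) = ShM D (e \<cdot> \<iota> j)" using ShM_Comp[OF assms(3)[OF j] eH] by simp
    also have "e \<cdot> \<iota> j = (if j \<in> F then \<iota> j else Zero D (Dom D (\<iota> j)) S)"
      using e(3) j by (simp add: is_cut_def)
    finally show "ShM D e \<cdot> (ShM D \<circ> \<iota>) j =
      (if j \<in> F then (ShM D \<circ> \<iota>) j else Zero D (Dom D ((ShM D \<circ> \<iota>) j)) (Sh D S))"
      using assms(3)[OF j] Hom_objs[OF assms(3)[OF j]] Hom_objs[OF eH] by (auto simp: Hom_iff)
  qed (use ShM_hom eH in auto)
  moreover have "ShM D e \<cdot> ShM D u = ShM D u"
    using ShM_Comp[OF assms(2) eH] e(4) by simp
  ultimately show ?thesis using e unfolding fin_supp_def by blast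
qed

lemma fin_supp_unSh:
  assumes "fin_supp J (Sh D S) \<iota>' (ShM D u)" "u \<in> Hom D B S"
    "\<And>j. j \<in> J \<Longrightarrow> \<iota> j \<in> Hom D (X j) S" "\<And>j. j \<in> J \<Longrightarrow> \<iota>' j = ShM D (\<iota> j)"
  shows "fin_supp J S \<iota> u"
proof -
  obtain F e where e: "finite F" "F \<subseteq> J" "is_cut J (Sh D S) \<iota>' F e" "e \<cdot> ShM D u = ShM D u"
    using assms(1) by (auto simp: fin_supp_def)
  have S: "S \<in> Obj D" using Hom_objs assms(2) by blast
  obtain d where d: "d \<in> Hom D S S" "ShM D d = e"
    using ShM_full[of e S S] e(3) S unfolding is_cut_def by blast
  have "is_cut J S \<iota> F d"
    unfolding is_cut_def
  proof (intro conjI ballI)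
    fix j assume j: "j \<in> J"
    have "ShM D (d \<cdot> \<iota> j) = e \<cdot> \<iota>' j" using ShM_Comp[OF assms(3)[OF j] d(1)] d assms(4) j by simp
    also have "\<dots> = (if j \<in> F then \<iota>' j else Zero D (Dom D (\<iota>' j)) (Sh D S))"
      using e(3) j by (simp add: is_cut_def)
    also have "\<dots> = ShM D (if j \<in> F then \<iota> j else Zero D (Dom D (\<iota> j)) S)"
      using assms(3)[OF j] Hom_objs[OF assms(3)[OF j]] assms(4)[OF j] S by (auto simp: Hom_iff)
    finally show "d \<cdot> \<iota> j = (if j \<in> F then \<iota> j else Zero D (Dom D (\<iota> j)) S)"
      by (rule ShM_inj) (use assms(3)[OF j] Hom_objs[OF assms(3)[OF j]] d S in \<open>auto simp: Hom_iff\<close>)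
  qed (use d in auto)
  moreover have "d \<cdot> u = u"
    by (rule ShM_inj) (use e(4) d ShM_Comp[OF assms(2) d(1)] assms(2) in \<open>auto simp: Hom_iff\<close>)
  ultimately show ?thesis using e unfolding fin_supp_def by blast
qed

end

section \<open>Small sets and compact objects\<close>

lemma small_subset: "small \<kappa> A \<Longrightarrow> B \<subseteq> A \<Longrightarrow> small \<kappa> B"
  unfolding small_def using card_of_mono1 ordLeq_ordLess_trans by blast

lemma small_image: "small \<kappa> A \<Longrightarrow> small \<kappa> (f ` A)"
  unfolding small_def using card_of_image ordLeq_ordLess_trans by blast

lemma small_nat:
  assumes "inaccessible_cardinal \<kappa>" shows "small \<kappa> (UNIV :: nat set)"
  using assms unfolding small_def inaccessible_cardinal_def
  using card_of_nat ordIso_ordLess_trans by blast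

lemma small_finite:
  assumes "inaccessible_cardinal \<kappa>" "finite A" shows "small \<kappa> A"
  using assms unfolding small_def inaccessible_cardinal_def
  using finite_iff_ordLess_natLeq ordLess_transitive by blast

text \<open>Regularity of \<open>\<kappa>\<close> in the form of stability, which asks for an
  infinite field; that follows from \<open>natLeq <o \<kappa>\<close>.\<close>

lemma small_UN:
  assumes "inaccessible_cardinal \<kappa>" "small \<kappa> I" "\<And>i. i \<in> I \<Longrightarrow> small \<kappa> (A i)"
  shows "small \<kappa> (\<Union>i\<in>I. A i)"
proof -
  have \<kappa>: "Card_order \<kappa>" "natLeq <o \<kappa>" "regularCard \<kappa>"
    using assms(1) by (auto simp: inaccessible_cardinal_def)
  have "\<not> finite (Field \<kappa>)"
  proof
    assume "finite (Field \<kappa>)"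
    then have "|Field \<kappa>| <o natLeq" by (simp add: finite_iff_ordLess_natLeq)
    then have "\<kappa> <o natLeq" using card_of_Field_ordIso[OF \<kappa>(1)] ordIso_ordLess_trans ordIso_symmetric by blast
    then show False using \<kappa>(2) ordLess_transitive ordLess_irreflexive by blast
  qed
  then have "stable \<kappa>" using regularCard_stable \<kappa> by blast
  then show ?thesis using assms(2,3) stable_UNION unfolding small_def by blast
qed

lemma small_Un:
  assumes "inaccessible_cardinal \<kappa>" "small \<kappa> A" "small \<kappa> B" shows "small \<kappa> (A \<union> B)"
proof -
  have "small \<kappa> (\<Union>b\<in>UNIV. if b then A else B)"
    by (rule small_UN[OF assms(1) small_finite]) (use assms in auto)
  moreover have "A \<union> B = (\<Union>b\<in>UNIV. if b then A else B)" by (auto split: if_splits)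
  ultimately show ?thesis by simp
qed

text \<open>A set smaller than \<open>\<kappa>\<close> injects into \<open>Field \<kappa>\<close>,
  hence into the type \<open>'u\<close> over which coproducts are indexed.\<close>

lemma small_reindex:
  fixes \<kappa> :: "'u rel" and J :: "'i set"
  assumes "inaccessible_cardinal \<kappa>" "small \<kappa> J"
  obtains J' :: "'u set" and r where "bij_betw r J' J" "small \<kappa> J'"
proof -
  have "Card_order \<kappa>" using assms(1) by (simp add: inaccessible_cardinal_def)
  then have "|J| <o |Field \<kappa>|"
    using assms(2) card_of_Field_ordIso ordIso_symmetric ordLess_ordIso_trans
    unfolding small_def by blast
  then have "|J| \<le>o |Field \<kappa>|" by (rule ordLess_imp_ordLeq)
  then obtain g :: "'i \<Rightarrow> 'u" where g: "inj_on g J"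
    using card_of_ordLeq[of J "Field \<kappa>"] by auto
  then have "bij_betw (inv_into J g) (g ` J) J" by (simp add: bij_betw_inv_into inj_on_imp_bij_betw)
  with that small_image[OF assms(2)] show ?thesis by blast
qed

text \<open>\<open>\<Phi>\<close> returns a small set for each pair, so that cones of all morphisms
  between two objects can be adjoined at once. Closing up takes countably many steps: the stages
  increase, two members always lie in a common stage, and regularity of \<open>\<kappa>\<close>
  keeps the union small.\<close>

lemma small_closure:
  assumes "inaccessible_cardinal \<kappa>" "small \<kappa> G" "G \<subseteq> K"
    and \<Phi>: "\<And>A B. A \<in> K \<Longrightarrow> B \<in> K \<Longrightarrow> small \<kappa> (\<Phi> A B) \<and> \<Phi> A B \<subseteq> K"
  obtains H where "small \<kappa> H" "G \<subseteq> H" "H \<subseteq> K" "\<And>A B. A \<in> H \<Longrightarrow> B \<in> H \<Longrightarrow> \<Phi> A B \<subseteq> H"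
proof -
  define step where "step S = S \<union> (\<Union>A\<in>S. \<Union>B\<in>S. \<Phi> A B)" for S
  define H where "H n = (step ^^ n) G" for n
  have H_Suc: "H (Suc n) = step (H n)" for n by (simp add: H_def)
  have H: "small \<kappa> (H n) \<and> H n \<subseteq> K" for n
  proof (induction n)
    case 0 then show ?case using assms by (simp add: H_def)
  next
    case (Suc n)
    have "small \<kappa> (step (H n))"
      unfolding step_def
      by (intro small_Un small_UN assms(1)) (use Suc \<Phi> in blast)+
    moreover have "step (H n) \<subseteq> K" unfolding step_def using Suc \<Phi> by blast
    ultimately show ?case by (simp add: H_Suc)
  qed
  have "H n \<subseteq> H (Suc n)" for n by (auto simp: H_Suc step_def)
  then have mono: "H m \<subseteq> H n" if "m \<le> n" for m n using that lift_Suc_mono_le by metis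
  show ?thesis
  proof (rule that[of "\<Union>n. H n"])
    show "small \<kappa> (\<Union>n. H n)" using small_UN small_nat H assms(1) by blast
    have "G = H 0" by (simp add: H_def)
    then show "G \<subseteq> (\<Union>n. H n)" by blast
    show "(\<Union>n. H n) \<subseteq> K" using H by blast
    fix A B assume "A \<in> (\<Union>n. H n)" "B \<in> (\<Union>n. H n)"
    then obtain m n where "A \<in> H m" "B \<in> H n" by blast
    then have "A \<in> H (max m n)" "B \<in> H (max m n)"
      using mono[of m "max m n"] mono[of n "max m n"] by auto
    then have "\<Phi> A B \<subseteq> H (Suc (max m n))" by (auto simp: H_Suc step_def)
    then show "\<Phi> A B \<subseteq> (\<Union>n. H n)" by blast
  qed
qed

section \<open>Compactness relative to a class of objects\<close>

locale inaccessible_compactly_generated = compactly_generated_category \<kappa> D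
  for \<kappa> :: "'u rel" and D :: "('o, 'm) triang_data" (structure) +
  assumes inaccessible: "inaccessible_cardinal \<kappa>"
begin

lemma coproduct_ex:
  fixes J :: "'i set"
  assumes "small \<kappa> J" "\<And>j. j \<in> J \<Longrightarrow> X j \<in> Obj D"
  obtains S \<iota> where "is_coproduct D J X S \<iota>"
proof -
  obtain J' :: "'u set" and r where r: "bij_betw r J' J" "small \<kappa> J'"
    using small_reindex[OF inaccessible assms(1)] .
  have inv: "bij_betw (inv_into J' r) J J'" using bij_betw_inv_into[OF r(1)] .
  have "\<forall>j\<in>J'. (X \<circ> r) j \<in> Obj D" using r(1) assms(2) by (auto simp: bij_betw_def)
  then obtain S \<iota> where S: "is_coproduct D J' (X \<circ> r) S \<iota>"
    using small_coproducts r(2) unfolding has_small_coproducts_def by meson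
  have "is_coproduct D J ((X \<circ> r) \<circ> inv_into J' r) S (\<iota> \<circ> inv_into J' r)"
    using is_coproduct_reindex[OF S inv] .
  moreover have "((X \<circ> r) \<circ> inv_into J' r) j = X j" if "j \<in> J" for j
    using that r(1) by (simp add: bij_betw_inv_into_right)
  ultimately have "is_coproduct D J X S (\<iota> \<circ> inv_into J' r)" by (simp add: is_coproduct_def)
  with that show ?thesis .
qed

text \<open>Coproducts are taken in the whole category, but only of members of \<open>T\<close>. For
  \<open>T = Obj D\<close> this is ordinary compactness (\<open>compact_object_iff\<close>); a
  smaller \<open>T\<close> is what reflections of compact objects require. Finite support replaces
  an isomorphism with a direct sum of groups.\<close>

definition rel_compact :: "'o set \<Rightarrow> 'o \<Rightarrow> bool" where
  "rel_compact T B \<longleftrightarrow>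
     B \<in> Obj D \<and>
     (\<forall>(J :: 'u set) X S \<iota> u. small \<kappa> J \<and> is_coproduct D J X S \<iota> \<and> (\<forall>j\<in>J. X j \<in> T) \<and> u \<in> Hom D B S \<longrightarrow>
        fin_supp J S \<iota> u)"

lemma rel_compactD:
  fixes J :: "'i set"
  assumes "rel_compact T B" "small \<kappa> J" "is_coproduct D J X S \<iota>" "\<And>j. j \<in> J \<Longrightarrow> X j \<in> T" "u \<in> Hom D B S"
  shows "fin_supp J S \<iota> u"
proof -
  obtain J' :: "'u set" and r where r: "bij_betw r J' J" "small \<kappa> J'"
    using small_reindex[OF inaccessible assms(2)] .
  have "\<forall>j\<in>J'. (X \<circ> r) j \<in> T" using r(1) assms(4) by (auto simp: bij_betw_def)
  then have "fin_supp J' S (\<iota> \<circ> r) u"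
    using assms(1) is_coproduct_reindex[OF assms(3) r(1)] r(2) assms(5)
    unfolding rel_compact_def by blast
  then show ?thesis using fin_supp_reindex r(1) by blast
qed

text \<open>A finite cut \<open>e\<close> fixes the restriction of \<open>u\<close> to
  \<open>A\<close>. The remainder \<open>u - e u\<close> then vanishes on \<open>A\<close>, so it
  factors through \<open>C\<close> and is finite there; the two finite supports are joined.\<close>

lemma rel_compact_extension:
  assumes t: "tri A B C f g h" and A: "rel_compact T A" and C: "rel_compact T C"
  shows "rel_compact T B"
  unfolding rel_compact_def
proof (intro conjI allI impI)
  note T = triD[OF t]
  show "B \<in> Obj D" by (fact T)
  fix J :: "'u set" and X S \<iota> u
  assume as: "small \<kappa> J \<and> is_coproduct D J X S \<iota> \<and> (\<forall>j\<in>J. X j \<in> T) \<and> u \<in> Hom D B S"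
  then have cp: "is_coproduct D J X S \<iota>" and u: "u \<in> Hom D B S" by auto
  have "fin_supp J S \<iota> (u \<cdot> f)"
    using rel_compactD[OF A _ cp] as Comp_hom[OF T(2) u] by blast
  then obtain F e where F: "finite F" "F \<subseteq> J" and e: "is_cut J S \<iota> F e" and eu: "e \<cdot> u \<cdot> f = u \<cdot> f"
    by (auto simp: fin_supp_def)
  have eH: "e \<in> Hom D S S" using e by (simp add: is_cut_def)
  have w: "u \<boxminus> e \<cdot> u \<in> Hom D B S" using eH u by (simp add: Hom_iff)
  have "(u \<boxminus> e \<cdot> u) \<cdot> f = u \<cdot> f \<boxminus> e \<cdot> u \<cdot> f"
    using eH u T by (simp add: Hom_iff)
  also have "\<dots> = Zero D A S" unfolding eu using u T by (simp add: Hom_iff)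
  finally obtain v where v: "v \<in> Hom D C S" "v \<cdot> g = u \<boxminus> e \<cdot> u"
    using tri_extend[OF t w] by blast
  have "fin_supp J S \<iota> v" using rel_compactD[OF C _ cp] as v by blast
  then have "fin_supp J S \<iota> (u \<boxminus> e \<cdot> u)" using fin_supp_comp[OF cp _ v(1) T(3)] v(2) by simp
  then show "fin_supp J S \<iota> u" using fin_supp_extend[OF cp u e F] by blast
qed

definition shift_invariant :: "'o set \<Rightarrow> bool" where
  "shift_invariant T \<longleftrightarrow> T \<subseteq> Obj D \<and> (\<forall>A\<in>Obj D. Sh D A \<in> T \<longleftrightarrow> A \<in> T)"

lemma shift_invariant_Obj: "shift_invariant (Obj D)"
  by (simp add: shift_invariant_def)

text \<open>A coproduct diagram can be shifted in both directions, and shift-invariance keeps its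
  summands in \<open>T\<close>.\<close>

lemma rel_compact_Sh_iff:
  assumes T: "shift_invariant T" and B: "B \<in> Obj D"
  shows "rel_compact T (Sh D B) \<longleftrightarrow> rel_compact T B"
proof
  assume R: "rel_compact T (Sh D B)"
  show "rel_compact T B"
    unfolding rel_compact_def
  proof (intro conjI allI impI)
    fix J :: "'u set" and X S \<iota> u
    assume as: "small \<kappa> J \<and> is_coproduct D J X S \<iota> \<and> (\<forall>j\<in>J. X j \<in> T) \<and> u \<in> Hom D B S"
    then have cp: "is_coproduct D J X S \<iota>" and u: "u \<in> Hom D B S" by auto
    note CP = is_coproductD[OF cp]
    have "fin_supp J (Sh D S) (ShM D \<circ> \<iota>) (ShM D u)"
      using rel_compactD[OF R _ is_coproduct_Sh[OF cp]] as ShM_hom[OF u] CP T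
      by (auto simp: shift_invariant_def)
    then show "fin_supp J S \<iota> u" by (rule fin_supp_unSh[OF _ u CP(3)]) auto
  qed (fact B)
next
  assume R: "rel_compact T B"
  show "rel_compact T (Sh D B)"
    unfolding rel_compact_def
  proof (intro conjI allI impI)
    fix J :: "'u set" and X S \<iota> u
    assume as: "small \<kappa> J \<and> is_coproduct D J X S \<iota> \<and> (\<forall>j\<in>J. X j \<in> T) \<and> u \<in> Hom D (Sh D B) S"
    then have cp: "is_coproduct D J X S \<iota>" and u: "u \<in> Hom D (Sh D B) S" by auto
    obtain X' S' \<iota>' where cp': "is_coproduct D J X' S' \<iota>'" and eq: "Sh D S' = S"
      "\<And>j. j \<in> J \<Longrightarrow> Sh D (X' j) = X j" "\<And>j. j \<in> J \<Longrightarrow> ShM D (\<iota>' j) = \<iota> j"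
      using is_coproduct_unSh[OF cp] by blast
    note CP = is_coproductD[OF cp']
    obtain v where v: "v \<in> Hom D B S'" "ShM D v = u" using ShM_full[of u B S'] u eq(1) B CP(1) by metis
    have "X' j \<in> T" if "j \<in> J" for j
      using as T eq(2)[OF that] CP(2)[OF that] that by (auto simp: shift_invariant_def)
    then have "fin_supp J S' \<iota>' v"
      using rel_compactD[OF R _ cp'] as v(1) by blast
    then have fs: "fin_supp J S (ShM D \<circ> \<iota>') u"
      using fin_supp_Sh[of J S' \<iota>' v B X'] v CP(3) eq(1) by simp
    \<comment> \<open>The shifted-back injections agree with the original ones only on
      \<open>J\<close>, but a cut inspects them nowhere else.\<close>
    have "is_cut J S \<iota> F e \<longleftrightarrow> is_cut J S (ShM D \<circ> \<iota>') F e" for F e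
      using eq(3) by (simp add: is_cut_def)
    then show "fin_supp J S \<iota> u" using fs by (simp add: fin_supp_def)
  qed (use B in simp)
qed

lemma rel_compact_cone:
  assumes "tri A B C f g h" "rel_compact T A" "rel_compact T B" "shift_invariant T"
  shows "rel_compact T C"
  using rel_compact_extension[OF tri_rotate[OF assms(1)] assms(3)] assms
    rel_compact_Sh_iff[OF assms(4)] triD(5)[OF assms(1)] by blast

lemma rel_compact_zero_object:
  assumes Z: "zero_object D Z"
  shows "rel_compact T Z"
  unfolding rel_compact_def
proof (intro conjI allI impI)
  show "Z \<in> Obj D" using Z by (simp add: zero_object_def)
  fix J :: "'u set" and X S \<iota> u
  assume as: "small \<kappa> J \<and> is_coproduct D J X S \<iota> \<and> (\<forall>j\<in>J. X j \<in> T) \<and> u \<in> Hom D Z S"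
  then have cp: "is_coproduct D J X S \<iota>" and u: "u \<in> Hom D Z S" by auto
  obtain e where e: "is_cut J S \<iota> {} e" using is_cut_ex[OF cp] .
  then have "e \<cdot> u \<in> Hom D Z S" using u Comp_hom unfolding is_cut_def by blast
  then have "e \<cdot> u = u" using zero_object_Hom(2)[OF Z] u by metis
  with e show "fin_supp J S \<iota> u" by (auto simp: fin_supp_def)
qed

text \<open>The cutting argument for extensions, with the decomposition \<open>i p + j q = 1\<close>
  in place of a triangle: once the part seen on \<open>A\<close> is removed, the remainder satisfies
  \<open>w = w j q\<close> and is finite because \<open>B\<close> is relatively compact.\<close>

lemma rel_compact_biproduct:
  assumes A: "rel_compact T A" and B: "rel_compact T B" and H: "i \<in> Hom D A S" "j \<in> Hom D B S"
    "p \<in> Hom D S A" "q \<in> Hom D S B" and id: "i \<cdot> p \<boxplus> j \<cdot> q = Ident D S"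
  shows "rel_compact T S"
  unfolding rel_compact_def
proof (intro conjI allI impI)
  show S: "S \<in> Obj D" using Hom_objs H by blast
  fix J :: "'u set" and X V \<iota> u
  assume as: "small \<kappa> J \<and> is_coproduct D J X V \<iota> \<and> (\<forall>j\<in>J. X j \<in> T) \<and> u \<in> Hom D S V"
  then have cp: "is_coproduct D J X V \<iota>" and u: "u \<in> Hom D S V" by auto
  have "fin_supp J V \<iota> (u \<cdot> i)"
    using rel_compactD[OF A _ cp] as Comp_hom[OF H(1) u] by blast
  then obtain F e where F: "finite F" "F \<subseteq> J" and e: "is_cut J V \<iota> F e" and eu: "e \<cdot> u \<cdot> i = u \<cdot> i"
    by (auto simp: fin_supp_def)
  have eH: "e \<in> Hom D V V" using e by (simp add: is_cut_def)
  define w where "w = u \<boxminus> e \<cdot> u"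
  have w: "w \<in> Hom D S V" using eH u by (simp add: Hom_iff w_def)
  have "w \<cdot> i = u \<cdot> i \<boxminus> e \<cdot> u \<cdot> i"
    using eH u H by (simp add: Hom_iff w_def)
  also have "\<dots> = Zero D A V" unfolding eu using u H by (simp add: Hom_iff)
  finally have wi: "w \<cdot> i = Zero D A V" .
  have "w = w \<cdot> (i \<cdot> p \<boxplus> j \<cdot> q)" unfolding id using w by (simp add: Hom_iff)
  also have "\<dots> = (w \<cdot> i) \<cdot> p \<boxplus> (w \<cdot> j) \<cdot> q" using w H by (simp add: Hom_iff)
  also have "\<dots> = (w \<cdot> j) \<cdot> q" unfolding wi using w H Hom_objs[OF w] by (simp add: Hom_iff)
  finally have weq: "w = (w \<cdot> j) \<cdot> q" .
  have wj: "w \<cdot> j \<in> Hom D B V" using Comp_hom[OF H(2) w] .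
  have "fin_supp J V \<iota> (w \<cdot> j)" using rel_compactD[OF B _ cp] as wj by blast
  then have "fin_supp J V \<iota> w" using fin_supp_comp[OF cp _ wj H(4)] weq by metis
  then show "fin_supp J V \<iota> u" using fin_supp_extend[OF cp u e F] by (simp add: w_def)
qed

section \<open>Agreement with compactness defined by direct sums\<close>

lemma finprod_cut:
  assumes "finite F" "P \<in> Obj D" "e \<in> Hom D S T" "\<And>j. j \<in> F \<Longrightarrow> f j \<in> Hom D P S"
  shows "finprod (hom_group D P S) f F \<in> Hom D P S"
    "e \<cdot> finprod (hom_group D P S) f F = finprod (hom_group D P T) (\<lambda>j. e \<cdot> f j) F"
proof -
  interpret S: comm_group "hom_group D P S" using hom_comm_group assms Hom_objs by blast
  interpret T: comm_group "hom_group D P T" using hom_comm_group assms Hom_objs by blast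
  have "finprod (hom_group D P S) f F \<in> Hom D P S \<and>
    e \<cdot> finprod (hom_group D P S) f F = finprod (hom_group D P T) (\<lambda>j. e \<cdot> f j) F"
    using assms(1,4)
  proof (induction F rule: finite_induct)
    case empty
    then show ?case using assms(2,3) Hom_objs[OF assms(3)] by (simp add: Hom_iff)
  next
    case (insert k F)
    have f: "f k \<in> Hom D P S" "f \<in> F \<rightarrow> Hom D P S" using insert by auto
    then have ef: "e \<cdot> f k \<in> Hom D P T" "(\<lambda>j. e \<cdot> f j) \<in> F \<rightarrow> Hom D P T"
      using Comp_hom[OF _ assms(3)] by auto
    show ?case using insert f ef assms(3) Comp_Add_right[OF f(1) _ assms(3)]
      by (auto intro: S.m_closed[simplified])
  qed
  then show "finprod (hom_group D P S) f F \<in> Hom D P S"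
    "e \<cdot> finprod (hom_group D P S) f F = finprod (hom_group D P T) (\<lambda>j. e \<cdot> f j) F" by auto
qed

text \<open>Translates the canonical sum from the definition of compactness into the language of
  cuts and projections. As the family is zero outside \<open>F\<close>, the product over
  \<open>J\<close> reduces to a finite one, over which postcomposition distributes.\<close>

lemma sum_map_props:
  assumes cp: "is_coproduct D J X S \<iota>" and P: "P \<in> Obj D"
    and g: "\<And>j. j \<in> J \<Longrightarrow> g j \<in> Hom D P (X j)" and F: "finite F" "F \<subseteq> J"
    and z: "\<And>j. j \<in> J - F \<Longrightarrow> g j = Zero D P (X j)"
  defines "v \<equiv> gfinprod (hom_group D P S) (\<lambda>j. \<iota> j \<cdot> g j) J"
  shows "v \<in> Hom D P S" "is_cut J S \<iota> F e \<Longrightarrow> e \<cdot> v = v"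
    "\<lbrakk>k \<in> J; is_proj J X S \<iota> k p\<rbrakk> \<Longrightarrow> p \<cdot> v = g k"
proof -
  note C = is_coproductD[OF cp]
  interpret S: comm_group "hom_group D P S" using hom_comm_group P C by blast
  have f: "\<iota> j \<cdot> g j \<in> Hom D P S" if "j \<in> J" for j using g C Comp_hom that by blast
  then have fF: "\<iota> j \<cdot> g j \<in> Hom D P S" if "j \<in> F" for j using F that by blast
  have "v = gfinprod (hom_group D P S) (\<lambda>j. \<iota> j \<cdot> g j) F"
    unfolding v_def
  proof (rule S.gfinprod_mono_neutral_cong_right)
    fix j assume j: "j \<in> J - F"
    then show "\<iota> j \<cdot> g j = \<one>\<^bsub>hom_group D P S\<^esub>"
      using z[OF j] C(2,3)[of j] C(1) P by (simp add: Hom_iff)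
  qed (use F f in auto)
  then have v: "v = finprod (hom_group D P S) (\<lambda>j. \<iota> j \<cdot> g j) F"
    using S.gfinprod_eq_finprod[OF F(1)] fF by simp
  then show vH: "v \<in> Hom D P S" using finprod_cut(1)[OF F(1) P Ident_hom[OF C(1)] fF] by simp
  show "e \<cdot> v = v" if e: "is_cut J S \<iota> F e"
  proof -
    have eH: "e \<in> Hom D S S" using e by (simp add: is_cut_def)
    have "e \<cdot> \<iota> j \<cdot> g j = \<iota> j \<cdot> g j" if "j \<in> F" for j
      by (rule Comp_reassoc) (use e that F C(3) eH g in \<open>auto simp: is_cut_def\<close>)
    then show ?thesis
      unfolding v using finprod_cut(2)[OF F(1) P eH fF] fF
      by (auto intro: S.finprod_cong')
  qed
  show "p \<cdot> v = g k" if k: "k \<in> J" and p: "is_proj J X S \<iota> k p"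
  proof -
    interpret X: comm_group "hom_group D P (X k)" using hom_comm_group P C k by blast
    have pH: "p \<in> Hom D S (X k)" using p by (simp add: is_proj_def)
    have pj: "p \<cdot> \<iota> j \<cdot> g j = (if j = k then g k else Zero D P (X k))" if "j \<in> F" for j
    proof -
      have j: "j \<in> J" using that F by blast
      have "p \<cdot> \<iota> j \<cdot> g j = (if j = k then Ident D (X k) else Zero D (X j) (X k)) \<cdot> g j"
        by (rule Comp_reassoc[OF _ C(3)[OF j] pH g[OF j]]) (use p j in \<open>simp add: is_proj_def\<close>)
      then show ?thesis using g[OF j] g[OF k] C(2)[OF j] C(2)[OF k] P by (auto simp: Hom_iff)
    qed
    have "p \<cdot> v = finprod (hom_group D P (X k)) (\<lambda>j. p \<cdot> \<iota> j \<cdot> g j) F"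
      unfolding v using finprod_cut(2)[OF F(1) P pH fF] .
    also have "\<dots> = finprod (hom_group D P (X k)) (\<lambda>j. if j = k then g k else \<one>\<^bsub>hom_group D P (X k)\<^esub>) F"
      using pj g[OF k] X.one_closed by (intro X.finprod_cong') auto
    also have "\<dots> = g k"
    proof (cases "k \<in> F")
      case True
      then show ?thesis using X.finprod_singleton_swap[of k F "\<lambda>_. g k"] F(1) g[OF k] by simp
    next
      case False
      then have "finprod (hom_group D P (X k)) (\<lambda>j. if j = k then g k else \<one>\<^bsub>hom_group D P (X k)\<^esub>) F =
          \<one>\<^bsub>hom_group D P (X k)\<^esub>"
        by (intro X.finprod_one_eqI) auto
      then show ?thesis using z[of k] False k by simp
    qed
    finally show ?thesis .
  qed
qed

text \<open>Surjectivity of the canonical map carries the content: every map into the coproduct is a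
  finite sum through the summands. Injectivity holds for any \<open>P\<close>, since projections
  recover the components of a family.\<close>

lemma compact_object_iff: "compact_object \<kappa> D P \<longleftrightarrow> rel_compact (Obj D) P"
proof
  assume L: "compact_object \<kappa> D P"
  then have P: "P \<in> Obj D" by (simp add: compact_object_def)
  show "rel_compact (Obj D) P"
    unfolding rel_compact_def
  proof (intro conjI allI impI)
    fix J :: "'u set" and X S \<iota> u
    assume as: "small \<kappa> J \<and> is_coproduct D J X S \<iota> \<and> (\<forall>j\<in>J. X j \<in> Obj D) \<and> u \<in> Hom D P S"
    then have cp: "is_coproduct D J X S \<iota>" and u: "u \<in> Hom D P S" by auto
    note C = is_coproductD[OF cp]
    have grp: "group (hom_group D P (X j))" if "j \<in> J" for j
      using hom_comm_group[OF P C(2)[OF that]] comm_group.axioms(2) by blast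
    have "(\<lambda>g. gfinprod (hom_group D P S) (\<lambda>j. \<iota> j \<cdot> g j) J)
          \<in> iso (sum_group J (\<lambda>j. hom_group D P (X j))) (hom_group D P S)"
      using L as unfolding compact_object_def by blast
    then have "bij_betw (\<lambda>g. gfinprod (hom_group D P S) (\<lambda>j. \<iota> j \<cdot> g j) J)
        (carrier (sum_group J (\<lambda>j. hom_group D P (X j)))) (Hom D P S)"
      by (simp add: iso_def)
    then obtain g where g: "g \<in> carrier (sum_group J (\<lambda>j. hom_group D P (X j)))"
      and gu: "gfinprod (hom_group D P S) (\<lambda>j. \<iota> j \<cdot> g j) J = u"
      using u by (metis (no_types, lifting) bij_betw_def imageE)
    define F where "F = {j\<in>J. g j \<noteq> Zero D P (X j)}"
    have F: "finite F" "F \<subseteq> J" and gH: "\<And>j. j \<in> J \<Longrightarrow> g j \<in> Hom D P (X j)"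
      using g by (auto simp: carrier_sum_group[OF grp] F_def)
    obtain e where e: "is_cut J S \<iota> F e" using is_cut_ex[OF cp] .
    have "e \<cdot> u = u" using sum_map_props(2)[OF cp P gH F _ e] gu F_def by auto
    then show "fin_supp J S \<iota> u" using F e by (auto simp: fin_supp_def)
  qed (fact P)
next
  assume R: "rel_compact (Obj D) P"
  then have P: "P \<in> Obj D" by (simp add: rel_compact_def)
  show "compact_object \<kappa> D P"
    unfolding compact_object_def
  proof (intro conjI allI impI)
    fix J :: "'u set" and X S \<iota>
    assume as: "small \<kappa> J \<and> is_coproduct D J X S \<iota>"
    then have cp: "is_coproduct D J X S \<iota>" by auto
    note C = is_coproductD[OF cp]
    interpret S: comm_group "hom_group D P S" using hom_comm_group P C by blast
    let ?\<Phi> = "\<lambda>g. gfinprod (hom_group D P S) (\<lambda>j. \<iota> j \<cdot> g j) J"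
    have grp: "group (hom_group D P (X j))" if "j \<in> J" for j
      using hom_comm_group[OF P C(2)[OF that]] comm_group.axioms(2) by blast
    have car: "carrier (sum_group J (\<lambda>j. hom_group D P (X j))) =
      {g \<in> \<Pi>\<^sub>E j\<in>J. Hom D P (X j). finite {j\<in>J. g j \<noteq> Zero D P (X j)}}"
      by (simp add: carrier_sum_group[OF grp])
    have "?\<Phi> \<in> hom (sum_group J (\<lambda>j. hom_group D P (X j))) (hom_group D P S)"
    proof (rule S.hom_group_sum)
      fix j assume j: "j \<in> J"
      show "(\<cdot>) (\<iota> j) \<in> hom (hom_group D P (X j)) (hom_group D P S)"
        using C(3)[OF j] Comp_Add_right Comp_hom by (auto simp: hom_def)
    qed (use grp in blast)
    moreover have "inj_on ?\<Phi> (carrier (sum_group J (\<lambda>j. hom_group D P (X j))))"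
    proof (rule inj_onI)
      fix g g' assume g: "g \<in> carrier (sum_group J (\<lambda>j. hom_group D P (X j)))"
        and g': "g' \<in> carrier (sum_group J (\<lambda>j. hom_group D P (X j)))" and eq: "?\<Phi> g = ?\<Phi> g'"
      show "g = g'"
      proof (rule PiE_ext)
        show "g \<in> (\<Pi>\<^sub>E j\<in>J. Hom D P (X j))" "g' \<in> (\<Pi>\<^sub>E j\<in>J. Hom D P (X j))"
          using g g' car by auto
        fix k assume k: "k \<in> J"
        obtain p where p: "is_proj J X S \<iota> k p" using is_proj_ex[OF cp k] .
        have "p \<cdot> ?\<Phi> g = g k" if "g \<in> carrier (sum_group J (\<lambda>j. hom_group D P (X j)))" for g
          by (rule sum_map_props(3)[OF cp P _ _ _ _ k p, where F = "{j\<in>J. g j \<noteq> Zero D P (X j)}"])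
            (use that car in auto)
        then show "g k = g' k" using g g' eq by metis
      qed
    qed
    moreover have "u \<in> ?\<Phi> ` carrier (sum_group J (\<lambda>j. hom_group D P (X j)))" if u: "u \<in> Hom D P S" for u
    proof -
      have "fin_supp J S \<iota> u" using rel_compactD[OF R _ cp] as C u by blast
      then obtain F e where F: "finite F" "F \<subseteq> J" and e: "is_cut J S \<iota> F e" and eu: "e \<cdot> u = u"
        by (auto simp: fin_supp_def)
      have eH: "e \<in> Hom D S S" using e by (simp add: is_cut_def)
      have "\<exists>p. k \<in> J \<longrightarrow> is_proj J X S \<iota> k p" for k using is_proj_ex[OF cp] by blast
      then obtain p where p: "\<And>k. k \<in> J \<Longrightarrow> is_proj J X S \<iota> k (p k)" by metis
      have pH: "\<And>k. k \<in> J \<Longrightarrow> p k \<in> Hom D S (X k)" using p by (auto simp: is_proj_def)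
      \<comment> \<open>The components of \<open>u\<close>, set to zero outside \<open>F\<close> so
        that the family lies in the direct sum.\<close>
      define g where "g = (\<lambda>j\<in>J. if j \<in> F then p j \<cdot> u else Zero D P (X j))"
      have gH: "g j \<in> Hom D P (X j)" if "j \<in> J" for j
        using pH[OF that] u C(2)[OF that] P by (auto simp: g_def that Hom_iff)
      have gz: "g j = Zero D P (X j)" if "j \<in> J - F" for j using that by (simp add: g_def)
      have "{j\<in>J. g j \<noteq> Zero D P (X j)} \<subseteq> F" using gz by blast
      then have gc: "g \<in> carrier (sum_group J (\<lambda>j. hom_group D P (X j)))"
        using gH F(1) finite_subset by (auto simp: car g_def)
      define v where "v = ?\<Phi> g"
      have V: "v \<in> Hom D P S" "e \<cdot> v = v"
        unfolding v_def
        by (rule sum_map_props(1)[OF cp P gH F gz] sum_map_props(2)[OF cp P gH F gz e]; assumption)+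
      have V3: "q \<cdot> v = g k" if "k \<in> J" "is_proj J X S \<iota> k q" for k q
        unfolding v_def by (rule sum_map_props(3)[OF cp P gH F gz that])
      \<comment> \<open>Both maps are fixed by the cut \<open>e\<close>, so their difference is
        finitely supported and may be tested on projections.\<close>
      have "u \<boxminus> v = Zero D P S"
      proof (rule fin_supp_eq_Zero[OF cp])
        have "e \<cdot> (u \<boxminus> v) = e \<cdot> u \<boxminus> e \<cdot> v" using eH u V(1) by (simp add: Hom_iff)
        then have "e \<cdot> (u \<boxminus> v) = u \<boxminus> v" using eu V(2) by simp
        then show "fin_supp J S \<iota> (u \<boxminus> v)" using e F by (auto simp: fin_supp_def)
        show "u \<boxminus> v \<in> Hom D P S" using u V(1) by (simp add: Hom_iff)
        fix k q assume k: "k \<in> J" and q: "is_proj J X S \<iota> k q"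
        have qH: "q \<in> Hom D S (X k)" using q by (simp add: is_proj_def)
        have qp: "q = p k"
          by (rule is_coproduct_eqI[OF cp qH pH[OF k]]) (use p[OF k] q in \<open>simp add: is_proj_def\<close>)
        have "q \<cdot> v = g k" using V3[OF k q] .
        also have "g k = q \<cdot> u"
        proof (cases "k \<in> F")
          case True
          then show ?thesis using k qp by (simp add: g_def)
        next
          case False
          \<comment> \<open>A projection outside \<open>F\<close> annihilates the cut, so it
            annihilates \<open>u = e u\<close>, in accordance with the zero component chosen
            there.\<close>
          have "q \<cdot> e = Zero D S (X k)"
          proof (rule is_coproduct_eqI[OF cp])
            show "q \<cdot> e \<in> Hom D S (X k)" "Zero D S (X k) \<in> Hom D S (X k)"
              using qH eH C(1) C(2)[OF k] by (simp_all add: Hom_iff)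
            fix j assume j: "j \<in> J"
            have "e \<cdot> \<iota> j = (if j \<in> F then \<iota> j else Zero D (X j) S)"
              using e j C(3)[OF j] by (simp add: is_cut_def Hom_iff)
            moreover have "q \<cdot> \<iota> j = (if j = k then Ident D (X k) else Zero D (X j) (X k))"
              using q j by (simp add: is_proj_def)
            moreover have "(q \<cdot> e) \<cdot> \<iota> j = q \<cdot> e \<cdot> \<iota> j" using qH eH C(3)[OF j] by (simp add: Hom_iff)
            ultimately show "(q \<cdot> e) \<cdot> \<iota> j = Zero D S (X k) \<cdot> \<iota> j"
              using qH C(2,3)[OF j] C(1) C(2)[OF k] False by (cases "j \<in> F") (auto simp: Hom_iff)
          qed
          then have "q \<cdot> e \<cdot> u = Zero D P (X k)"
            using Comp_reassoc[OF _ eH qH u] u C(2)[OF k] by (simp add: Hom_iff)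
          then show ?thesis using gz k False eu by simp
        qed
        finally show "q \<cdot> (u \<boxminus> v) = Zero D P (X k)"
          using qH u V(1) C(2)[OF k] by (simp add: Hom_iff)
      qed
      then have "u = v" using sub_eq_Zero_iff[OF u V(1)] by blast
      then show ?thesis using gc v_def by blast
    qed
    moreover have "?\<Phi> ` carrier (sum_group J (\<lambda>j. hom_group D P (X j))) \<subseteq> Hom D P S"
      using calculation(1) by (auto simp: hom_def)
    ultimately show "?\<Phi> \<in> iso (sum_group J (\<lambda>j. hom_group D P (X j))) (hom_group D P S)"
      unfolding iso_def bij_betw_def by auto
  qed (fact P)
qed

end

section \<open>Milnor colimits\<close>

lemma is_coproduct_UNIV_ex:
  assumes "is_coproduct D UNIV X S \<iota>" "T \<in> Obj D" "\<And>j. f j \<in> Hom D (X j) T"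
  obtains u where "u \<in> Hom D S T" "\<And>j. u \<cdot>\<^bsub>D\<^esub> \<iota> j = f j"
proof (rule is_coproduct_ex[OF assms(1,2), of f])
  show "f j \<in> Hom D (X j) T" for j by (rule assms(3))
  fix u assume "u \<in> Hom D S T" "\<And>j. j \<in> UNIV \<Longrightarrow> u \<cdot>\<^bsub>D\<^esub> \<iota> j = f j"
  then show thesis by (intro that) simp_all
qed

context inaccessible_compactly_generated
begin

definition milnor_data where
  "milnor_data M f C c S \<iota> \<sigma> g h \<longleftrightarrow>
     (\<forall>n. f n \<in> Hom D (M n) (M (Suc n))) \<and> is_coproduct D UNIV M S \<iota> \<and> \<sigma> \<in> Hom D S S \<and>
     (\<forall>n. \<sigma> \<cdot> \<iota> n = \<iota> (Suc n) \<cdot> f n) \<and>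
     tri S S C (Ident D S \<boxminus> \<sigma>) g h \<and> (\<forall>n. c n = g \<cdot> \<iota> n)"

text \<open>\<open>Milnor_colimit\<close> names only the object. The maps \<open>c n\<close> from
  the stages are recorded here, as all later arguments move along them.\<close>

definition milnor_cocone :: "(nat \<Rightarrow> 'o) \<Rightarrow> (nat \<Rightarrow> 'm) \<Rightarrow> 'o \<Rightarrow> (nat \<Rightarrow> 'm) \<Rightarrow> bool" where
  "milnor_cocone M f C c \<longleftrightarrow> (\<exists>S \<iota> \<sigma> g h. milnor_data M f C c S \<iota> \<sigma> g h)"

lemma milnor_dataD:
  assumes "milnor_data M f C c S \<iota> \<sigma> g h"
  shows "f n \<in> Hom D (M n) (M (Suc n))" "is_coproduct D UNIV M S \<iota>" "\<sigma> \<in> Hom D S S"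
    "\<sigma> \<cdot> \<iota> n = \<iota> (Suc n) \<cdot> f n" "tri S S C (Ident D S \<boxminus> \<sigma>) g h" "c n = g \<cdot> \<iota> n"
  using assms by (simp_all add: milnor_data_def)

lemma milnor_cocone_Hom: "milnor_cocone M f C c \<Longrightarrow> f n \<in> Hom D (M n) (M (Suc n))"
  using milnor_dataD(1) unfolding milnor_cocone_def by blast

lemma Milnor_colimit_iff: "Milnor_colimit D M f C \<longleftrightarrow> (\<exists>c. milnor_cocone M f C c)"
proof
  assume "Milnor_colimit D M f C"
  then obtain S \<iota> \<sigma> g h where H: "\<forall>n. f n \<in> Hom D (M n) (M (Suc n))" "is_coproduct D UNIV M S \<iota>"
    "\<sigma> \<in> Hom D S S" "\<forall>n. \<sigma> \<cdot> \<iota> n = \<iota> (Suc n) \<cdot> f n"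
    "(Ident D S \<boxminus> \<sigma>, g, h) \<in> Tri D" "Cod D g = C"
    unfolding Milnor_colimit_def by blast
  have "Ident D S \<boxminus> \<sigma> \<in> Hom D S S" using H(3) Hom_objs[OF H(3)] by (simp add: Hom_iff)
  then have t: "tri S S C (Ident D S \<boxminus> \<sigma>) g h"
    using Tri_tri[OF H(5)] H(6) by (simp add: Hom_iff)
  show "\<exists>c. milnor_cocone M f C c"
    unfolding milnor_cocone_def milnor_data_def
    by (intro exI[of _ "\<lambda>n. g \<cdot> \<iota> n"] conjI exI) (rule H(1) H(2) H(3) H(4) t allI refl)+
next
  assume "\<exists>c. milnor_cocone M f C c"
  then obtain c S \<iota> \<sigma> g h where "milnor_data M f C c S \<iota> \<sigma> g h" by (auto simp: milnor_cocone_def)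
  note H = milnor_dataD[OF this]
  have "Cod D g = C" using triD(3)[OF H(5)] by (simp add: Hom_iff)
  then show "Milnor_colimit D M f C"
    unfolding Milnor_colimit_def
    by (intro conjI exI allI) (rule H(1) H(2) H(3) H(4) triD(1)[OF H(5)] | assumption)+
qed

lemma milnor_cocone_ex:
  assumes "\<And>n. f n \<in> Hom D (M n) (M (Suc n))"
  obtains C c where "milnor_cocone M f C c"
proof -
  have M: "M n \<in> Obj D" for n using Hom_objs[OF assms] by blast
  obtain S \<iota> where S: "is_coproduct D UNIV M S \<iota>"
    using coproduct_ex[OF small_nat[OF inaccessible], of M] M by blast
  note CP = is_coproductD[OF S]
  obtain \<sigma> where \<sigma>: "\<sigma> \<in> Hom D S S" "\<And>n. \<sigma> \<cdot> \<iota> n = \<iota> (Suc n) \<cdot> f n"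
    by (rule is_coproduct_UNIV_ex[OF S CP(1), of "\<lambda>n. \<iota> (Suc n) \<cdot> f n"])
      (use Comp_hom[OF assms CP(3)] in blast)+
  have "Ident D S \<boxminus> \<sigma> \<in> Hom D S S" using \<sigma>(1) CP(1) by (simp add: Hom_iff)
  then obtain C g h where t: "tri S S C (Ident D S \<boxminus> \<sigma>) g h" using tri_cone by blast
  have "milnor_cocone M f C (\<lambda>n. g \<cdot> \<iota> n)"
    unfolding milnor_cocone_def milnor_data_def
    by (intro conjI allI exI) (rule assms S \<sigma> t refl)+
  with that show ?thesis .
qed

text \<open>The composite of \<open>1 - \<sigma>\<close> with \<open>g\<close> is zero, that is
  \<open>g = g \<sigma>\<close>; restricted to the summands this is compatibility with the
  transition maps.\<close>

lemma milnor_cocone_compat: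
  assumes "milnor_cocone M f C c"
  shows "C \<in> Obj D" "c n \<in> Hom D (M n) C" "c (Suc n) \<cdot> f n = c n"
proof -
  obtain S \<iota> \<sigma> g h where "milnor_data M f C c S \<iota> \<sigma> g h" using assms by (auto simp: milnor_cocone_def)
  note H = milnor_dataD[OF this]
  note CP = is_coproductD[OF H(2)] and T = triD[OF H(5)]
  have \<iota>: "\<iota> n \<in> Hom D (M n) S" for n using CP(3) by blast
  show "C \<in> Obj D" by (fact T)
  show "c n \<in> Hom D (M n) C" using Comp_hom[OF \<iota> T(3)] H(6) by simp
  have "g \<cdot> (Ident D S \<boxminus> \<sigma>) = g \<boxminus> g \<cdot> \<sigma>"
    using T(3) H(3) CP(1) by (simp add: Hom_iff)
  then have "g \<boxminus> g \<cdot> \<sigma> = Zero D S C" using tri_comp_Zero[OF H(5)] by simp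
  then have "g = g \<cdot> \<sigma>"
    using sub_eq_Zero_iff[OF T(3) Comp_hom[OF H(3) T(3)]] by blast
  then have "g \<cdot> \<iota> n = g \<cdot> \<sigma> \<cdot> \<iota> n"
    using Comp_assoc[OF \<iota> H(3) T(3)] by simp
  also have "\<dots> = c (Suc n) \<cdot> f n" unfolding H(4) H(6) using Comp_assoc[OF H(1) \<iota> T(3)] by simp
  finally show "c (Suc n) \<cdot> f n = c n" using H(6) by simp
qed

text \<open>A compatible family assembles to \<open>v\<close> with \<open>v \<sigma> = v\<close>,
  which kills \<open>1 - \<sigma>\<close> and so extends to the cone. Only existence is claimed: the
  colimit is weak, and two extensions may differ by a map coming from \<open>S[1]\<close>.\<close>

lemma milnor_cocone_desc:
  assumes "milnor_cocone M f C c" and b: "\<And>n. b n \<in> Hom D (M n) X" "\<And>n. b (Suc n) \<cdot> f n = b n"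
  obtains u where "u \<in> Hom D C X" "\<And>n. u \<cdot> c n = b n"
proof -
  obtain S \<iota> \<sigma> g h where "milnor_data M f C c S \<iota> \<sigma> g h" using assms(1) by (auto simp: milnor_cocone_def)
  note H = milnor_dataD[OF this]
  note CP = is_coproductD[OF H(2)] and T = triD[OF H(5)]
  have \<iota>: "\<iota> n \<in> Hom D (M n) S" for n using CP(3) by blast
  have X: "X \<in> Obj D" using Hom_objs b(1) by blast
  obtain v where v: "v \<in> Hom D S X" "\<And>n. v \<cdot> \<iota> n = b n"
    by (rule is_coproduct_UNIV_ex[OF H(2) X, of b, OF b(1)]) blast
  have "v \<cdot> \<sigma> = v"
  proof (rule is_coproduct_eqI[OF H(2) Comp_hom[OF H(3) v(1)] v(1)])
    fix n
    have "(v \<cdot> \<sigma>) \<cdot> \<iota> n = (v \<cdot> \<iota> (Suc n)) \<cdot> f n"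
      using Comp_assoc[OF \<iota> H(3) v(1)] Comp_assoc[OF H(1) \<iota> v(1)] H(4) by simp
    then show "(v \<cdot> \<sigma>) \<cdot> \<iota> n = v \<cdot> \<iota> n" using v(2) b(2) by simp
  qed
  then have "v \<cdot> (Ident D S \<boxminus> \<sigma>) = Zero D S X"
    using v(1) H(3) CP(1) by (simp add: Hom_iff)
  then obtain u where u: "u \<in> Hom D C X" "u \<cdot> g = v" using tri_extend[OF H(5) v(1)] by blast
  have "u \<cdot> c n = b n" for n
    unfolding H(6) using Comp_assoc[OF \<iota> T(3) u(1)] u(2) v(2) by simp
  with that u(1) show ?thesis by blast
qed

text \<open>Injectivity of \<open>1 - \<sigma>\<close> on finitely supported maps. As
  \<open>\<sigma>\<close> raises degrees by one, component \<open>0\<close> of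
  \<open>\<sigma> v\<close> is zero and component \<open>k + 1\<close> is \<open>f k\<close> applied
  to component \<open>k\<close>; so \<open>v = \<sigma> v\<close> has all components zero by
  induction.\<close>

lemma milnor_shift_injective:
  assumes cp: "is_coproduct D UNIV M S \<iota>" and \<sigma>: "\<sigma> \<in> Hom D S S"
    and f: "\<And>n. f n \<in> Hom D (M n) (M (Suc n))" and \<sigma>\<iota>: "\<And>n. \<sigma> \<cdot> \<iota> n = \<iota> (Suc n) \<cdot> f n"
    and v: "v \<in> Hom D B S" "fin_supp UNIV S \<iota> v" "\<sigma> \<cdot> v = v"
  shows "v = Zero D B S"
proof -
  note CP = is_coproductD[OF cp]
  have \<iota>: "\<iota> n \<in> Hom D (M n) S" and M: "M n \<in> Obj D" for n using CP(2,3) by blast+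
  have B: "B \<in> Obj D" using Hom_objs v(1) by blast
  have uniq: "p \<cdot> v = q \<cdot> v" if "is_proj UNIV M S \<iota> k p" "is_proj UNIV M S \<iota> k q" for k p q
    using is_coproduct_eqI[OF cp, of p "M k" q] that by (simp add: is_proj_def)
  have "\<forall>p. is_proj UNIV M S \<iota> k p \<longrightarrow> p \<cdot> v = Zero D B (M k)" for k
  proof (induction k)
    case 0
    show ?case
    proof (intro allI impI)
      fix p assume p: "is_proj UNIV M S \<iota> 0 p"
      then have pH: "p \<in> Hom D S (M 0)" by (simp add: is_proj_def)
      have "p \<cdot> \<sigma> = Zero D S (M 0)"
      proof (rule is_coproduct_eqI[OF cp Comp_hom[OF \<sigma> pH]])
        fix n
        have "(p \<cdot> \<sigma>) \<cdot> \<iota> n = (p \<cdot> \<iota> (Suc n)) \<cdot> f n"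
          using Comp_assoc[OF \<iota> \<sigma> pH] Comp_assoc[OF f \<iota> pH] \<sigma>\<iota> by simp
        also have "p \<cdot> \<iota> (Suc n) = Zero D (M (Suc n)) (M 0)" using p by (simp add: is_proj_def)
        finally show "(p \<cdot> \<sigma>) \<cdot> \<iota> n = Zero D S (M 0) \<cdot> \<iota> n"
          using f[of n] \<iota>[of n] M by (simp add: Hom_iff)
      qed (use CP(1) M in \<open>simp add: Hom_iff\<close>)
      then have "p \<cdot> \<sigma> \<cdot> v = Zero D B (M 0)"
        using Comp_reassoc[OF _ \<sigma> pH v(1)] v(1) M by (simp add: Hom_iff)
      then show "p \<cdot> v = Zero D B (M 0)" using v(3) by simp
    qed
  next
    case (Suc k)
    show ?case
    proof (intro allI impI)
      fix p assume p: "is_proj UNIV M S \<iota> (Suc k) p"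
      then have pH: "p \<in> Hom D S (M (Suc k))" by (simp add: is_proj_def)
      obtain q where q: "is_proj UNIV M S \<iota> k q" using is_proj_ex[OF cp] by blast
      then have qH: "q \<in> Hom D S (M k)" by (simp add: is_proj_def)
      have "p \<cdot> \<sigma> = f k \<cdot> q"
      proof (rule is_coproduct_eqI[OF cp Comp_hom[OF \<sigma> pH] Comp_hom[OF qH f]])
        fix n
        have pn: "p \<cdot> \<iota> (Suc n) = (if n = k then Ident D (M (Suc k)) else Zero D (M (Suc n)) (M (Suc k)))"
          and qn: "q \<cdot> \<iota> n = (if n = k then Ident D (M k) else Zero D (M n) (M k))"
          using p q by (simp_all add: is_proj_def)
        have "(p \<cdot> \<sigma>) \<cdot> \<iota> n = (p \<cdot> \<iota> (Suc n)) \<cdot> f n"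
          using Comp_assoc[OF \<iota> \<sigma> pH] Comp_assoc[OF f \<iota> pH] \<sigma>\<iota> by simp
        also have "\<dots> = f k \<cdot> q \<cdot> \<iota> n"
          unfolding pn qn using f[of n] f[of k] M by (simp add: Hom_iff)
        finally show "(p \<cdot> \<sigma>) \<cdot> \<iota> n = (f k \<cdot> q) \<cdot> \<iota> n" using Comp_assoc[OF \<iota> qH f] by simp
      qed
      then have "p \<cdot> \<sigma> \<cdot> v = f k \<cdot> q \<cdot> v"
        using Comp_reassoc[OF _ \<sigma> pH v(1)] Comp_assoc[OF v(1) qH f] by simp
      also have "\<dots> = Zero D B (M (Suc k))" using Suc q f[of k] B by (simp add: Hom_iff)
      finally show "p \<cdot> v = Zero D B (M (Suc k))" using v(3) by simp
    qed
  qed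
  then show ?thesis using fin_supp_eq_Zero[OF cp v(2,1)] by blast
qed

lemma milnor_cocone_raise:
  assumes "milnor_cocone M f C c" "n \<le> m" "w \<in> Hom D B (M n)"
  shows "\<exists>w' \<in> Hom D B (M m). c m \<cdot> w' = c n \<cdot> w"
  using assms(2)
proof (induction m rule: dec_induct)
  case base
  then show ?case using assms(3) by blast
next
  case (step m)
  then obtain w' where w': "w' \<in> Hom D B (M m)" "c m \<cdot> w' = c n \<cdot> w" by blast
  have f: "f m \<in> Hom D (M m) (M (Suc m))" using assms(1) by (rule milnor_cocone_Hom)
  have "c (Suc m) \<cdot> f m \<cdot> w' = c m \<cdot> w'"
    using Comp_reassoc[OF milnor_cocone_compat(3)[OF assms(1)] f milnor_cocone_compat(2)[OF assms(1)] w'(1)] .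
  then show ?case using w' Comp_hom[OF w'(1) f] by auto
qed

text \<open>Relative compactness enters twice: it makes the connecting component \<open>h u\<close>
  vanish, so that \<open>u\<close> lifts to the coproduct \<open>S\<close>, and it makes this lift a
  finite sum, whose terms can be pushed to one common stage.\<close>

lemma milnor_cocone_factor:
  assumes c: "milnor_cocone M f C c" and B: "rel_compact T B" and T: "shift_invariant T"
    and M: "\<And>n. M n \<in> T" and u: "u \<in> Hom D B C"
  obtains n w where "w \<in> Hom D B (M n)" "u = c n \<cdot> w"
proof -
  obtain S \<iota> \<sigma> g h where "milnor_data M f C c S \<iota> \<sigma> g h" using c by (auto simp: milnor_cocone_def)
  note H = milnor_dataD[OF this]
  note CP = is_coproductD[OF H(2)] and TT = triD[OF H(5)]
  have \<iota>: "\<iota> n \<in> Hom D (M n) S" for n using CP(3) by blast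
  have Bo: "B \<in> Obj D" using Hom_objs u by blast
  note nat = small_nat[OF inaccessible]
  define v where "v = h \<cdot> u"
  have v: "v \<in> Hom D B (Sh D S)" using Comp_hom[OF u TT(4)] by (simp add: v_def)
  have "v = Zero D B (Sh D S)"
  proof (rule milnor_shift_injective[OF is_coproduct_Sh[OF H(2)] ShM_hom[OF H(3)] _ _ v])
    show "(ShM D \<circ> f) n \<in> Hom D ((Sh D \<circ> M) n) ((Sh D \<circ> M) (Suc n))" for n
      using ShM_hom[OF H(1)] by simp
    show "ShM D \<sigma> \<cdot> (ShM D \<circ> \<iota>) n = (ShM D \<circ> \<iota>) (Suc n) \<cdot> (ShM D \<circ> f) n" for n
      using ShM_Comp[OF \<iota> H(3)] ShM_Comp[OF H(1) \<iota>] H(4) by simp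
    show "fin_supp UNIV (Sh D S) (ShM D \<circ> \<iota>) v"
    proof (rule rel_compactD[OF B nat is_coproduct_Sh[OF H(2)] _ v])
      show "(Sh D \<circ> M) j \<in> T" for j using T M CP(2) by (auto simp: shift_invariant_def)
    qed
    have d: "Ident D S \<boxminus> \<sigma> \<in> Hom D S S" by (fact TT)
    \<comment> \<open>The shift of \<open>1 - \<sigma>\<close> annihilates \<open>h\<close>, which
      says that \<open>v = h u\<close> is fixed by the shift of \<open>\<sigma>\<close>.\<close>
    have "Zero D B (Sh D S) = ShM D (Ident D S \<boxminus> \<sigma>) \<cdot> h \<cdot> u"
      using Comp_reassoc[OF tri_comp_Zero3[OF H(5)] TT(4) ShM_hom[OF d] u] u CP(1)
      by (simp add: Hom_iff)
    also have "ShM D (Ident D S \<boxminus> \<sigma>) = Ident D (Sh D S) \<boxminus> ShM D \<sigma>"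
    proof -
      have "neg D \<sigma> \<in> Hom D S S" using H(3) by (simp add: Hom_iff)
      moreover have "ShM D (neg D \<sigma>) = neg D (ShM D \<sigma>)"
      proof (rule neg_unique)
        show "ShM D \<sigma> \<boxplus> ShM D (neg D \<sigma>) = Zero D (Sh D S) (Sh D S)"
          using ShM_Add[OF H(3) calculation] H(3) CP(1) by (simp add: Hom_iff)
      qed (use H(3) in \<open>simp_all add: Hom_iff\<close>)
      ultimately show ?thesis using ShM_Add[OF Ident_hom[OF CP(1)]] ShM_Ident[OF CP(1)] by simp
    qed
    also have "(Ident D (Sh D S) \<boxminus> ShM D \<sigma>) \<cdot> h \<cdot> u = v \<boxminus> ShM D \<sigma> \<cdot> v"
      using H(3) TT(4) u CP(1) by (simp add: v_def Hom_iff)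
    finally show "ShM D \<sigma> \<cdot> v = v"
      using sub_eq_Zero_iff[OF v Comp_hom[OF v ShM_hom[OF H(3)]]] by simp
  qed
  then obtain w where w: "w \<in> Hom D B S" "g \<cdot> w = u" using tri_lift2[OF H(5) u] by (auto simp: v_def)
  have "fin_supp UNIV S \<iota> w" using rel_compactD[OF B nat H(2) M w(1)] .
  then obtain F e where F: "finite F" and e: "is_cut UNIV S \<iota> F e" "e \<cdot> w = w" by (auto simp: fin_supp_def)
  \<comment> \<open>The maps into \<open>S\<close> whose image in the colimit comes from a single
    stage. Closure under addition raises both representatives to stage
    \<open>max n m\<close>.\<close>
  define K where "K = {v \<in> Hom D B S. \<exists>n. \<exists>w \<in> Hom D B (M n). g \<cdot> v = c n \<cdot> w}"
  have "e \<cdot> w \<in> K"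
  proof (rule is_cut_comp_induct[OF H(2) F _ e(1) w(1)])
    have "g \<cdot> Zero D B S = c 0 \<cdot> Zero D B (M 0)" "Zero D B (M 0) \<in> Hom D B (M 0)"
      using TT(3) Bo CP(1) CP(2)[of 0] milnor_cocone_compat(2)[OF c, of 0] by (simp_all add: Hom_iff)
    moreover have "Zero D B S \<in> Hom D B S" using Bo CP(1) by (simp add: Hom_iff)
    ultimately show "Zero D B S \<in> K" unfolding K_def by blast
  next
    fix v v' assume vv: "v \<in> K" "v' \<in> K" and vH: "v \<in> Hom D B S" "v' \<in> Hom D B S"
    obtain n x m y where x: "x \<in> Hom D B (M n)" "g \<cdot> v = c n \<cdot> x"
      and y: "y \<in> Hom D B (M m)" "g \<cdot> v' = c m \<cdot> y" using vv by (auto simp: K_def)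
    obtain x' where x': "x' \<in> Hom D B (M (max n m))" "c (max n m) \<cdot> x' = c n \<cdot> x"
      using milnor_cocone_raise[OF c _ x(1), of "max n m"] by auto
    obtain y' where y': "y' \<in> Hom D B (M (max n m))" "c (max n m) \<cdot> y' = c m \<cdot> y"
      using milnor_cocone_raise[OF c _ y(1), of "max n m"] by auto
    have "g \<cdot> (v \<boxplus> v') = c (max n m) \<cdot> (x' \<boxplus> y')"
      using Comp_Add_right[OF vH TT(3)] Comp_Add_right[OF x'(1) y'(1) milnor_cocone_compat(2)[OF c]]
        x(2) y(2) x'(2) y'(2) by simp
    moreover have "x' \<boxplus> y' \<in> Hom D B (M (max n m))" "v \<boxplus> v' \<in> Hom D B S"
      using x'(1) y'(1) vH by (simp_all add: Hom_iff)
    ultimately show "v \<boxplus> v' \<in> K" by (auto simp: K_def)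
  next
    fix j p assume "is_proj UNIV M S \<iota> j p"
    then have p: "p \<in> Hom D S (M j)" by (simp add: is_proj_def)
    have pw: "p \<cdot> w \<in> Hom D B (M j)" using Comp_hom[OF w(1) p] .
    have "g \<cdot> \<iota> j \<cdot> p \<cdot> w = c j \<cdot> p \<cdot> w"
      unfolding H(6) using Comp_assoc[OF pw \<iota> TT(3)] by simp
    then show "\<iota> j \<cdot> p \<cdot> w \<in> K" using pw Comp_hom[OF pw \<iota>] by (auto simp: K_def)
  qed auto
  then show ?thesis using that w e(2) by (auto simp: K_def)
qed

text \<open>The argument uses the shifted sequence because \<open>Hom(C, Y)\<close> has a contribution from \<open>S[1]\<close>.\<close>

lemma milnor_cocone_Hom_zero:
  assumes c: "milnor_cocone M f C c" and u: "u \<in> Hom D C Y"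
    and z: "\<And>n v. v \<in> Hom D (M (Suc n)) Y \<Longrightarrow> v \<cdot> f n = Zero D (M n) Y"
    and z': "\<And>n v. v \<in> Hom D (Sh D (M (Suc n))) Y \<Longrightarrow> v \<cdot> ShM D (f n) = Zero D (Sh D (M n)) Y"
  shows "u = Zero D C Y"
proof -
  obtain S \<iota> \<sigma> g h where "milnor_data M f C c S \<iota> \<sigma> g h" using c by (auto simp: milnor_cocone_def)
  note H = milnor_dataD[OF this]
  note CP = is_coproductD[OF H(2)] and TT = triD[OF H(5)]
  have \<iota>: "\<iota> n \<in> Hom D (M n) S" for n using CP(3) by blast
  have Y: "Y \<in> Obj D" using Hom_objs u by blast
  have "u \<cdot> g = Zero D S Y"
  proof (rule is_coproduct_eqI[OF H(2) Comp_hom[OF TT(3) u]])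
    fix n
    have cn: "u \<cdot> c (Suc n) \<in> Hom D (M (Suc n)) Y"
      using Comp_hom[OF milnor_cocone_compat(2)[OF c] u] .
    have "(u \<cdot> g) \<cdot> \<iota> n = u \<cdot> c n" using Comp_assoc[OF \<iota> TT(3) u] H(6) by simp
    also have "\<dots> = (u \<cdot> c (Suc n)) \<cdot> f n"
      using Comp_assoc[OF H(1) milnor_cocone_compat(2)[OF c] u] milnor_cocone_compat(3)[OF c] by simp
    also have "\<dots> = Zero D (M n) Y" using z[OF cn] .
    finally show "(u \<cdot> g) \<cdot> \<iota> n = Zero D S Y \<cdot> \<iota> n" using \<iota>[of n] Y by (simp add: Hom_iff)
  qed (use CP(1) Y in \<open>simp add: Hom_iff\<close>)
  then obtain v where v: "v \<in> Hom D (Sh D S) Y" "v \<cdot> h = u" using tri_extend2[OF H(5) u] by blast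
  have \<sigma>': "ShM D \<sigma> \<in> Hom D (Sh D S) (Sh D S)" using ShM_hom[OF H(3)] .
  have v\<sigma>: "v \<cdot> ShM D \<sigma> = Zero D (Sh D S) Y"
  proof (rule is_coproduct_eqI[OF is_coproduct_Sh[OF H(2)] Comp_hom[OF \<sigma>' v(1)]])
    fix n
    have i: "ShM D (\<iota> m) \<in> Hom D (Sh D (M m)) (Sh D S)" for m using ShM_hom[OF \<iota>] .
    have vi: "v \<cdot> ShM D (\<iota> (Suc n)) \<in> Hom D (Sh D (M (Suc n))) Y" using Comp_hom[OF i v(1)] .
    have "(v \<cdot> ShM D \<sigma>) \<cdot> ShM D (\<iota> n) = v \<cdot> ShM D (\<iota> (Suc n) \<cdot> f n)"
      using Comp_assoc[OF i \<sigma>' v(1)] ShM_Comp[OF \<iota> H(3)] H(4) by simp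
    also have "\<dots> = (v \<cdot> ShM D (\<iota> (Suc n))) \<cdot> ShM D (f n)"
      using Comp_assoc[OF ShM_hom[OF H(1)] i v(1)] ShM_Comp[OF H(1) \<iota>] by simp
    also have "\<dots> = Zero D (Sh D (M n)) Y" using z'[OF vi] .
    finally show "(v \<cdot> ShM D \<sigma>) \<cdot> (ShM D \<circ> \<iota>) n = Zero D (Sh D S) Y \<cdot> (ShM D \<circ> \<iota>) n"
      using i[of n] Y by (simp add: Hom_iff)
  qed (use CP(1) Y in \<open>simp add: Hom_iff\<close>)
  \<comment> \<open>Splitting the identity as \<open>(1 - \<sigma>) + \<sigma>\<close> and shifting:
    the first summand annihilates \<open>h\<close>, so \<open>h\<close> equals the shift of
    \<open>\<sigma>\<close> composed with \<open>h\<close>, and \<open>v\<close> kills the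
    latter.\<close>
  have "Ident D S = (Ident D S \<boxminus> \<sigma>) \<boxplus> \<sigma>" using CP(1) H(3) by (simp add: Hom_iff)
  then have 1: "Ident D (Sh D S) = ShM D (Ident D S \<boxminus> \<sigma>) \<boxplus> ShM D \<sigma>"
    using ShM_Add[OF TT(2) H(3)] ShM_Ident[OF CP(1)] by simp
  have \<sigma>h: "ShM D \<sigma> \<cdot> h \<in> Hom D C (Sh D S)" using Comp_hom[OF TT(4) \<sigma>'] .
  have "h = Ident D (Sh D S) \<cdot> h" using Ident_Comp[OF TT(4)] by simp
  also have "\<dots> = ShM D (Ident D S \<boxminus> \<sigma>) \<cdot> h \<boxplus> ShM D \<sigma> \<cdot> h"
    unfolding 1 by (rule Comp_Add_left[OF TT(4) ShM_hom[OF TT(2)] \<sigma>'])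
  also have "\<dots> = ShM D \<sigma> \<cdot> h"
    unfolding tri_comp_Zero3[OF H(5)] using \<sigma>h by (simp add: Hom_def)
  finally have "v \<cdot> h = v \<cdot> ShM D \<sigma> \<cdot> h" by (rule arg_cong)
  also have "\<dots> = Zero D (Sh D S) Y \<cdot> h" by (rule Comp_reassoc[OF v\<sigma> \<sigma>' v(1) TT(4)])
  also have "\<dots> = Zero D C Y" using TT(4) Y by (simp add: Hom_iff)
  finally show ?thesis using v(2) by simp
qed

end

section \<open>Cellular approximation\<close>

context inaccessible_compactly_generated
begin

definition coproduct_of :: "'o set \<Rightarrow> 'o \<Rightarrow> bool" where
  "coproduct_of Q F \<longleftrightarrow>
     (\<exists>(J :: 'u set) X \<iota>. small \<kappa> J \<and> is_coproduct D J X F \<iota> \<and> (\<forall>j\<in>J. X j \<in> Q))"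

lemma coproduct_ofI:
  fixes J :: "'i set"
  assumes "small \<kappa> J" "is_coproduct D J X F \<iota>" "\<And>j. j \<in> J \<Longrightarrow> X j \<in> Q"
  shows "coproduct_of Q F"
proof -
  obtain J' :: "'u set" and r where r: "bij_betw r J' J" "small \<kappa> J'"
    using small_reindex[OF inaccessible assms(1)] .
  have "\<forall>j\<in>J'. (X \<circ> r) j \<in> Q" using r(1) assms(3) by (auto simp: bij_betw_def)
  then show ?thesis
    using is_coproduct_reindex[OF assms(2) r(1)] r(2) unfolding coproduct_of_def by blast
qed

text \<open>Neither shifts nor retracts are built in. Recording the shape of the construction, and
  not just membership in \<open>Tria\<close>, is what allows a map from a compact object to be
  traced back through it.\<close>

inductive cell :: "'o set \<Rightarrow> 'o \<Rightarrow> bool" for Q where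
  coprod: "coproduct_of Q F \<Longrightarrow> cell Q F"
| attach: "cell Q X \<Longrightarrow> coproduct_of Q F \<Longrightarrow> tri F X Y \<phi> x h \<Longrightarrow> cell Q Y"
| colim: "(\<And>n. cell Q (M n)) \<Longrightarrow> milnor_cocone M f C c \<Longrightarrow> cell Q C"

definition localizing :: "'o set \<Rightarrow> bool" where
  "localizing T \<longleftrightarrow> triangulated_subcategory D T \<and> closed_under_small_coproducts \<kappa> D T"

lemma localizingD:
  assumes "localizing T"
  shows "shift_invariant T" "T \<subseteq> Obj D"
    "tri A B C f g h \<Longrightarrow> A \<in> T \<Longrightarrow> B \<in> T \<Longrightarrow> C \<in> T"
    "coproduct_of T F \<Longrightarrow> F \<in> T"
proof -
  have T: "triangulated_subcategory D T" "closed_under_small_coproducts \<kappa> D T"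
    using assms by (auto simp: localizing_def)
  show "T \<subseteq> Obj D" "shift_invariant T"
    using T(1) by (auto simp: triangulated_subcategory_def strictly_full_def shift_invariant_def)
  show "coproduct_of T F \<Longrightarrow> F \<in> T"
    using T(2) unfolding closed_under_small_coproducts_def coproduct_of_def by blast
  assume t: "tri A B C f g h" "A \<in> T" "B \<in> T"
  have "\<forall>f g h. (f, g, h) \<in> Tri D \<and> Dom D f \<in> T \<and> Cod D f \<in> T \<longrightarrow> Cod D g \<in> T"
    using T(1) by (simp add: triangulated_subcategory_def)
  moreover have "Dom D f = A" "Cod D f = B" "Cod D g = C"
    using triD(2,3)[OF t(1)] by (simp_all add: Hom_iff)
  ultimately show "C \<in> T" using triD(1)[OF t(1)] t by metis
qed

lemma coproduct_of_mono: "coproduct_of Q F \<Longrightarrow> Q \<subseteq> R \<Longrightarrow> coproduct_of R F"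
  unfolding coproduct_of_def by blast

text \<open>A Milnor colimit is the cone of an endomorphism of a coproduct of its stages, so
  localizing classes are closed under it.\<close>

lemma cell_localizing:
  assumes T: "localizing T" and Q: "Q \<subseteq> T" and X: "cell Q X"
  shows "X \<in> T"
  using X
proof induction
  case (coprod F)
  then show ?case using localizingD(4)[OF T] coproduct_of_mono Q by blast
next
  case (attach X F Y \<phi> x h)
  then show ?case using localizingD(3,4)[OF T] coproduct_of_mono Q by blast
next
  case (colim M f C c)
  obtain S \<iota> \<sigma> g h where "milnor_data M f C c S \<iota> \<sigma> g h"
    using colim.hyps(2) by (auto simp: milnor_cocone_def)
  note H = milnor_dataD(2,5)[OF this]
  have "coproduct_of T S"
    by (rule coproduct_ofI[OF small_nat[OF inaccessible] H(1)]) (rule colim.IH)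
  then have "S \<in> T" using localizingD(4)[OF T] by blast
  then show ?case using localizingD(3)[OF T H(2)] by blast
qed

lemma small_morphisms_from:
  assumes "small \<kappa> Q" "Q \<subseteq> Obj D" "X \<in> Obj D"
  shows "small \<kappa> {v \<in> Arr D. Dom D v \<in> Q \<and> Cod D v = X \<and> P v}"
proof (rule small_subset)
  show "small \<kappa> (\<Union>C\<in>Q. Hom D C X)"
    by (rule small_UN[OF inaccessible assms(1)], rule locally_small) (use assms in auto)
qed (auto simp: Hom_def)

text \<open>The coproduct is indexed by the morphisms themselves, which form a small set because Hom
  sets are small. The predicate lets one statement serve both the initial stage (all maps into
  \<open>M\<close>) and the attaching stages (maps with zero composite to \<open>M\<close>). The
  last property tests vanishing on the cover one morphism at a time.\<close>

lemma cover_ex: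
  assumes "small \<kappa> Q" "Q \<subseteq> Obj D" "X \<in> Obj D"
  obtains F \<phi> where "coproduct_of Q F" "\<phi> \<in> Hom D F X"
    "\<And>C v. \<lbrakk>C \<in> Q; v \<in> Hom D C X; P v\<rbrakk> \<Longrightarrow> \<exists>w \<in> Hom D C F. \<phi> \<cdot> w = v"
    "\<And>Y m. \<lbrakk>m \<in> Hom D X Y; \<forall>v. P v \<longrightarrow> v \<in> Hom D (Dom D v) X \<longrightarrow> m \<cdot> v = Zero D (Dom D v) Y\<rbrakk> \<Longrightarrow>
      m \<cdot> \<phi> = Zero D F Y"
proof -
  let ?J = "{v \<in> Arr D. Dom D v \<in> Q \<and> Cod D v = X \<and> P v}"
  have J: "small \<kappa> ?J" using small_morphisms_from[OF assms] .
  obtain F \<iota> where F: "is_coproduct D ?J (Dom D) F \<iota>"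
    by (rule coproduct_ex[OF J, of "Dom D"]) auto
  note CP = is_coproductD[OF F]
  obtain \<phi> where \<phi>: "\<phi> \<in> Hom D F X" "\<And>v. v \<in> ?J \<Longrightarrow> \<phi> \<cdot> \<iota> v = v"
    by (rule is_coproduct_ex[OF F assms(3), of "\<lambda>v. v"]) (auto simp: Hom_iff)
  have 1: "coproduct_of Q F" by (rule coproduct_ofI[OF J F]) auto
  have 2: "\<exists>w \<in> Hom D C F. \<phi> \<cdot> w = v" if "C \<in> Q" "v \<in> Hom D C X" "P v" for C v
  proof -
    have v: "v \<in> ?J" "Dom D v = C" using that by (auto simp: Hom_iff)
    have "\<iota> v \<in> Hom D C F" using CP(3)[OF v(1)] v(2) by simp
    then show ?thesis using \<phi>(2)[OF v(1)] by blast
  qed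
  have 3: "m \<cdot> \<phi> = Zero D F Y"
    if m: "m \<in> Hom D X Y" and z: "\<And>v. P v \<Longrightarrow> v \<in> Hom D (Dom D v) X \<Longrightarrow> m \<cdot> v = Zero D (Dom D v) Y"
    for Y m
  proof (rule is_coproduct_eqI[OF F Comp_hom[OF \<phi>(1) m]])
    have Y: "Y \<in> Obj D" using Hom_objs[OF m] by blast
    then show "Zero D F Y \<in> Hom D F Y" using CP(1) by (simp add: Hom_iff)
    fix v assume v: "v \<in> ?J"
    have "(m \<cdot> \<phi>) \<cdot> \<iota> v = m \<cdot> v" using Comp_assoc[OF CP(3)[OF v] \<phi>(1) m] \<phi>(2)[OF v] by simp
    also have "\<dots> = Zero D (Dom D v) Y" using z v by (simp add: Hom_iff)
    finally show "(m \<cdot> \<phi>) \<cdot> \<iota> v = Zero D F Y \<cdot> \<iota> v"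
      using CP(3)[OF v] Y by (simp add: Hom_iff)
  qed
  show ?thesis
  proof (rule that[OF 1 \<phi>(1)])
    show "\<exists>w \<in> Hom D C F. \<phi> \<cdot> w = v" if "C \<in> Q" "v \<in> Hom D C X" "P v" for C v
      using that by (rule 2)
    show "m \<cdot> \<phi> = Zero D F Y"
      if "m \<in> Hom D X Y" "\<forall>v. P v \<longrightarrow> v \<in> Hom D (Dom D v) X \<longrightarrow> m \<cdot> v = Zero D (Dom D v) Y" for Y m
      by (rule 3[OF that(1)]) (use that(2) in blast)
  qed
qed

definition factors_via :: "'o set \<Rightarrow> 'm \<Rightarrow> bool" where
  "factors_via Q f \<longleftrightarrow> (\<exists>C\<in>Q. factors_through D f C)"

lemma factors_viaE:
  assumes "factors_via Q f" "f \<in> Hom D A B"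
  obtains C a b where "C \<in> Q" "a \<in> Hom D A C" "b \<in> Hom D C B" "f = b \<cdot> a"
proof -
  have "Dom D f = A" "Cod D f = B" using assms(2) by (simp_all add: Hom_iff)
  then obtain C where "C \<in> Q" "\<exists>a\<in>Hom D A C. \<exists>b\<in>Hom D C B. f = b \<cdot> a"
    using assms(1) by (auto simp: factors_via_def factors_through_def)
  then show ?thesis using that by blast
qed

lemma factors_viaI:
  assumes "C \<in> Q" "a \<in> Hom D A C" "b \<in> Hom D C B" "f = b \<cdot> a"
  shows "factors_via Q f"
  unfolding factors_via_def factors_through_def
  using assms by (intro bexI[of _ C] bexI[of _ a] bexI[of _ b]) (auto simp: Hom_iff)

text \<open>In the last clause \<open>B\<close> carries the finiteness and \<open>f\<close> the
  passage through \<open>Q\<close>; \<open>B\<close> itself need not lie in \<open>Q\<close>. The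
  class \<open>T\<close> is quantified inside, so one construction serves ordinary compactness as
  well as compactness relative to another localizing class.\<close>

definition cell_approx :: "'o set \<Rightarrow> 'o \<Rightarrow> 'o \<Rightarrow> 'm \<Rightarrow> bool" where
  "cell_approx Q M X m \<longleftrightarrow> cell Q X \<and> m \<in> Hom D X M \<and>
     (\<forall>C\<in>Q. \<forall>v\<in>Hom D C M. \<exists>w\<in>Hom D C X. m \<cdot> w = v) \<and>
     (\<forall>T A B v f. localizing T \<and> Q \<subseteq> T \<and> rel_compact T B \<and> v \<in> Hom D B X \<and> m \<cdot> v = Zero D B M \<and>
        f \<in> Hom D A B \<and> factors_via Q f \<longrightarrow> v \<cdot> f = Zero D A X)"

text \<open>The cone of a cover of the kernel: \<open>m\<close> vanishes on the cover and therefore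
  extends, while every kernel element lifts to the cover and dies in its cone.\<close>

lemma kill_step:
  assumes Q: "small \<kappa> Q" "Q \<subseteq> Obj D" and X: "cell Q X" "m \<in> Hom D X M"
  obtains X' m' x where "cell Q X'" "m' \<in> Hom D X' M" "x \<in> Hom D X X'" "m' \<cdot> x = m"
    "\<And>C v. \<lbrakk>C \<in> Q; v \<in> Hom D C X; m \<cdot> v = Zero D C M\<rbrakk> \<Longrightarrow> x \<cdot> v = Zero D C X'"
proof -
  have Xo: "X \<in> Obj D" using Hom_objs X(2) by blast
  obtain F \<phi> where F: "coproduct_of Q F" and \<phi>: "\<phi> \<in> Hom D F X"
    and lift: "\<And>C v. \<lbrakk>C \<in> Q; v \<in> Hom D C X; m \<cdot> v = Zero D (Dom D v) M\<rbrakk> \<Longrightarrow> \<exists>w \<in> Hom D C F. \<phi> \<cdot> w = v"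
    and zero: "\<And>Y n. \<lbrakk>n \<in> Hom D X Y;
        \<forall>v. m \<cdot> v = Zero D (Dom D v) M \<longrightarrow> v \<in> Hom D (Dom D v) X \<longrightarrow> n \<cdot> v = Zero D (Dom D v) Y\<rbrakk> \<Longrightarrow>
      n \<cdot> \<phi> = Zero D F Y"
    by (rule cover_ex[OF Q Xo, of "\<lambda>v. m \<cdot> v = Zero D (Dom D v) M"]) (rule that)
  obtain X' x h where t: "tri F X X' \<phi> x h" using tri_cone[OF \<phi>] by blast
  note T = triD[OF t]
  have "m \<cdot> \<phi> = Zero D F M" using zero[OF X(2)] by blast
  then obtain m' where m': "m' \<in> Hom D X' M" "m' \<cdot> x = m" using tri_extend[OF t X(2)] by blast
  have 1: "x \<cdot> v = Zero D C X'" if v: "C \<in> Q" "v \<in> Hom D C X" "m \<cdot> v = Zero D C M" for C v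
  proof -
    have "Dom D v = C" using v(2) by (simp add: Hom_iff)
    then obtain w where w: "w \<in> Hom D C F" "\<phi> \<cdot> w = v" using lift[OF v(1,2)] v(3) by auto
    have "x \<cdot> \<phi> \<cdot> w = Zero D F X' \<cdot> w"
      by (rule Comp_reassoc[OF tri_comp_Zero[OF t] \<phi> T(3) w(1)])
    then show ?thesis using w T by (simp add: Hom_iff)
  qed
  show ?thesis by (rule that[OF cell.attach[OF X(1) F t] m'(1) T(3) m'(2) 1])
qed

text \<open>Killing the kernels of the maps from \<open>Q\<close> along a sequence, as in the proof of Brown
  representability.\<close>

lemma cell_approx_ex:
  assumes Q: "small \<kappa> Q" "Q \<subseteq> Obj D" and M: "M \<in> Obj D"
  obtains X m where "cell_approx Q M X m"
proof -
  \<comment> \<open>A state is an object with its map to \<open>M\<close>. Lifting of all maps from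
    \<open>Q\<close> is demanded at stage \<open>0\<close> only; the colimit inherits it through
    \<open>c 0\<close>.\<close>
  define st where "st n y \<longleftrightarrow> cell Q (fst y) \<and> snd y \<in> Hom D (fst y) M \<and>
    (n = 0 \<longrightarrow> (\<forall>C\<in>Q. \<forall>v\<in>Hom D C M. \<exists>w\<in>Hom D C (fst y). snd y \<cdot> w = v))" for n :: nat and y
  define ok where "ok y y' x \<longleftrightarrow> x \<in> Hom D (fst y) (fst y') \<and> snd y' \<cdot> x = snd y \<and>
    (\<forall>C\<in>Q. \<forall>v\<in>Hom D C (fst y). snd y \<cdot> v = Zero D C M \<longrightarrow> x \<cdot> v = Zero D C (fst y'))" for y y' x
  have "\<exists>y. \<forall>n. st n (y n) \<and> (\<exists>x. ok (y n) (y (Suc n)) x)"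
  proof (rule dependent_nat_choice)
    obtain F \<phi> where F: "coproduct_of Q F" and \<phi>: "\<phi> \<in> Hom D F M"
      and lift: "\<And>C v. \<lbrakk>C \<in> Q; v \<in> Hom D C M; True\<rbrakk> \<Longrightarrow> \<exists>w \<in> Hom D C F. \<phi> \<cdot> w = v"
      by (rule cover_ex[OF Q M, of "\<lambda>_. True"]) blast
    have "st 0 (F, \<phi>)" unfolding st_def using cell.coprod[OF F] \<phi> lift by simp
    then show "\<exists>y. st 0 y" by blast
  next
    fix y and n :: nat assume y: "st n y"
    then have y': "cell Q (fst y)" "snd y \<in> Hom D (fst y) M" by (simp_all add: st_def)
    obtain X' m' x where "cell Q X'" "m' \<in> Hom D X' M" "x \<in> Hom D (fst y) X'" "m' \<cdot> x = snd y"
      "\<And>C v. \<lbrakk>C \<in> Q; v \<in> Hom D C (fst y); snd y \<cdot> v = Zero D C M\<rbrakk> \<Longrightarrow> x \<cdot> v = Zero D C X'"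
      by (rule kill_step[OF Q y']) (rule that)
    then have "st (Suc n) (X', m')" "ok y (X', m') x" by (auto simp: st_def ok_def)
    then show "\<exists>y'. st (Suc n) y' \<and> (\<exists>x. ok y y' x)" by blast
  qed
  then obtain y where y: "\<And>n. st n (y n)" "\<And>n. \<exists>x. ok (y n) (y (Suc n)) x" by blast
  then obtain x where x: "\<And>n. ok (y n) (y (Suc n)) (x n)" by metis
  define X where "X n = fst (y n)" for n
  define m where "m n = snd (y n)" for n
  have cellX: "cell Q (X n)" and mH: "m n \<in> Hom D (X n) M" for n
    using y(1)[of n] by (simp_all add: st_def X_def m_def)
  have lift0: "\<exists>w\<in>Hom D C (X 0). m 0 \<cdot> w = v" if "C \<in> Q" "v \<in> Hom D C M" for C v
    using y(1)[of 0] that by (simp add: st_def X_def m_def)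
  have xH: "x n \<in> Hom D (X n) (X (Suc n))" and mx: "m (Suc n) \<cdot> x n = m n" for n
    using x[of n] by (simp_all add: ok_def X_def m_def)
  have kill: "x n \<cdot> v = Zero D C (X (Suc n))" if "C \<in> Q" "v \<in> Hom D C (X n)" "m n \<cdot> v = Zero D C M" for n C v
    using x[of n] that by (simp add: ok_def X_def m_def)
  obtain Y c where c: "milnor_cocone X x Y c" by (rule milnor_cocone_ex[of x X, OF xH])
  note cc = milnor_cocone_compat[OF c]
  obtain \<mu> where \<mu>: "\<mu> \<in> Hom D Y M" "\<And>n. \<mu> \<cdot> c n = m n"
    by (rule milnor_cocone_desc[OF c, of m, OF mH mx]) (rule that)
  have "cell_approx Q M Y \<mu>"
    unfolding cell_approx_def
  proof (intro conjI ballI allI impI)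
    show "cell Q Y" using cell.colim[OF cellX c] .
    show "\<mu> \<in> Hom D Y M" by (fact \<mu>)
    fix C v assume "C \<in> Q" "v \<in> Hom D C M"
    then obtain w where w: "w \<in> Hom D C (X 0)" "m 0 \<cdot> w = v" using lift0 by blast
    have "\<mu> \<cdot> c 0 \<cdot> w = m 0 \<cdot> w" by (rule Comp_reassoc[OF \<mu>(2) cc(2) \<mu>(1) w(1)])
    then show "\<exists>w\<in>Hom D C Y. \<mu> \<cdot> w = v" using w Comp_hom[OF w(1) cc(2)] by auto
  next
    fix T A B v f
    assume as: "localizing T \<and> Q \<subseteq> T \<and> rel_compact T B \<and> v \<in> Hom D B Y \<and> \<mu> \<cdot> v = Zero D B M \<and>
        f \<in> Hom D A B \<and> factors_via Q f"
    then have T: "localizing T" "Q \<subseteq> T" and B: "rel_compact T B" and v: "v \<in> Hom D B Y" "\<mu> \<cdot> v = Zero D B M"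
      and f: "f \<in> Hom D A B" "factors_via Q f" by auto
    have XT: "X n \<in> T" for n using cell_localizing[OF T cellX] .
    obtain n w where w: "w \<in> Hom D B (X n)" "v = c n \<cdot> w"
      using milnor_cocone_factor[OF c B localizingD(1)[OF T(1)] XT v(1)] by blast
    obtain C a b where C: "C \<in> Q" and ab: "a \<in> Hom D A C" "b \<in> Hom D C B" "f = b \<cdot> a"
      using factors_viaE[OF f(2,1)] by blast
    have mw: "m n \<cdot> w = Zero D B M"
      using Comp_reassoc[OF \<mu>(2) cc(2) \<mu>(1) w(1)] v(2) w(2) by simp
    have wb: "w \<cdot> b \<in> Hom D C (X n)" using Comp_hom[OF ab(2) w(1)] .
    have "m n \<cdot> w \<cdot> b = Zero D B M \<cdot> b" by (rule Comp_reassoc[OF mw w(1) mH ab(2)])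
    also have "\<dots> = Zero D C M" using ab(2) M by (simp add: Hom_iff)
    finally have z: "x n \<cdot> w \<cdot> b = Zero D C (X (Suc n))" using kill[OF C wb] by blast
    have Yo: "Y \<in> Obj D" by (fact cc)
    \<comment> \<open>The stage \<open>n\<close> representative becomes zero on \<open>C\<close>
      only after one more transition map, hence the passage from \<open>c n\<close> to
      \<open>c (Suc n)\<close>.\<close>
    have "v \<cdot> f = c n \<cdot> (w \<cdot> b) \<cdot> a"
      using w ab cc(2)[of n] by (simp add: Hom_iff)
    also have "c n = c (Suc n) \<cdot> x n" using cc(3) by simp
    also have "(c (Suc n) \<cdot> x n) \<cdot> (w \<cdot> b) \<cdot> a = c (Suc n) \<cdot> (x n \<cdot> w \<cdot> b) \<cdot> a"
      using cc(2)[of "Suc n"] xH[of n] wb w ab by (simp add: Hom_iff)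
    also have "\<dots> = Zero D A Y"
      unfolding z using ab cc(2)[of "Suc n"] Hom_objs[OF cc(2)[of "Suc n"]] Hom_objs[OF ab(1)]
      by (simp add: Hom_iff)
    finally show "v \<cdot> f = Zero D A Y" .
  qed
  with that show ?thesis .
qed

text \<open>The morphism \<open>f\<close> kills the component \<open>l u\<close> in
  \<open>X[1]\<close>, so \<open>u\<close> after \<open>f[1]\<close> lifts to \<open>M\<close>. Then
  \<open>g\<close> passes through \<open>Q\<close>, where maps into \<open>M\<close> lift on to
  \<open>X\<close>, and \<open>X -> M -> Z\<close> is zero. The first morphism is given unshifted
  because the approximation speaks about \<open>X\<close> while \<open>l\<close> ends in
  \<open>X[1]\<close>.\<close>

lemma cell_approx_cone:
  assumes app: "cell_approx Q M X m" and t: "tri X M Z m k l" and T: "localizing T" "Q \<subseteq> T"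
    and B: "rel_compact T B" and f: "f \<in> Hom D A B" "factors_via Q f"
    and g: "g \<in> Hom D E (Sh D A)" "factors_via Q g" and u: "u \<in> Hom D (Sh D B) Z"
  shows "u \<cdot> ShM D f \<cdot> g = Zero D E Z"
proof -
  note TT = triD[OF t]
  have Bo: "B \<in> Obj D" "A \<in> Obj D" using Hom_objs f(1) by blast+
  have lu: "l \<cdot> u \<in> Hom D (Sh D B) (Sh D X)" using Comp_hom[OF u TT(4)] .
  obtain v where v: "v \<in> Hom D B X" "ShM D v = l \<cdot> u"
    using ShM_full[OF lu Bo(1) TT(5)] by blast
  have "ShM D (m \<cdot> v) = ShM D m \<cdot> l \<cdot> u" using ShM_Comp[OF v(1) TT(2)] v(2) by simp
  also have "\<dots> = Zero D Z (Sh D M) \<cdot> u"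
    by (rule Comp_reassoc[OF tri_comp_Zero3[OF t] TT(4) ShM_hom[OF TT(2)] u])
  also have "\<dots> = Zero D (Sh D B) (Sh D M)" using u TT by (simp add: Hom_iff)
  finally have "m \<cdot> v = Zero D B M" using ShM_eq_Zero Comp_hom[OF v(1) TT(2)] by blast
  then have "v \<cdot> f = Zero D A X" using app T B v(1) f unfolding cell_approx_def by blast
  then have "ShM D v \<cdot> ShM D f = Zero D (Sh D A) (Sh D X)"
    using ShM_Comp[OF f(1) v(1)] Bo TT by simp
  then have "l \<cdot> u \<cdot> ShM D f = Zero D (Sh D A) (Sh D X)"
    using Comp_assoc[OF ShM_hom[OF f(1)] u TT(4)] v(2) by simp
  then obtain w where w: "w \<in> Hom D (Sh D A) M" "k \<cdot> w = u \<cdot> ShM D f"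
    using tri_lift2[OF t Comp_hom[OF ShM_hom[OF f(1)] u]] by blast
  obtain C a b where C: "C \<in> Q" and ab: "a \<in> Hom D E C" "b \<in> Hom D C (Sh D A)" "g = b \<cdot> a"
    using factors_viaE[OF g(2,1)] by blast
  obtain w' where w': "w' \<in> Hom D C X" "m \<cdot> w' = w \<cdot> b"
    using app C Comp_hom[OF ab(2) w(1)] unfolding cell_approx_def by blast
  have "u \<cdot> ShM D f \<cdot> g = (u \<cdot> ShM D f) \<cdot> g"
    using Comp_assoc[OF g(1) ShM_hom[OF f(1)] u] by simp
  also have "\<dots> = k \<cdot> (w \<cdot> b) \<cdot> a"
    unfolding w(2)[symmetric] ab(3) using w(1) ab(1,2) TT(3) by (simp add: Hom_iff)
  also have "\<dots> = (k \<cdot> m) \<cdot> w' \<cdot> a"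
    unfolding w'(2)[symmetric] using w'(1) ab(1) TT(2,3) by (simp add: Hom_iff)
  also have "\<dots> = Zero D E Z"
    unfolding tri_comp_Zero[OF t] using w'(1) ab(1) TT Hom_objs[OF ab(1)] by (simp add: Hom_iff)
  finally show ?thesis .
qed

end

section \<open>Compact objects are essentially small\<close>

context triangulated_category
begin

text \<open>One rotation turns the missing middle map into a left one.\<close>

lemma tri_map_middle:
  assumes t: "tri A B C f g h" and t': "tri A' B' C' f' g' h'"
    and a: "a \<in> Hom D A A'" and c: "c \<in> Hom D C C'" and eq: "ShM D a \<cdot> h = h' \<cdot> c"
  obtains b where "b \<in> Hom D B B'" "b \<cdot> f = f' \<cdot> a" "c \<cdot> g = g' \<cdot> b"
proof -
  note T = triD[OF t] and T' = triD[OF t']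
  obtain b where b: "b \<in> Hom D B B'" "c \<cdot> g = g' \<cdot> b"
    "ShM D b \<cdot> neg D (ShM D f) = neg D (ShM D f') \<cdot> ShM D a"
    by (rule tri_map_left[OF tri_rotate[OF t] tri_rotate[OF t'] c ShM_hom[OF a] eq])
  have "neg D (ShM D (b \<cdot> f)) = neg D (ShM D (f' \<cdot> a))"
    using b(1,3) a T(2) T'(2) by (simp add: Hom_iff)
  then have "ShM D (b \<cdot> f) = ShM D (f' \<cdot> a)"
    by (rule neg_inject) (use b(1) a T(2) T'(2) in \<open>simp_all add: Hom_iff\<close>)
  then have "b \<cdot> f = f' \<cdot> a"
    by (rule ShM_inj) (use b(1) a T(2) T'(2) in \<open>simp_all add: Hom_iff\<close>)
  with b that show ?thesis by blast
qed

text \<open>Complete \<open>k\<close> to a triangle and rotate back twice; the first vertex returns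
  to \<open>A\<close> because the shift is injective on objects.\<close>

lemma tri_from_connecting:
  assumes "k \<in> Hom D C (Sh D A)" "A \<in> Obj D"
  obtains B f g where "tri A B C f g k"
proof -
  obtain W g h where t: "tri C (Sh D A) W k g h" using tri_cone[OF assms(1)] by blast
  obtain W' w where t': "tri W' C (Sh D A) w k g" using tri_rotate_back[OF t] by blast
  obtain A' a where A': "A' \<in> Obj D" "Sh D A' = Sh D A" "tri A' W' C a w k"
    using tri_rotate_back[OF t'] by blast
  then have "A' = A" using Sh_inj assms(2) by blast
  with A' that show ?thesis by blast
qed

definition is_biproduct :: "'a \<Rightarrow> 'a \<Rightarrow> 'a \<Rightarrow> bool" where
  "is_biproduct A B S \<longleftrightarrow> (\<exists>i \<in> Hom D A S. \<exists>j \<in> Hom D B S. \<exists>p \<in> Hom D S A. \<exists>q \<in> Hom D S B.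
     p \<cdot> i = Ident D A \<and> q \<cdot> j = Ident D B \<and> p \<cdot> j = Zero D B A \<and> q \<cdot> i = Zero D A B \<and>
     i \<cdot> p \<boxplus> j \<cdot> q = Ident D S)"

text \<open>A row out of the biproduct times a column into it. The structure maps are exposed so
  that each of the two factors can be checked to lie in an ideal.\<close>

lemma factor_sum_biproduct:
  assumes S: "is_biproduct A B S" and a: "a \<in> Hom D K A" "a' \<in> Hom D A M"
    and b: "b \<in> Hom D K B" "b' \<in> Hom D B M"
  obtains i j p q where "i \<in> Hom D A S" "j \<in> Hom D B S" "p \<in> Hom D S A" "q \<in> Hom D S B"
    "a' \<cdot> a \<boxplus> b' \<cdot> b = (a' \<cdot> p \<boxplus> b' \<cdot> q) \<cdot> (i \<cdot> a \<boxplus> j \<cdot> b)"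
proof -
  obtain i j p q where H: "i \<in> Hom D A S" "j \<in> Hom D B S" "p \<in> Hom D S A" "q \<in> Hom D S B"
    and E: "p \<cdot> i = Ident D A" "q \<cdot> j = Ident D B" "p \<cdot> j = Zero D B A" "q \<cdot> i = Zero D A B"
    using S unfolding is_biproduct_def by blast
  define w where "w = i \<cdot> a \<boxplus> j \<cdot> b"
  have ia: "i \<cdot> a \<in> Hom D K S" and jb: "j \<cdot> b \<in> Hom D K S"
    using Comp_hom[OF a(1) H(1)] Comp_hom[OF b(1) H(2)] by auto
  have O: "A \<in> Obj D" "B \<in> Obj D" "K \<in> Obj D" using Hom_objs[OF a(1)] Hom_objs[OF b(1)] by auto
  have "p \<cdot> i \<cdot> a = a" "p \<cdot> j \<cdot> b = Zero D K A" "q \<cdot> i \<cdot> a = Zero D K B" "q \<cdot> j \<cdot> b = b"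
    using Comp_reassoc[OF E(1) H(1,3) a(1)] Comp_reassoc[OF E(3) H(2,3) b(1)]
      Comp_reassoc[OF E(4) H(1,4) a(1)] Comp_reassoc[OF E(2) H(2,4) b(1)] a(1) b(1) O
    by (simp_all add: Hom_iff)
  then have pw: "p \<cdot> w = a" and qw: "q \<cdot> w = b"
    using Comp_Add_right[OF ia jb H(3)] Comp_Add_right[OF ia jb H(4)] a(1) b(1) O
    by (simp_all add: w_def Hom_iff)
  have w: "w \<in> Hom D K S" using ia jb by (simp add: w_def Hom_iff)
  have "(a' \<cdot> p \<boxplus> b' \<cdot> q) \<cdot> w = a' \<cdot> p \<cdot> w \<boxplus> b' \<cdot> q \<cdot> w"
    using a(2) b(2) H w by (simp add: Hom_iff)
  then have "a' \<cdot> a \<boxplus> b' \<cdot> b = (a' \<cdot> p \<boxplus> b' \<cdot> q) \<cdot> w" using pw qw by simp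
  then show ?thesis by (intro that[OF H]) (simp add: w_def)
qed

end

context inaccessible_compactly_generated
begin

lemma localizing_Obj: "localizing (Obj D)"
proof -
  have "Cod D g \<in> Obj D" if "(f, g, h) \<in> Tri D" for f g h
    using triD(7)[OF Tri_tri[OF that]] .
  moreover have "Obj D \<noteq> {}" using ex_zero_object by (auto simp: zero_object_def)
  ultimately show ?thesis
    unfolding localizing_def triangulated_subcategory_def strictly_full_def
      closed_under_small_coproducts_def is_coproduct_def by (auto dest: Sh_obj)
qed

text \<open>When \<open>B\<close> and its shift belong to \<open>Q\<close>, both test morphisms can
  be identities, and the vanishing of a composite becomes orthogonality of the cone.\<close>

lemma cell_approx_cone_Hom_zero:
  assumes app: "cell_approx Q M X m" and t: "tri X M Z m k l" and T: "localizing T" "Q \<subseteq> T"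
    and B: "rel_compact T B" "B \<in> Q" "Sh D B \<in> Q" and u: "u \<in> Hom D (Sh D B) Z"
  shows "u = Zero D (Sh D B) Z"
proof -
  have Bo: "B \<in> Obj D" using B(1) by (simp add: rel_compact_def)
  have id: "Ident D B \<in> Hom D B B" "Ident D (Sh D B) \<in> Hom D (Sh D B) (Sh D B)"
    using Bo by (simp_all add: Hom_iff)
  have "factors_via Q (Ident D B)" "factors_via Q (Ident D (Sh D B))"
    using factors_viaI[OF B(2) id(1) id(1)] factors_viaI[OF B(3) id(2) id(2)] Bo by simp_all
  then have "u \<cdot> ShM D (Ident D B) \<cdot> Ident D (Sh D B) = Zero D (Sh D B) Z"
    using cell_approx_cone[OF app t T B(1) id(1) _ id(2) _ u] by blast
  then show ?thesis using u Bo ShM_Ident[OF Bo] by (simp add: Hom_iff)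
qed

section \<open>A small set of compact objects closed under the operations of the proof\<close>

text \<open>Just one biproduct per pair and one cone per morphism are asked for, and no closure
  under isomorphism, since an isomorphism class may fail to be small.\<close>

definition compact_core :: "'o set \<Rightarrow> bool" where
  "compact_core H \<longleftrightarrow> small \<kappa> H \<and> H \<noteq> {} \<and> (\<forall>B\<in>H. rel_compact (Obj D) B) \<and>
     (\<forall>B\<in>H. Sh D B \<in> H) \<and> (\<forall>B\<in>H. \<exists>A\<in>H. Sh D A = B) \<and>
     (\<forall>A\<in>H. \<forall>B\<in>H. \<exists>S\<in>H. is_biproduct A B S) \<and>
     (\<forall>A\<in>H. \<forall>B\<in>H. \<forall>f\<in>Hom D A B. \<exists>C\<in>H. \<exists>g h. tri A B C f g h) \<and>
     (\<forall>M\<in>Obj D. (\<forall>B\<in>H. Hom D B M = {Zero D B M}) \<longrightarrow> zero_object D M)"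

lemma compact_core_ex: obtains H where "compact_core H"
proof -
  obtain G where G: "small \<kappa> G" "\<forall>P \<in> G. compact_object \<kappa> D P"
    and gen: "\<forall>M \<in> Obj D. (\<forall>P \<in> G. \<forall>n. Hom D (shift_power D n P) M = {Zero D (shift_power D n P) M}) \<longrightarrow>
        zero_object D M"
    using ex_generators by blast
  obtain Z where Z: "zero_object D Z" using ex_zero_object by blast
  define K where "K = {B. rel_compact (Obj D) B}"
  have KO: "A \<in> Obj D" if "A \<in> K" for A using that by (simp add: K_def rel_compact_def)
  let ?unsh = "inv_into (Obj D) (Sh D)"
  define bip where "bip A B = (SOME S. is_biproduct A B S)" for A B
  define cone where "cone f = (SOME C. \<exists>g h. tri (Dom D f) (Cod D f) C f g h)" for f
  \<comment> \<open>One chosen object per construction keeps the value small, the cones being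
    indexed by a Hom set. The inverse shift is included because the generating condition involves
    all integer shifts.\<close>
  define \<Phi> where "\<Phi> A B = {Sh D A, ?unsh A, bip A B} \<union> cone ` Hom D A B" for A B
  have bip: "is_biproduct A B (bip A B)" if "A \<in> Obj D" "B \<in> Obj D" for A B
  proof -
    have "\<exists>S. is_biproduct A B S" using ex_biproduct[OF that] unfolding is_biproduct_def by blast
    then show ?thesis unfolding bip_def by (rule someI_ex)
  qed
  have cone: "\<exists>g h. tri A B (cone f) f g h" if fH: "f \<in> Hom D A B" for f A B
  proof -
    obtain C g h where t: "tri A B C f g h" using tri_cone[OF fH] by blast
    have "Dom D f = A" "Cod D f = B" using fH by (simp_all add: Hom_iff)
    then have "\<exists>C. \<exists>g h. tri (Dom D f) (Cod D f) C f g h" using t by blast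
    then have "\<exists>g h. tri (Dom D f) (Cod D f) (cone f) f g h" unfolding cone_def by (rule someI_ex)
    then show ?thesis using \<open>Dom D f = A\<close> \<open>Cod D f = B\<close> by simp
  qed
  have "small \<kappa> (\<Phi> A B) \<and> \<Phi> A B \<subseteq> K" if A: "A \<in> K" and B: "B \<in> K" for A B
  proof
    show "small \<kappa> (\<Phi> A B)"
      unfolding \<Phi>_def
      by (intro small_Un[OF inaccessible] small_image locally_small KO A B small_finite[OF inaccessible])
        simp
    have "Sh D A \<in> K" "?unsh A \<in> K"
      using A KO[OF A] Sh_inv[of A] rel_compact_Sh_iff[OF shift_invariant_Obj, of A]
        rel_compact_Sh_iff[OF shift_invariant_Obj, of "?unsh A"] by (simp_all add: K_def)
    moreover have "bip A B \<in> K"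
    proof -
      obtain i j p q where "i \<in> Hom D A (bip A B)" "j \<in> Hom D B (bip A B)" "p \<in> Hom D (bip A B) A"
        "q \<in> Hom D (bip A B) B" "i \<cdot> p \<boxplus> j \<cdot> q = Ident D (bip A B)"
        using bip[OF KO[OF A] KO[OF B]] unfolding is_biproduct_def by blast
      then show ?thesis using rel_compact_biproduct A B unfolding K_def by blast
    qed
    moreover have "cone f \<in> K" if fH: "f \<in> Hom D A B" for f
    proof -
      obtain g h where "tri A B (cone f) f g h" using cone[OF fH] by blast
      then show ?thesis using rel_compact_cone shift_invariant_Obj A B unfolding K_def by blast
    qed
    ultimately show "\<Phi> A B \<subseteq> K" unfolding \<Phi>_def by blast
  qed
  \<comment> \<open>The zero object makes \<open>H\<close> nonempty even if there are no generators;
    zero maps will have to factor through some member.\<close>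
  moreover have "small \<kappa> (insert Z G)"
    using small_Un[OF inaccessible small_finite[OF inaccessible, of "{Z}"] G(1)] by simp
  moreover have "insert Z G \<subseteq> K"
    using G(2) rel_compact_zero_object[OF Z] by (auto simp: K_def compact_object_iff)
  ultimately obtain H where H: "small \<kappa> H" "insert Z G \<subseteq> H" "H \<subseteq> K"
    and cl: "\<And>A B. A \<in> H \<Longrightarrow> B \<in> H \<Longrightarrow> \<Phi> A B \<subseteq> H"
    using small_closure[OF inaccessible, of "insert Z G" K \<Phi>] by metis
  have HO: "A \<in> Obj D" if "A \<in> H" for A using that H KO by blast
  have cl': "Sh D A \<in> H" "?unsh A \<in> H" "bip A B \<in> H" "f \<in> Hom D A B \<Longrightarrow> cone f \<in> H"
    if "A \<in> H" "B \<in> H" for A B f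
    using cl[OF that] unfolding \<Phi>_def by blast+
  have "shift_power D n P \<in> H" if "P \<in> H" for n P
  proof -
    have "(Sh D ^^ k) P \<in> H" for k using that cl' by (induction k) auto
    moreover have "(inv_into (Obj D) (Sh D) ^^ k) P \<in> H" for k
      using that cl'(2) by (induction k) auto
    ultimately show ?thesis by (simp add: shift_power_def)
  qed
  then have "zero_object D M" if "M \<in> Obj D" "\<forall>B\<in>H. Hom D B M = {Zero D B M}" for M
    using gen that H(2) by blast
  moreover have "\<exists>S\<in>H. is_biproduct A B S" if "A \<in> H" "B \<in> H" for A B
    using bip[OF HO[OF that(1)] HO[OF that(2)]] cl'(3)[OF that] by blast
  moreover have "\<exists>C\<in>H. \<exists>g h. tri A B C f g h" if "A \<in> H" "B \<in> H" "f \<in> Hom D A B" for A B f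
    using cone[OF that(3)] cl'(4)[OF that] by blast
  moreover have "\<exists>A\<in>H. Sh D A = B" if "B \<in> H" for B
    using Sh_inv(2)[OF HO[OF that]] cl'(2)[OF that that] by blast
  moreover have "\<forall>B\<in>H. rel_compact (Obj D) B" using H(3) by (auto simp: K_def)
  moreover have "H \<noteq> {}" using H(2) by blast
  ultimately have "compact_core H" unfolding compact_core_def using H(1) cl'(1) by blast
  with that show ?thesis .
qed

context
  fixes H assumes H: "compact_core H"
begin

lemma
  shows core_small: "small \<kappa> H" and core_nonempty: "H \<noteq> {}"
    and core_compact: "B \<in> H \<Longrightarrow> rel_compact (Obj D) B"
    and core_Sh: "B \<in> H \<Longrightarrow> Sh D B \<in> H" and core_unSh: "B \<in> H \<Longrightarrow> \<exists>A\<in>H. Sh D A = B"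
    and core_biproduct: "A \<in> H \<Longrightarrow> B \<in> H \<Longrightarrow> \<exists>S\<in>H. is_biproduct A B S"
    and core_cone: "A \<in> H \<Longrightarrow> B \<in> H \<Longrightarrow> f \<in> Hom D A B \<Longrightarrow> \<exists>C\<in>H. \<exists>g h. tri A B C f g h"
  using H by (simp_all add: compact_core_def)

lemma core_obj: "H \<subseteq> Obj D"
  using H by (auto simp: compact_core_def rel_compact_def)

lemma core_generates:
  assumes M: "M \<in> Obj D" and z: "\<And>B u. B \<in> H \<Longrightarrow> u \<in> Hom D B M \<Longrightarrow> u = Zero D B M"
  shows "zero_object D M"
proof -
  have "Zero D B M \<in> Hom D B M" if "B \<in> H" for B using that core_obj M by (auto simp: Hom_iff)
  then have "\<forall>B\<in>H. Hom D B M = {Zero D B M}" using z by blast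
  then show "zero_object D M" using H M by (simp add: compact_core_def)
qed

lemma factors_via_core_add:
  assumes u: "u \<in> Hom D K M" "factors_via H u" and v: "v \<in> Hom D K M" "factors_via H v"
  shows "factors_via H (u \<boxplus> v)"
proof -
  obtain A a a' where A: "A \<in> H" and a: "a \<in> Hom D K A" "a' \<in> Hom D A M" "u = a' \<cdot> a"
    using factors_viaE[OF u(2,1)] by blast
  obtain B b b' where B: "B \<in> H" and b: "b \<in> Hom D K B" "b' \<in> Hom D B M" "v = b' \<cdot> b"
    using factors_viaE[OF v(2,1)] by blast
  obtain S where S: "S \<in> H" "is_biproduct A B S" using core_biproduct[OF A B] by blast
  obtain i j p q where ij: "i \<in> Hom D A S" "j \<in> Hom D B S" "p \<in> Hom D S A" "q \<in> Hom D S B"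
    and e: "a' \<cdot> a \<boxplus> b' \<cdot> b = (a' \<cdot> p \<boxplus> b' \<cdot> q) \<cdot> (i \<cdot> a \<boxplus> j \<cdot> b)"
    by (rule factor_sum_biproduct[OF S(2) a(1,2) b(1,2)])
  show ?thesis
  proof (rule factors_viaI[OF S(1)])
    show "i \<cdot> a \<boxplus> j \<cdot> b \<in> Hom D K S" "a' \<cdot> p \<boxplus> b' \<cdot> q \<in> Hom D S M"
      using ij a(1,2) b(1,2) by (simp_all add: Hom_iff)
    show "u \<boxplus> v = (a' \<cdot> p \<boxplus> b' \<cdot> q) \<cdot> (i \<cdot> a \<boxplus> j \<cdot> b)" using e a(3) b(3) by simp
  qed
qed

text \<open>Compactness turns \<open>u\<close> into a finite sum of maps through single summands,
  and biproducts in \<open>H\<close> merge these into one factorization.\<close>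

lemma coproduct_of_core_factor:
  assumes F: "coproduct_of H F" and K: "rel_compact (Obj D) K" and u: "u \<in> Hom D K F"
  shows "factors_via H u"
proof -
  obtain J :: "'u set" and X \<iota> where J: "small \<kappa> J" and cp: "is_coproduct D J X F \<iota>"
    and X: "\<And>j. j \<in> J \<Longrightarrow> X j \<in> H"
    using F unfolding coproduct_of_def by blast
  note CP = is_coproductD[OF cp]
  have Ko: "K \<in> Obj D" using K by (simp add: rel_compact_def)
  have "fin_supp J F \<iota> u" using rel_compactD[OF K J cp CP(2) u] .
  then obtain E e where E: "finite E" "E \<subseteq> J" and e: "is_cut J F \<iota> E e" "e \<cdot> u = u"
    by (auto simp: fin_supp_def)
  have "e \<cdot> u \<in> {v. factors_via H v}"
  proof (rule is_cut_comp_induct[OF cp E e(1) u])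
    obtain B where B: "B \<in> H" using core_nonempty by blast
    then have Bo: "B \<in> Obj D" using core_obj by blast
    have "factors_via H (Zero D K F)"
      by (rule factors_viaI[OF B, of "Zero D K B" _ "Zero D B F"]) (use Bo Ko CP(1) in \<open>simp_all add: Hom_iff\<close>)
    then show "Zero D K F \<in> {v. factors_via H v}" by simp
    show "v \<boxplus> w \<in> {v. factors_via H v}"
      if "v \<in> {v. factors_via H v}" "w \<in> {v. factors_via H v}" "v \<in> Hom D K F" "w \<in> Hom D K F" for v w
      using factors_via_core_add that by blast
    fix j p assume j: "j \<in> E" and "is_proj J X F \<iota> j p"
    then have p: "p \<in> Hom D F (X j)" and jJ: "j \<in> J" using E by (auto simp: is_proj_def)
    have "factors_via H (\<iota> j \<cdot> p \<cdot> u)"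
      using factors_viaI[OF X[OF jJ] Comp_hom[OF u p] CP(3)[OF jJ]] by blast
    then show "\<iota> j \<cdot> p \<cdot> u \<in> {v. factors_via H v}" by simp
  qed
  then show ?thesis using e(2) by simp
qed

text \<open>The claim covers all compact \<open>K\<close> at once because the attaching step passes
  from \<open>K\<close> to another compact object. There \<open>h u\<close> runs through some
  \<open>B1\<close> in \<open>H\<close>; the fibre \<open>L\<close> of \<open>K -> B1\<close> maps
  to the earlier stage, where induction applies, and the factorization found is transported to a
  cone in \<open>H\<close>.\<close>

lemma cell_core_factor:
  assumes "cell H M"
  shows "\<forall>K u. rel_compact (Obj D) K \<longrightarrow> u \<in> Hom D K M \<longrightarrow> factors_via H u"
  using assms
proof induction
  case (coprod F)
  then show ?case using coproduct_of_core_factor by blast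
next
  case (colim M f C c)
  have MO: "M n \<in> Obj D" for n
    using cell_localizing[OF localizing_Obj core_obj colim.hyps(1)] .
  show ?case
  proof (intro allI impI)
    fix K u assume K: "rel_compact (Obj D) K" and u: "u \<in> Hom D K C"
    obtain n w where w: "w \<in> Hom D K (M n)" "u = c n \<cdot> w"
      by (rule milnor_cocone_factor[OF colim.hyps(2) K shift_invariant_Obj MO u])
    obtain B a b where B: "B \<in> H" "a \<in> Hom D K B" "b \<in> Hom D B (M n)" "w = b \<cdot> a"
      using factors_viaE[of H w K "M n"] colim.IH[of n] K w(1) by metis
    have cn: "c n \<in> Hom D (M n) C" using milnor_cocone_compat(2)[OF colim.hyps(2)] .
    have "u = (c n \<cdot> b) \<cdot> a" using Comp_assoc[OF B(2,3) cn] w(2) B(4) by simp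
    then show "factors_via H u" using factors_viaI[OF B(1,2) Comp_hom[OF B(3) cn]] by blast
  qed
next
  case (attach X F Y \<phi> x h)
  note t = attach.hyps(3)
  note T = triD[OF t]
  show ?case
  proof (intro allI impI)
    fix K u assume K: "rel_compact (Obj D) K" and u: "u \<in> Hom D K Y"
    have "coproduct_of H (Sh D F)"
    proof -
      obtain J :: "'u set" and V \<iota> where "small \<kappa> J" "is_coproduct D J V F \<iota>" "\<forall>j\<in>J. V j \<in> H"
        using attach.hyps(2) unfolding coproduct_of_def by blast
      then show ?thesis using coproduct_ofI[OF _ is_coproduct_Sh, of J V F \<iota> H] core_Sh by simp
    qed
    then have "factors_via H (h \<cdot> u)"
      using coproduct_of_core_factor[OF _ K] Comp_hom[OF u T(4)] by blast
    then obtain B1 k \<beta>' where B1: "B1 \<in> H" and k: "k \<in> Hom D K B1" and \<beta>': "\<beta>' \<in> Hom D B1 (Sh D F)"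
      and hu: "h \<cdot> u = \<beta>' \<cdot> k"
      using factors_viaE[OF _ Comp_hom[OF u T(4)]] by blast
    obtain B0 where B0: "B0 \<in> H" "Sh D B0 = B1" using core_unSh[OF B1] by blast
    have B0o: "B0 \<in> Obj D" using B0 core_obj by blast
    obtain \<beta> where \<beta>: "\<beta> \<in> Hom D B0 F" "ShM D \<beta> = \<beta>'"
      using ShM_full[of \<beta>' B0 F] \<beta>' B0(2) B0o T(5) by blast
    have k': "k \<in> Hom D K (Sh D B0)" using k B0(2) by simp
    \<comment> \<open>The fibre of \<open>k\<close>, an extension of \<open>K\<close> by
      \<open>B0\<close> and thus compact. On it \<open>u\<close> comes from the earlier stage
      \<open>X\<close>.\<close>
    obtain L a w where tL: "tri B0 L K a w k" using tri_from_connecting[OF k' B0o] by blast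
    note TL = triD[OF tL]
    have Lc: "rel_compact (Obj D) L" using rel_compact_extension[OF tL core_compact[OF B0(1)] K] .
    obtain \<gamma> where \<gamma>: "\<gamma> \<in> Hom D L X" "\<gamma> \<cdot> a = \<phi> \<cdot> \<beta>" "u \<cdot> w = x \<cdot> \<gamma>"
      by (rule tri_map_middle[OF tL t \<beta>(1) u]) (simp add: hu \<beta>(2))
    have "factors_via H \<gamma>" using attach.IH Lc \<gamma>(1) by blast
    then obtain B z y where B: "B \<in> H" and z: "z \<in> Hom D L B" and y: "y \<in> Hom D B X" and yz: "\<gamma> = y \<cdot> z"
      using factors_viaE[OF _ \<gamma>(1)] by blast
    have za: "z \<cdot> a \<in> Hom D B0 B" using Comp_hom[OF TL(2) z] .
    \<comment> \<open>\<open>B'\<close> stands to \<open>B\<close> as \<open>K\<close> stands to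
      \<open>L\<close>: both are cones of maps from \<open>B0\<close>. This yields \<open>p\<close>
      from \<open>K\<close> to \<open>B'\<close> and \<open>q\<close> from \<open>B'\<close> to
      \<open>Y\<close>.\<close>
    obtain B' s r where B': "B' \<in> H" and tB: "tri B0 B B' (z \<cdot> a) s r"
      using core_cone[OF B0(1) B za] by blast
    note TB = triD[OF tB]
    obtain p where p: "p \<in> Hom D K B'" "p \<cdot> w = s \<cdot> z"
      by (rule tri_map[OF tL tB Ident_hom[OF B0o] z]) (use Comp_Ident[OF za] in simp)
    have "y \<cdot> z \<cdot> a = \<phi> \<cdot> \<beta>" using \<gamma>(2) yz Comp_assoc[OF TL(2) z y] by simp
    then obtain q where q: "q \<in> Hom D B' Y" "q \<cdot> s = x \<cdot> y"
      by (rule tri_map[OF tB t \<beta>(1) y])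
    have qp: "q \<cdot> p \<in> Hom D K Y" using Comp_hom[OF p(1) q(1)] .
    have d: "u \<boxminus> q \<cdot> p \<in> Hom D K Y" using u qp by (simp add: Hom_iff)
    \<comment> \<open>The map \<open>q p\<close> need not equal \<open>u\<close>, but both agree on
      \<open>L\<close>; so the difference factors through \<open>k\<close> and hence through
      \<open>B1\<close>, which is again in \<open>H\<close>.\<close>
    have "(q \<cdot> p) \<cdot> w = (q \<cdot> s) \<cdot> z"
      using Comp_assoc[OF TL(3) p(1) q(1)] Comp_assoc[OF z TB(3) q(1)] p(2) by simp
    also have "\<dots> = u \<cdot> w" using q(2) Comp_assoc[OF z y T(3)] yz \<gamma>(3) by simp
    finally have "(u \<boxminus> q \<cdot> p) \<cdot> w = u \<cdot> w \<boxminus> u \<cdot> w"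
      using u qp TL(3) by (simp add: Hom_iff del: Comp_assoc_eq sub_self)
    also have "\<dots> = Zero D L Y" using u TL(3) by (simp add: Hom_iff)
    finally obtain e where e: "e \<in> Hom D (Sh D B0) Y" "e \<cdot> k = u \<boxminus> q \<cdot> p"
      using tri_extend2[OF tL d] by blast
    have "factors_via H (u \<boxminus> q \<cdot> p)"
      using factors_viaI[OF _ k' e(1)] e(2) B1 B0(2) by metis
    moreover have "factors_via H (q \<cdot> p)" using factors_viaI[OF B' p(1) q(1)] by blast
    ultimately have "factors_via H (q \<cdot> p \<boxplus> (u \<boxminus> q \<cdot> p))"
      using factors_via_core_add[OF qp _ d] by blast
    moreover have "q \<cdot> p \<boxplus> (u \<boxminus> q \<cdot> p) = u" using u qp by (simp add: Hom_iff)
    ultimately show "factors_via H u" by simp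
  qed
qed

lemma compact_retract_of_core:
  assumes K: "rel_compact (Obj D) K"
  obtains B i p where "B \<in> H" "i \<in> Hom D K B" "p \<in> Hom D B K" "p \<cdot> i = Ident D K"
proof -
  have Ko: "K \<in> Obj D" using K by (simp add: rel_compact_def)
  obtain X m where app: "cell_approx H K X m"
    by (rule cell_approx_ex[OF core_small core_obj Ko])
  then have X: "cell H X" and m: "m \<in> Hom D X K" by (auto simp: cell_approx_def)
  obtain Z k l where t: "tri X K Z m k l" using tri_cone[OF m] by blast
  have "zero_object D Z"
  proof (rule core_generates)
    show "Z \<in> Obj D" using triD(7)[OF t] .
    fix B u assume B: "B \<in> H" and u: "u \<in> Hom D B Z"
    obtain A where A: "A \<in> H" "Sh D A = B" using core_unSh[OF B] by blast
    then show "u = Zero D B Z"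
      using cell_approx_cone_Hom_zero[OF app t localizing_Obj core_obj core_compact[OF A(1)] A(1), of u]
        B u by simp
  qed
  then obtain s where s: "s \<in> Hom D K X" "m \<cdot> s = Ident D K" using tri_zero_cone_section[OF t] by blast
  have "factors_via H s" using cell_core_factor[OF X] K s(1) by blast
  then obtain B a b where B: "B \<in> H" "a \<in> Hom D K B" "b \<in> Hom D B X" "s = b \<cdot> a"
    using factors_viaE[OF _ s(1)] by blast
  have "(m \<cdot> b) \<cdot> a = Ident D K" using Comp_assoc[OF B(2,3) m] s(2) B(4) by simp
  with that B(1,2) Comp_hom[OF B(3) m] show ?thesis by blast
qed

end

end

section \<open>Orthogonal classes and ideals of compact objects\<close>

context inaccessible_compactly_generated
begin

section \<open>Localizing classes and orthogonals\<close>

lemma localizingI: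
  assumes "T \<subseteq> Obj D" "T \<noteq> {}"
    and iso: "\<And>A B e. A \<in> T \<Longrightarrow> B \<in> Obj D \<Longrightarrow> iso_arr D A B e \<Longrightarrow> B \<in> T"
    and sh: "\<And>A. A \<in> Obj D \<Longrightarrow> Sh D A \<in> T \<longleftrightarrow> A \<in> T"
    and cone: "\<And>A B C f g h. tri A B C f g h \<Longrightarrow> A \<in> T \<Longrightarrow> B \<in> T \<Longrightarrow> C \<in> T"
    and cop: "\<And>F. coproduct_of T F \<Longrightarrow> F \<in> T"
  shows "localizing T"
proof -
  have "strictly_full D T" unfolding strictly_full_def using assms(1) iso by blast
  moreover have "Cod D g \<in> T" if "(f, g, h) \<in> Tri D" "Dom D f \<in> T" "Cod D f \<in> T" for f g h
    using cone[OF Tri_tri[OF that(1)]] that by blast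
  ultimately have "triangulated_subcategory D T"
    unfolding triangulated_subcategory_def using assms(2) sh by blast
  moreover have "closed_under_small_coproducts \<kappa> D T"
    unfolding closed_under_small_coproducts_def
  proof (intro allI impI)
    fix J :: "'u set" and X S \<iota>
    assume "small \<kappa> J \<and> is_coproduct D J X S \<iota> \<and> (\<forall>j\<in>J. X j \<in> T)"
    then have "coproduct_of T S" unfolding coproduct_of_def by blast
    then show "S \<in> T" by (rule cop)
  qed
  ultimately show ?thesis by (simp add: localizing_def)
qed

lemma localizing_strictly_full: "localizing T \<Longrightarrow> strictly_full D T"
  by (simp add: localizing_def triangulated_subcategory_def)

text \<open>All closure conditions pass to intersections. That the intersection consists of objects
  uses \<open>Obj D\<close> itself as a member of the family, which is why \<open>P\<close> is
  assumed to consist of objects.\<close>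

lemma localizing_Tria:
  shows "P \<subseteq> Tria \<kappa> D P" and "localizing T \<Longrightarrow> P \<subseteq> T \<Longrightarrow> Tria \<kappa> D P \<subseteq> T"
    and "P \<subseteq> Obj D \<Longrightarrow> localizing (Tria \<kappa> D P)"
proof -
  have eq: "Tria \<kappa> D P = \<Inter> {T. localizing T \<and> P \<subseteq> T}"
    by (simp add: Tria_def localizing_def conj_assoc)
  show "P \<subseteq> Tria \<kappa> D P" "localizing T \<Longrightarrow> P \<subseteq> T \<Longrightarrow> Tria \<kappa> D P \<subseteq> T"
    unfolding eq by auto
  assume P: "P \<subseteq> Obj D"
  obtain Z where Z: "zero_object D Z" using ex_zero_object by blast
  have Zo: "Z \<in> Obj D" using Z by (simp add: zero_object_def)
  \<comment> \<open>A zero object is the empty coproduct, so it lies in every localizing class and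
    the intersection is nonempty.\<close>
  have Zin: "Z \<in> T" if T: "localizing T" for T
  proof -
    have "is_coproduct D ({} :: 'u set) (\<lambda>_. Z) Z (\<lambda>_. Ident D Z)"
      using Z by (simp add: is_coproduct_def zero_object_def)
    then have "coproduct_of T Z"
      by (rule coproduct_ofI[rotated]) (simp_all add: small_finite[OF inaccessible])
    then show ?thesis by (rule localizingD(4)[OF T])
  qed
  show "localizing (Tria \<kappa> D P)"
  proof (rule localizingI)
    have sub: "Tria \<kappa> D P \<subseteq> T" if "localizing T" "P \<subseteq> T" for T using that by (auto simp: eq)
    have mem: "A \<in> Tria \<kappa> D P" if "\<And>T. localizing T \<Longrightarrow> P \<subseteq> T \<Longrightarrow> A \<in> T" for A
      using that by (simp add: eq)
    show "Tria \<kappa> D P \<subseteq> Obj D" using sub localizing_Obj P .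
    have "Z \<in> Tria \<kappa> D P" using Zin by (intro mem)
    then show "Tria \<kappa> D P \<noteq> {}" by blast
    show "B \<in> Tria \<kappa> D P" if "A \<in> Tria \<kappa> D P" "B \<in> Obj D" "iso_arr D A B e" for A B e
    proof (rule mem)
      fix T assume T: "localizing T" "P \<subseteq> T"
      then have "A \<in> T" using sub[OF T] that(1) by blast
      then show "B \<in> T"
        using localizing_strictly_full[OF T(1)] that(2,3) unfolding strictly_full_def by blast
    qed
    show "Sh D A \<in> Tria \<kappa> D P \<longleftrightarrow> A \<in> Tria \<kappa> D P" if A: "A \<in> Obj D" for A
    proof -
      have "Sh D A \<in> T \<longleftrightarrow> A \<in> T" if "localizing T" for T
        using localizingD(1)[OF that] A by (simp add: shift_invariant_def)
      then show ?thesis by (auto simp: eq)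
    qed
    show "C \<in> Tria \<kappa> D P" if t: "tri A B C f g h" and AB: "A \<in> Tria \<kappa> D P" "B \<in> Tria \<kappa> D P" for A B C f g h
    proof (rule mem)
      fix T assume T: "localizing T" "P \<subseteq> T"
      show "C \<in> T" by (rule localizingD(3)[OF T(1) t]) (use AB sub[OF T] in blast)+
    qed
    show "F \<in> Tria \<kappa> D P" if "coproduct_of (Tria \<kappa> D P) F" for F
    proof (rule mem)
      fix T assume T: "localizing T" "P \<subseteq> T"
      show "F \<in> T" by (rule localizingD(4)[OF T(1) coproduct_of_mono[OF that sub[OF T]]])
    qed
  qed
qed

lemma cell_Tria: "P \<subseteq> Obj D \<Longrightarrow> cell P X \<Longrightarrow> X \<in> Tria \<kappa> D P"
  by (rule cell_localizing[OF localizing_Tria(3) localizing_Tria(1)])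

definition left_perp :: "'o set \<Rightarrow> 'o set" where
  "left_perp S = {W \<in> Obj D. \<forall>Z\<in>S. \<forall>u\<in>Hom D W Z. u = Zero D W Z}"

definition right_perp :: "'o set \<Rightarrow> 'o set" where
  "right_perp S = {Z \<in> Obj D. \<forall>W\<in>S. \<forall>u\<in>Hom D W Z. u = Zero D W Z}"

text \<open>For subsets of \<open>Obj D\<close> this amounts to \<open>shift_invariant\<close>, as
  the shift is injective on objects; in this form a condition on all members can be reindexed along
  the shift.\<close>

definition shift_closed :: "'o set \<Rightarrow> bool" where
  "shift_closed S \<longleftrightarrow> (\<forall>B\<in>S. Sh D B \<in> S) \<and> (\<forall>B\<in>S. \<exists>A\<in>S. Sh D A = B)"

lemma shift_invariant_closed: "shift_invariant T \<Longrightarrow> shift_closed T"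
  unfolding shift_closed_def
proof (intro conjI ballI)
  assume T: "shift_invariant T"
  fix B assume B: "B \<in> T"
  then show "Sh D B \<in> T" using T by (auto simp: shift_invariant_def)
  obtain A where "A \<in> Obj D" "Sh D A = B" using Sh_surj B T by (auto simp: shift_invariant_def)
  then show "\<exists>A\<in>T. Sh D A = B" using B T by (auto simp: shift_invariant_def)
qed

lemma Hom_Sh_zero_iff:
  assumes "A \<in> Obj D" "B \<in> Obj D"
  shows "(\<forall>u\<in>Hom D (Sh D A) (Sh D B). u = Zero D (Sh D A) (Sh D B)) \<longleftrightarrow> (\<forall>u\<in>Hom D A B. u = Zero D A B)"
proof (intro iffI ballI)
  fix u assume "\<forall>u\<in>Hom D (Sh D A) (Sh D B). u = Zero D (Sh D A) (Sh D B)" "u \<in> Hom D A B"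
  then show "u = Zero D A B" using ShM_hom ShM_eq_Zero by blast
next
  fix u assume z: "\<forall>u\<in>Hom D A B. u = Zero D A B" and u: "u \<in> Hom D (Sh D A) (Sh D B)"
  obtain v where v: "v \<in> Hom D A B" "ShM D v = u" using ShM_full[OF u assms] .
  then have "v = Zero D A B" using z by blast
  then show "u = Zero D (Sh D A) (Sh D B)" using v(2) assms by simp
qed

lemma shift_closed_ball_iff:
  assumes "shift_closed S" "\<And>B. B \<in> S \<Longrightarrow> P (Sh D B) \<longleftrightarrow> Q B"
  shows "(\<forall>B\<in>S. P B) \<longleftrightarrow> (\<forall>B\<in>S. Q B)"
  using assms unfolding shift_closed_def by metis

lemma right_perp_shift_invariant:
  assumes S: "shift_closed S" "S \<subseteq> Obj D"
  shows "shift_invariant (right_perp S)"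
proof -
  have "Sh D Z \<in> right_perp S \<longleftrightarrow> Z \<in> right_perp S" if Z: "Z \<in> Obj D" for Z
  proof -
    have "(\<forall>W\<in>S. \<forall>u\<in>Hom D W (Sh D Z). u = Zero D W (Sh D Z)) \<longleftrightarrow>
        (\<forall>W\<in>S. \<forall>u\<in>Hom D W Z. u = Zero D W Z)"
      by (rule shift_closed_ball_iff[OF S(1)], rule Hom_Sh_zero_iff) (use S(2) Z in auto)
    then show ?thesis using Z by (simp add: right_perp_def)
  qed
  then show ?thesis by (auto simp: shift_invariant_def right_perp_def)
qed

lemma iso_arr_inverse:
  assumes "iso_arr D A B e"
  obtains e' where "e \<in> Hom D A B" "e' \<in> Hom D B A" "e' \<cdot> e = Ident D A" "e \<cdot> e' = Ident D B"
  using assms unfolding iso_arr_def by blast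

lemma right_perp_strictly_full: "strictly_full D (right_perp S)"
  unfolding strictly_full_def
proof (intro conjI ballI impI)
  show "right_perp S \<subseteq> Obj D" by (auto simp: right_perp_def)
  fix A B assume A: "A \<in> right_perp S" and B: "B \<in> Obj D" and "\<exists>e. iso_arr D A B e"
  then obtain e e' where e: "e \<in> Hom D A B" "e' \<in> Hom D B A" "e \<cdot> e' = Ident D B"
    using iso_arr_inverse by metis
  have "u = Zero D W B" if W: "W \<in> S" and u: "u \<in> Hom D W B" for W u
  proof -
    have z: "e' \<cdot> u = Zero D W A" using A W Comp_hom[OF u e(2)] by (simp add: right_perp_def)
    have "u = e \<cdot> e' \<cdot> u" using Comp_reassoc[OF e(3,2,1) u] Ident_Comp[OF u] by simp
    then show ?thesis unfolding z using e(1) Hom_objs[OF u] by (simp add: Hom_iff)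
  qed
  then show "B \<in> right_perp S" using B by (simp add: right_perp_def)
qed

text \<open>Shift-invariance of \<open>S\<close> puts \<open>A[1]\<close> into the orthogonal
  together with \<open>A\<close>. The cone step depends on this, since a map from \<open>C\<close>
  that vanishes on \<open>B\<close> factors through \<open>A[1]\<close>.\<close>

lemma localizing_left_perp:
  assumes S: "shift_invariant S"
  shows "localizing (left_perp S)"
proof (rule localizingI)
  have SO: "S \<subseteq> Obj D" using S by (simp add: shift_invariant_def)
  show "left_perp S \<subseteq> Obj D" by (auto simp: left_perp_def)
  obtain Z where "zero_object D Z" using ex_zero_object by blast
  then have "Z \<in> left_perp S" using zero_object_Hom by (auto simp: left_perp_def zero_object_def)
  then show "left_perp S \<noteq> {}" by blast
  show "B \<in> left_perp S" if A: "A \<in> left_perp S" and B: "B \<in> Obj D" and i: "iso_arr D A B e" for A B e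
  proof -
    obtain e' where e: "e \<in> Hom D A B" "e' \<in> Hom D B A" "e \<cdot> e' = Ident D B"
      using iso_arr_inverse[OF i] by blast
    have "u = Zero D B Z" if Z: "Z \<in> S" and u: "u \<in> Hom D B Z" for Z u
    proof -
      have z: "u \<cdot> e = Zero D A Z" using A Z Comp_hom[OF e(1) u] by (simp add: left_perp_def)
      have "u = (u \<cdot> e) \<cdot> e'" using Comp_assoc[OF e(2,1) u] e(3) Comp_Ident[OF u] by simp
      then show ?thesis unfolding z using e(2) Hom_objs[OF u] by (simp add: Hom_iff)
    qed
    then show ?thesis using B by (simp add: left_perp_def)
  qed
  show "Sh D A \<in> left_perp S \<longleftrightarrow> A \<in> left_perp S" if A: "A \<in> Obj D" for A
  proof -
    have "(\<forall>Z\<in>S. \<forall>u\<in>Hom D (Sh D A) Z. u = Zero D (Sh D A) Z) \<longleftrightarrow>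
        (\<forall>Z\<in>S. \<forall>u\<in>Hom D A Z. u = Zero D A Z)"
      by (rule shift_closed_ball_iff[OF shift_invariant_closed[OF S]], rule Hom_Sh_zero_iff)
        (use SO A in auto)
    then show ?thesis using A by (simp add: left_perp_def)
  qed
  then have sh: "Sh D A \<in> left_perp S" if "A \<in> left_perp S" for A
    using that by (auto simp: left_perp_def)
  show "C \<in> left_perp S" if t: "tri A B C f g h" and A: "A \<in> left_perp S" and B: "B \<in> left_perp S"
    for A B C f g h
  proof -
    note T = triD[OF t]
    have "u = Zero D C Z" if Z: "Z \<in> S" and u: "u \<in> Hom D C Z" for Z u
    proof -
      have "u \<cdot> g = Zero D B Z" using B Z Comp_hom[OF T(3) u] by (simp add: left_perp_def)
      then obtain w where w: "w \<in> Hom D (Sh D A) Z" "w \<cdot> h = u" using tri_extend2[OF t u] by blast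
      have "w = Zero D (Sh D A) Z" using sh[OF A] Z w(1) by (simp add: left_perp_def)
      then show ?thesis using w(2) T(4) Hom_objs[OF u] by (simp add: Hom_iff)
    qed
    then show ?thesis using T(7) by (simp add: left_perp_def)
  qed
  show "F \<in> left_perp S" if "coproduct_of (left_perp S) F" for F
  proof -
    obtain J :: "'u set" and X \<iota> where cp: "is_coproduct D J X F \<iota>" and X: "\<And>j. j \<in> J \<Longrightarrow> X j \<in> left_perp S"
      using \<open>coproduct_of (left_perp S) F\<close> unfolding coproduct_of_def by blast
    note CP = is_coproductD[OF cp]
    have "u = Zero D F Z" if Z: "Z \<in> S" and u: "u \<in> Hom D F Z" for Z u
    proof (rule is_coproduct_eqI[OF cp u])
      have Zo: "Z \<in> Obj D" using Z SO by blast
      show "Zero D F Z \<in> Hom D F Z" using CP(1) Zo by (simp add: Hom_iff)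
      fix j assume j: "j \<in> J"
      have "u \<cdot> \<iota> j = Zero D (X j) Z"
        using X[OF j] Z Comp_hom[OF CP(3)[OF j] u] by (simp add: left_perp_def)
      then show "u \<cdot> \<iota> j = Zero D F Z \<cdot> \<iota> j" using CP(3)[OF j] Zo by (simp add: Hom_iff)
    qed
    then show ?thesis using CP(1) by (simp add: left_perp_def)
  qed
qed

section \<open>Idempotent, shift-stable ideals of compact objects\<close>

context
  fixes I assumes ideal: "compact_ideal \<kappa> D I" and idem: "idempotent_ideal \<kappa> D I" and shift: "ShM D ` I = I"
begin

lemma ideal_arr:
  assumes "f \<in> I"
  shows "f \<in> Hom D (Dom D f) (Cod D f)" "rel_compact (Obj D) (Dom D f)" "rel_compact (Obj D) (Cod D f)"
  using assms ideal by (auto simp: compact_ideal_def compact_arrows_def compact_object_iff Hom_iff)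

lemma ideal_subgroup:
  assumes "rel_compact (Obj D) A" "rel_compact (Obj D) B"
  shows "subgroup (I \<inter> Hom D A B) (hom_group D A B)"
  using ideal assms by (simp add: compact_ideal_def compact_object_iff)

lemma ideal_Zero: "rel_compact (Obj D) A \<Longrightarrow> rel_compact (Obj D) B \<Longrightarrow> Zero D A B \<in> I"
  using subgroup.one_closed[OF ideal_subgroup] by simp

lemma ideal_Add:
  assumes "f \<in> I" "g \<in> I" "f \<in> Hom D A B" "g \<in> Hom D A B"
  shows "f \<boxplus> g \<in> I"
proof -
  have "rel_compact (Obj D) A" "rel_compact (Obj D) B"
    using ideal_arr[OF assms(1)] assms(3) by (simp_all add: Hom_iff)
  from subgroup.m_closed[OF ideal_subgroup[OF this], of f g] show ?thesis using assms by simp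
qed

text \<open>One-sided absorption comes from the two-sided axiom by inserting an identity on the
  other side.\<close>

lemma ideal_comp:
  assumes "g \<in> I" "g \<in> Hom D A B"
  shows ideal_comp_left: "h \<in> Hom D B C \<Longrightarrow> rel_compact (Obj D) C \<Longrightarrow> h \<cdot> g \<in> I"
    and ideal_comp_right: "f \<in> Hom D E A \<Longrightarrow> rel_compact (Obj D) E \<Longrightarrow> g \<cdot> f \<in> I"
proof -
  have AB: "rel_compact (Obj D) A" "rel_compact (Obj D) B"
    using ideal_arr[OF assms(1)] assms(2) by (simp_all add: Hom_iff)
  have all: "\<forall>f \<in> compact_arrows \<kappa> D. \<forall>g \<in> I. \<forall>h \<in> compact_arrows \<kappa> D.
        Cod D f = Dom D g \<and> Cod D g = Dom D h \<longrightarrow> h \<cdot> g \<cdot> f \<in> I"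
    using ideal by (simp add: compact_ideal_def)
  have ca: "f \<in> compact_arrows \<kappa> D" if "f \<in> Hom D X Y" "rel_compact (Obj D) X" "rel_compact (Obj D) Y" for f X Y
    using that by (simp add: compact_arrows_def compact_object_iff Hom_iff)
  have idA: "Ident D A \<in> Hom D A A" "Ident D B \<in> Hom D B B" using Ident_hom Hom_objs[OF assms(2)] by auto
  show "h \<cdot> g \<in> I" if h: "h \<in> Hom D B C" "rel_compact (Obj D) C"
  proof -
    have "h \<cdot> g \<cdot> Ident D A \<in> I"
      by (rule all[rule_format, OF ca[OF idA(1) AB(1) AB(1)] assms(1) ca[OF h(1) AB(2) h(2)]])
        (use assms h idA(1) in \<open>simp add: Hom_iff\<close>)
    then show ?thesis using Comp_Ident[OF assms(2)] by simp
  qed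
  show "g \<cdot> f \<in> I" if f: "f \<in> Hom D E A" "rel_compact (Obj D) E"
  proof -
    have "Ident D B \<cdot> g \<cdot> f \<in> I"
      by (rule all[rule_format, OF ca[OF f(1) f(2) AB(1)] assms(1) ca[OF idA(2) AB(2) AB(2)]])
        (use assms f idA(2) in \<open>simp add: Hom_iff\<close>)
    then show ?thesis using Ident_Comp[OF Comp_hom[OF f(1) assms(2)]] by simp
  qed
qed

lemma ideal_ShM: "f \<in> I \<Longrightarrow> ShM D f \<in> I"
  using shift by blast

lemma ideal_unShM: assumes "f \<in> I" obtains f' where "f' \<in> I" "ShM D f' = f"
  using shift assms by (metis imageE)

text \<open>Membership in the square of \<open>I\<close> gives only finite sums of composites. A sum
  becomes one composite through the biproduct of the middle objects, a zero map passes through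
  \<open>A\<close> itself, and a sign is absorbed into the second factor.\<close>

lemma ideal_factor:
  assumes f: "f \<in> I" "f \<in> Hom D A B"
  obtains C a b where "a \<in> I" "a \<in> Hom D A C" "b \<in> I" "b \<in> Hom D C B" "f = b \<cdot> a"
proof -
  have AB: "rel_compact (Obj D) A" "rel_compact (Obj D) B"
    using ideal_arr[OF f(1)] f(2) by (simp_all add: Hom_iff)
  have AB': "Dom D f = A" "Cod D f = B" using f(2) by (simp_all add: Hom_iff)
  let ?P = "\<lambda>f. \<exists>C a b. a \<in> I \<and> a \<in> Hom D A C \<and> b \<in> I \<and> b \<in> Hom D C B \<and> f = b \<cdot> a"
  have "f \<in> ideal_square \<kappa> D I" using f(1) idem by (simp add: idempotent_ideal_def)
  then have "f \<in> generate (hom_group D A B)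
    {b \<cdot> a | a b. a \<in> I \<and> b \<in> I \<and> Dom D a = A \<and> Cod D a = Dom D b \<and> Cod D b = B}"
    using AB' by (simp add: ideal_square_def)
  then have "?P f"
  proof induction
    case one
    have AO: "A \<in> Obj D" "B \<in> Obj D" using AB by (simp_all add: rel_compact_def)
    have "Zero D A B = Zero D A B \<cdot> Zero D A A" "Zero D A A \<in> Hom D A A" "Zero D A B \<in> Hom D A B"
      using AO by (simp_all add: Hom_iff)
    then show ?case using ideal_Zero[OF AB(1,1)] ideal_Zero[OF AB] unfolding hom_group_simps by blast
  next
    case (incl h)
    then obtain a b where "h = b \<cdot> a" "a \<in> I" "b \<in> I" "Dom D a = A" "Cod D a = Dom D b" "Cod D b = B"
      by blast
    then show ?case using ideal_arr(1)[of a] ideal_arr(1)[of b] by auto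
  next
    case (inv h)
    then obtain a b where h: "h = b \<cdot> a" "a \<in> I" "b \<in> I" "Dom D a = A" "Cod D a = Dom D b" "Cod D b = B"
      by blast
    have a: "a \<in> Hom D A (Dom D b)" and b: "b \<in> Hom D (Dom D b) B"
      using ideal_arr(1) h by metis+
    have Bc: "rel_compact (Obj D) (Dom D b)" using ideal_arr[OF h(3)] by blast
    have "Dom D h = A" "Cod D h = B" using Comp_hom[OF a b] h(1) by (simp_all add: Hom_def)
    then have "inv\<^bsub>hom_group D A B\<^esub> h = neg D h" by (simp add: neg_def)
    then have eq: "inv\<^bsub>hom_group D A B\<^esub> h = neg D b \<cdot> a"
      using a b h(1) by (simp add: Hom_iff)
    have nb: "neg D b \<in> I"
    proof -
      interpret comm_group "hom_group D (Dom D b) B" using hom_comm_group Hom_objs[OF b] .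
      show ?thesis using subgroup.m_inv_closed[OF ideal_subgroup[OF Bc AB(2)], of b] b h(3)
        by (simp add: neg_def Hom_iff)
    qed
    have "neg D b \<in> Hom D (Dom D b) B" using b by (simp add: Hom_iff)
    then show ?case using eq nb h(2) a by blast
  next
    case (eng h1 h2)
    then obtain C1 a1 b1 C2 a2 b2 where
      1: "a1 \<in> I" "a1 \<in> Hom D A C1" "b1 \<in> I" "b1 \<in> Hom D C1 B" "h1 = b1 \<cdot> a1" and
      2: "a2 \<in> I" "a2 \<in> Hom D A C2" "b2 \<in> I" "b2 \<in> Hom D C2 B" "h2 = b2 \<cdot> a2" by blast
    have C: "rel_compact (Obj D) C1" "rel_compact (Obj D) C2"
      using ideal_arr[OF 1(1)] ideal_arr[OF 2(1)] 1(2) 2(2) by (simp_all add: Hom_iff)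
    have CO: "C1 \<in> Obj D" "C2 \<in> Obj D" using C by (simp_all add: rel_compact_def)
    obtain S where S: "is_biproduct C1 C2 S" using ex_biproduct[OF CO] unfolding is_biproduct_def by blast
    obtain i j p q where H: "i \<in> Hom D C1 S" "j \<in> Hom D C2 S" "p \<in> Hom D S C1" "q \<in> Hom D S C2"
      and e: "b1 \<cdot> a1 \<boxplus> b2 \<cdot> a2 = (b1 \<cdot> p \<boxplus> b2 \<cdot> q) \<cdot> (i \<cdot> a1 \<boxplus> j \<cdot> a2)"
      by (rule factor_sum_biproduct[OF S 1(2,4) 2(2,4)])
    \<comment> \<open>The new middle object has to be compact, as the ideal absorbs only morphisms
      between compact objects.\<close>
    have Sc: "rel_compact (Obj D) S"
    proof -
      obtain i j p q where "i \<in> Hom D C1 S" "j \<in> Hom D C2 S" "p \<in> Hom D S C1" "q \<in> Hom D S C2"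
        "i \<cdot> p \<boxplus> j \<cdot> q = Ident D S"
        using S unfolding is_biproduct_def by blast
      then show ?thesis using rel_compact_biproduct[OF C] by blast
    qed
    have "i \<cdot> a1 \<boxplus> j \<cdot> a2 \<in> I"
      by (rule ideal_Add[OF ideal_comp_left[OF 1(1,2) H(1) Sc] ideal_comp_left[OF 2(1,2) H(2) Sc]
            Comp_hom[OF 1(2) H(1)] Comp_hom[OF 2(2) H(2)]])
    moreover have "b1 \<cdot> p \<boxplus> b2 \<cdot> q \<in> I"
      by (rule ideal_Add[OF ideal_comp_right[OF 1(3,4) H(3) Sc] ideal_comp_right[OF 2(3,4) H(4) Sc]
            Comp_hom[OF H(3) 1(4)] Comp_hom[OF H(4) 2(4)]])
    moreover have "i \<cdot> a1 \<boxplus> j \<cdot> a2 \<in> Hom D A S" "b1 \<cdot> p \<boxplus> b2 \<cdot> q \<in> Hom D S B"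
      using H 1(2,4) 2(2,4) by (simp_all add: Hom_iff)
    moreover have "h1 \<otimes>\<^bsub>hom_group D A B\<^esub> h2 = (b1 \<cdot> p \<boxplus> b2 \<cdot> q) \<cdot> (i \<cdot> a1 \<boxplus> j \<cdot> a2)"
      using e 1(5) 2(5) by simp
    ultimately show ?case by blast
  qed
  with that show ?thesis by blast
qed

lemma right_orthogonalD:
  assumes "Y \<in> right_orthogonal D I"
  shows "Y \<in> Obj D" "f \<in> I \<Longrightarrow> f \<in> Hom D A B \<Longrightarrow> u \<in> Hom D B Y \<Longrightarrow> u \<cdot> f = Zero D A Y"
  using assms by (auto simp: right_orthogonal_def Hom_iff)

lemma right_orthogonalI:
  assumes "Y \<in> Obj D" "\<And>f A B u. f \<in> I \<Longrightarrow> f \<in> Hom D A B \<Longrightarrow> u \<in> Hom D B Y \<Longrightarrow> u \<cdot> f = Zero D A Y"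
  shows "Y \<in> right_orthogonal D I"
  unfolding right_orthogonal_def using assms(1) assms(2)[OF _ ideal_arr(1)] by blast

text \<open>Each closure property consumes one hypothesis. Stability of \<open>I\<close> under the
  shift and its inverse gives shift-invariance. Compactness of codomains gives coproducts, since a
  map into one is a finite sum through summands. A factorization \<open>b a\<close> inside
  \<open>I\<close> gives cones: \<open>b\<close> kills the component in \<open>A[1]\<close>, and
  \<open>a\<close> kills the resulting lift to \<open>B\<close>.\<close>

lemma localizing_right_orthogonal: "localizing (right_orthogonal D I)"
proof (rule localizingI)
  let ?Y = "right_orthogonal D I"
  show "?Y \<subseteq> Obj D" by (auto simp: right_orthogonal_def)
  obtain Z where Z: "zero_object D Z" using ex_zero_object by blast
  have "Z \<in> ?Y"
  proof (rule right_orthogonalI)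
    show "Z \<in> Obj D" using Z by (simp add: zero_object_def)
    show "u \<cdot> f = Zero D A Z" if "f \<in> Hom D A B" "u \<in> Hom D B Z" for f A B u
      using zero_object_Hom(1)[OF Z Comp_hom[OF that]] .
  qed
  then show "?Y \<noteq> {}" by blast
  show "B \<in> ?Y" if A: "A \<in> ?Y" and B: "B \<in> Obj D" and i: "iso_arr D A B e" for A B e
  proof (rule right_orthogonalI[OF B])
    obtain e' where e: "e \<in> Hom D A B" "e' \<in> Hom D B A" "e \<cdot> e' = Ident D B"
      using iso_arr_inverse[OF i] by blast
    fix f M N u assume f: "f \<in> I" "f \<in> Hom D M N" and u: "u \<in> Hom D N B"
    have z: "(e' \<cdot> u) \<cdot> f = Zero D M A" using right_orthogonalD(2)[OF A f Comp_hom[OF u e(2)]] .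
    have "u \<cdot> f = e \<cdot> e' \<cdot> u \<cdot> f"
      using Comp_reassoc[OF e(3,2,1) Comp_hom[OF f(2) u]] Ident_Comp[OF Comp_hom[OF f(2) u]] by simp
    also have "\<dots> = e \<cdot> (e' \<cdot> u) \<cdot> f" using Comp_assoc[OF f(2) u e(2)] by simp
    finally show "u \<cdot> f = Zero D M B" unfolding z using e(1) Hom_objs[OF f(2)] by (simp add: Hom_iff)
  qed
  show sh: "Sh D Y \<in> ?Y \<longleftrightarrow> Y \<in> ?Y" if Yo: "Y \<in> Obj D" for Y
  proof
    assume Y: "Sh D Y \<in> ?Y"
    show "Y \<in> ?Y"
    proof (rule right_orthogonalI[OF Yo])
      fix f A B u assume f: "f \<in> I" "f \<in> Hom D A B" and u: "u \<in> Hom D B Y"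
      have "ShM D (u \<cdot> f) = Zero D (Sh D A) (Sh D Y)"
        using ShM_Comp[OF f(2) u] right_orthogonalD(2)[OF Y ideal_ShM[OF f(1)] ShM_hom[OF f(2)] ShM_hom[OF u]]
        by simp
      then show "u \<cdot> f = Zero D A Y" by (rule ShM_eq_Zero[OF Comp_hom[OF f(2) u]])
    qed
  next
    assume Y: "Y \<in> ?Y"
    show "Sh D Y \<in> ?Y"
    proof (rule right_orthogonalI)
      fix f A B u assume f: "f \<in> I" "f \<in> Hom D A B" and u: "u \<in> Hom D B (Sh D Y)"
      obtain g where g: "g \<in> I" "ShM D g = f" using ideal_unShM[OF f(1)] .
      have gH: "g \<in> Hom D (Dom D g) (Cod D g)" using ideal_arr(1)[OF g(1)] .
      have AB: "Sh D (Dom D g) = A" "Sh D (Cod D g) = B" using ShM_hom[OF gH] g(2) f(2) by (auto simp: Hom_iff)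
      have "u \<in> Hom D (Sh D (Cod D g)) (Sh D Y)" using u AB(2) by simp
      then obtain v where v: "v \<in> Hom D (Cod D g) Y" "ShM D v = u"
        using ShM_full[OF _ Hom_cod_obj[OF gH] Yo] by blast
      have "u \<cdot> f = ShM D (v \<cdot> g)" using ShM_Comp[OF gH v(1)] v(2) g(2) by simp
      also have "v \<cdot> g = Zero D (Dom D g) Y" using right_orthogonalD(2)[OF Y g(1) gH v(1)] .
      finally show "u \<cdot> f = Zero D A (Sh D Y)" using AB(1) Hom_objs[OF gH] Yo by simp
    qed (use Yo in simp)
  qed
  show "C \<in> ?Y" if t: "tri A B C f g h" and A: "A \<in> ?Y" and B: "B \<in> ?Y" for A B C f g h
  proof (rule right_orthogonalI)
    note T = triD[OF t]
    show "C \<in> Obj D" by (fact T)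
    have ShA: "Sh D A \<in> ?Y" using sh[OF T(5)] A by blast
    fix e M N u assume e: "e \<in> I" "e \<in> Hom D M N" and u: "u \<in> Hom D N C"
    obtain K a b where ab: "a \<in> I" "a \<in> Hom D M K" "b \<in> I" "b \<in> Hom D K N" "e = b \<cdot> a"
      using ideal_factor[OF e] .
    have "h \<cdot> u \<cdot> b = Zero D K (Sh D A)"
      using right_orthogonalD(2)[OF ShA ab(3,4) Comp_hom[OF u T(4)]] Comp_assoc[OF ab(4) u T(4)] by simp
    then obtain w where w: "w \<in> Hom D K B" "g \<cdot> w = u \<cdot> b"
      using tri_lift2[OF t Comp_hom[OF ab(4) u]] by blast
    have z: "w \<cdot> a = Zero D M B" using right_orthogonalD(2)[OF B ab(1,2) w(1)] .
    have "u \<cdot> e = (u \<cdot> b) \<cdot> a" using Comp_assoc[OF ab(2,4) u] ab(5) by simp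
    also have "\<dots> = g \<cdot> w \<cdot> a" using Comp_assoc[OF ab(2) w(1) T(3)] w(2) by simp
    also have "\<dots> = Zero D M C" unfolding z using T(3) Hom_objs[OF ab(2)] by (simp add: Hom_iff)
    finally show "u \<cdot> e = Zero D M C" .
  qed
  show "F \<in> ?Y" if "coproduct_of ?Y F" for F
  proof -
    obtain J :: "'u set" and X \<iota> where J: "small \<kappa> J" and cp: "is_coproduct D J X F \<iota>"
      and X: "\<And>j. j \<in> J \<Longrightarrow> X j \<in> ?Y"
      using \<open>coproduct_of ?Y F\<close> unfolding coproduct_of_def by blast
    note CP = is_coproductD[OF cp]
    show ?thesis
    proof (rule right_orthogonalI[OF CP(1)])
      fix f A B u assume f: "f \<in> I" "f \<in> Hom D A B" and u: "u \<in> Hom D B F"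
      have AB: "A \<in> Obj D" "B \<in> Obj D" using Hom_objs[OF f(2)] by auto
      have "rel_compact (Obj D) B" using ideal_arr(3)[OF f(1)] f(2) by (simp add: Hom_iff)
      then have "fin_supp J F \<iota> u" using rel_compactD[OF _ J cp CP(2) u] by blast
      then obtain E e where E: "finite E" "E \<subseteq> J" and e: "is_cut J F \<iota> E e" "e \<cdot> u = u"
        by (auto simp: fin_supp_def)
      have "e \<cdot> u \<in> {v. v \<cdot> f = Zero D A F}"
      proof (rule is_cut_comp_induct[OF cp E e(1) u])
        show "Zero D B F \<in> {v. v \<cdot> f = Zero D A F}" using f(2) CP(1) by (simp add: Hom_iff)
        show "v \<boxplus> w \<in> {v. v \<cdot> f = Zero D A F}"
          if "v \<in> {v. v \<cdot> f = Zero D A F}" "w \<in> {v. v \<cdot> f = Zero D A F}" "v \<in> Hom D B F" "w \<in> Hom D B F" for v w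
          using Comp_Add_left[OF f(2) that(3,4)] that(1,2) AB CP(1) by simp
        fix j p assume j: "j \<in> E" and "is_proj J X F \<iota> j p"
        then have p: "p \<in> Hom D F (X j)" and jJ: "j \<in> J" using E by (auto simp: is_proj_def)
        have pu: "p \<cdot> u \<in> Hom D B (X j)" using Comp_hom[OF u p] .
        have z: "(p \<cdot> u) \<cdot> f = Zero D A (X j)" using right_orthogonalD(2)[OF X[OF jJ] f pu] .
        have "(\<iota> j \<cdot> p \<cdot> u) \<cdot> f = \<iota> j \<cdot> (p \<cdot> u) \<cdot> f" using Comp_assoc[OF f(2) pu CP(3)[OF jJ]] .
        then show "\<iota> j \<cdot> p \<cdot> u \<in> {v. v \<cdot> f = Zero D A F}"
          unfolding z using CP(3)[OF jJ] AB by (simp add: Hom_iff)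
      qed
      then show "u \<cdot> f = Zero D A F" using e(2) by simp
    qed
  qed
qed

text \<open>Repeated factorization gives \<open>b 0 = f\<close> and
  \<open>b n = b (Suc n) g n\<close> with all factors in \<open>I\<close>. The leftover factors
  \<open>b n\<close> form a cocone to \<open>B\<close>, and the induced map \<open>u\<close>
  satisfies \<open>u c 0 = f\<close>.\<close>

lemma ideal_factors_through_milnor:
  assumes f: "f \<in> I" "f \<in> Hom D A B"
  obtains C M g where "\<And>n. g n \<in> I" "Milnor_colimit D M g C" "factors_through D f C"
proof -
  \<comment> \<open>A state is an intermediate object with the factor still to be split; the clause
    for \<open>n = 0\<close> pins the sequence to start with \<open>f\<close>.\<close>
  define st where "st n y \<longleftrightarrow> snd y \<in> I \<and> snd y \<in> Hom D (fst y) B \<and> (n = 0 \<longrightarrow> y = (A, f))" for n :: nat and y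
  define ok where "ok y y' g \<longleftrightarrow> g \<in> I \<and> g \<in> Hom D (fst y) (fst y') \<and> snd y = snd y' \<cdot> g" for y y' g
  have "\<exists>y. \<forall>n. st n (y n) \<and> (\<exists>g. ok (y n) (y (Suc n)) g)"
  proof (rule dependent_nat_choice)
    show "\<exists>y. st 0 y" using f by (auto simp: st_def)
  next
    fix y and n :: nat assume "st n y"
    then have y: "snd y \<in> I" "snd y \<in> Hom D (fst y) B" by (simp_all add: st_def)
    obtain C a b where "a \<in> I" "a \<in> Hom D (fst y) C" "b \<in> I" "b \<in> Hom D C B" "snd y = b \<cdot> a"
      using ideal_factor[OF y] .
    then have "st (Suc n) (C, b)" "ok y (C, b) a" by (simp_all add: st_def ok_def)
    then show "\<exists>y'. st (Suc n) y' \<and> (\<exists>g. ok y y' g)" by blast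
  qed
  then obtain y where y: "\<And>n. st n (y n)" "\<And>n. \<exists>g. ok (y n) (y (Suc n)) g" by blast
  then obtain g where g: "\<And>n. ok (y n) (y (Suc n)) (g n)" by metis
  define M where "M n = fst (y n)" for n
  define b where "b n = snd (y n)" for n
  have gH: "g n \<in> Hom D (M n) (M (Suc n))" and gI: "g n \<in> I" and bg: "b (Suc n) \<cdot> g n = b n" for n
    using g[of n] by (simp_all add: ok_def M_def b_def)
  have bH: "b n \<in> Hom D (M n) B" for n using y(1)[of n] by (simp add: st_def M_def b_def)
  have M0: "M 0 = A" and b0: "b 0 = f" using y(1)[of 0] by (simp_all add: st_def M_def b_def)
  obtain C c where c: "milnor_cocone M g C c" by (rule milnor_cocone_ex[of g M, OF gH])
  obtain u where u: "u \<in> Hom D C B" "\<And>n. u \<cdot> c n = b n"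
    by (rule milnor_cocone_desc[OF c, of b, OF bH bg]) (rule that)
  have c0: "c 0 \<in> Hom D A C" using milnor_cocone_compat(2)[OF c, of 0] M0 by simp
  have fu: "f = u \<cdot> c 0" using u(2)[of 0] b0 by simp
  have "factors_via {C} f" by (rule factors_viaI[OF _ c0 u(1) fu]) simp
  then have "factors_through D f C" by (simp add: factors_via_def)
  moreover have "Milnor_colimit D M g C" using c Milnor_colimit_iff by blast
  ultimately show ?thesis using that[of g M C, OF gI] by blast
qed

text \<open>A map from a compact object into the colimit comes from some stage \<open>n\<close>.
  Moving it on to stage \<open>Suc n\<close> inserts the transition map \<open>g n\<close>, and this
  puts the composite into \<open>I\<close>.\<close>

lemma factors_through_milnor_ideal:
  assumes g: "\<And>n. g n \<in> I" and C: "Milnor_colimit D M g C"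
    and f: "f \<in> Hom D A B" "rel_compact (Obj D) A" "rel_compact (Obj D) B" and fC: "factors_through D f C"
  shows "f \<in> I"
proof -
  obtain c where c: "milnor_cocone M g C c" using C Milnor_colimit_iff by blast
  note cc = milnor_cocone_compat[OF c]
  have gH: "g n \<in> Hom D (M n) (M (Suc n))" for n using c by (rule milnor_cocone_Hom)
  have "factors_via {C} f" using fC by (simp add: factors_via_def)
  then obtain a b where ab: "a \<in> Hom D A C" "b \<in> Hom D C B" "f = b \<cdot> a"
    using factors_viaE[OF _ f(1)] by blast
  have MO: "M n \<in> Obj D" for n using Hom_objs[OF gH] by blast
  obtain n w where w: "w \<in> Hom D A (M n)" "a = c n \<cdot> w"
    by (rule milnor_cocone_factor[OF c f(2) shift_invariant_Obj MO ab(1)])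
  have gw: "g n \<cdot> w \<in> I" using ideal_comp_right[OF g gH w(1) f(2)] .
  have gwH: "g n \<cdot> w \<in> Hom D A (M (Suc n))" using Comp_hom[OF w(1) gH] .
  have "a = c (Suc n) \<cdot> g n \<cdot> w" using Comp_reassoc[OF cc(3) gH cc(2) w(1)] w(2) by simp
  then have "f = (b \<cdot> c (Suc n)) \<cdot> g n \<cdot> w" using Comp_assoc[OF gwH cc(2) ab(2)] ab(3) by simp
  then show ?thesis using ideal_comp_left[OF gw gwH Comp_hom[OF cc(2) ab(2)] f(3)] by simp
qed

lemma milnor_set_ex:
  obtains P where "small \<kappa> P" "P \<subseteq> Obj D"
    "\<And>C. C \<in> P \<Longrightarrow> \<exists>M g. (\<forall>n. g n \<in> I) \<and> Milnor_colimit D M g C"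
    "\<And>f A B. \<lbrakk>f \<in> Hom D A B; rel_compact (Obj D) A; rel_compact (Obj D) B\<rbrakk> \<Longrightarrow> f \<in> I \<longleftrightarrow> factors_via P f"
proof -
  obtain H where H: "compact_core H" using compact_core_ex .
  define F where "F = {f \<in> I. Dom D f \<in> H \<and> Cod D f \<in> H}"
  define good where "good f C \<longleftrightarrow> (\<exists>M g. (\<forall>n. g n \<in> I) \<and> Milnor_colimit D M g C) \<and> factors_through D f C" for f C
  have "\<exists>C. good f C" if "f \<in> F" for f
  proof -
    have fI: "f \<in> I" using that by (simp add: F_def)
    obtain C M g where "\<And>n. g n \<in> I" "Milnor_colimit D M g C" "factors_through D f C"
      by (rule ideal_factors_through_milnor[OF fI ideal_arr(1)[OF fI]]) (rule that)
    then show ?thesis unfolding good_def by blast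
  qed
  then obtain c where c: "\<And>f. f \<in> F \<Longrightarrow> good f (c f)" by metis
  have "small \<kappa> (\<Union>A\<in>H. \<Union>B\<in>H. Hom D A B)"
    by (intro small_UN[OF inaccessible] locally_small core_small[OF H]) (use core_obj[OF H] in auto)
  moreover have "F \<subseteq> (\<Union>A\<in>H. \<Union>B\<in>H. Hom D A B)"
  proof
    fix f assume "f \<in> F"
    then show "f \<in> (\<Union>A\<in>H. \<Union>B\<in>H. Hom D A B)" using ideal_arr(1)[of f] unfolding F_def by blast
  qed
  ultimately have small: "small \<kappa> (c ` F)" using small_subset small_image by blast
  have mil: "\<exists>M g. (\<forall>n. g n \<in> I) \<and> Milnor_colimit D M g C" if "C \<in> c ` F" for C
    using c that by (auto simp: good_def)
  have iff: "f \<in> I \<longleftrightarrow> factors_via (c ` F) f"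
    if f: "f \<in> Hom D A B" and A: "rel_compact (Obj D) A" and B: "rel_compact (Obj D) B" for f A B
  proof
    assume "factors_via (c ` F) f"
    then obtain C where C: "C \<in> c ` F" "factors_through D f C" by (auto simp: factors_via_def)
    obtain M g where "\<And>n. g n \<in> I" "Milnor_colimit D M g C" using mil[OF C(1)] by blast
    then show "f \<in> I" by (rule factors_through_milnor_ideal[OF _ _ f A B C(2)])
  next
    assume fI: "f \<in> I"
    obtain A' i p where A': "A' \<in> H" "i \<in> Hom D A A'" "p \<in> Hom D A' A" "p \<cdot> i = Ident D A"
      using compact_retract_of_core[OF H A] .
    obtain B' j q where B': "B' \<in> H" "j \<in> Hom D B B'" "q \<in> Hom D B' B" "q \<cdot> j = Ident D B"
      using compact_retract_of_core[OF H B] .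
    note comp = core_compact[OF H]
    \<comment> \<open>The transport of \<open>f\<close> to members of \<open>H\<close>. From
      \<open>p i = 1\<close> and \<open>q j = 1\<close> one recovers \<open>f = q f' i\<close>, so
      the Milnor colimit chosen for \<open>f'\<close> serves \<open>f\<close> too.\<close>
    define f' where "f' = j \<cdot> f \<cdot> p"
    have fp: "f \<cdot> p \<in> Hom D A' B" using Comp_hom[OF A'(3) f] .
    have f'H: "f' \<in> Hom D A' B'" using Comp_hom[OF fp B'(2)] by (simp add: f'_def)
    have "f' \<in> I"
      unfolding f'_def
      by (rule ideal_comp_left[OF ideal_comp_right[OF fI f A'(3) comp[OF A'(1)]] fp B'(2) comp[OF B'(1)]])
    then have f'F: "f' \<in> F" using f'H A'(1) B'(1) by (simp add: F_def Hom_iff)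
    then have "factors_via {c f'} f'" using c[OF f'F] by (simp add: good_def factors_via_def)
    then obtain a b where ab: "a \<in> Hom D A' (c f')" "b \<in> Hom D (c f') B'" "f' = b \<cdot> a"
      using factors_viaE[OF _ f'H] by blast
    have "q \<cdot> f' = f \<cdot> p"
      using Comp_reassoc[OF B'(4,2,3) fp] Ident_Comp[OF fp] by (simp add: f'_def)
    then have "q \<cdot> f' \<cdot> i = f"
      using Comp_assoc[OF A'(2) f'H B'(3)] Comp_assoc[OF A'(2,3) f] A'(4) Comp_Ident[OF f] by simp
    moreover have "q \<cdot> f' \<cdot> i = (q \<cdot> b) \<cdot> a \<cdot> i"
      using ab A'(2) B'(3) by (simp add: Hom_iff)
    ultimately have "f = (q \<cdot> b) \<cdot> a \<cdot> i" by simp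
    then show "factors_via (c ` F) f"
      using factors_viaI[OF _ Comp_hom[OF A'(2) ab(1)] Comp_hom[OF ab(2) B'(3)]] f'F by blast
  qed
  have sub: "c ` F \<subseteq> Obj D"
  proof
    fix C assume "C \<in> c ` F"
    then obtain M g where "Milnor_colimit D M g C" using mil by blast
    then show "C \<in> Obj D" using Milnor_colimit_iff milnor_cocone_compat(1) by blast
  qed
  show ?thesis
  proof (rule that[OF small sub])
    show "\<exists>M g. (\<forall>n. g n \<in> I) \<and> Milnor_colimit D M g C" if "C \<in> c ` F" for C
      using that by (rule mil)
    show "f \<in> I \<longleftrightarrow> factors_via (c ` F) f"
      if "f \<in> Hom D A B" "rel_compact (Obj D) A" "rel_compact (Obj D) B" for f A B
      using that by (rule iff)
  qed
qed

end

end

section \<open>The t-structures\<close>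

context inaccessible_compactly_generated
begin

lemma shift_invariant_image:
  assumes "shift_invariant T" shows "Sh D ` T = T"
proof -
  have "shift_closed T" using shift_invariant_closed[OF assms] .
  then show ?thesis unfolding shift_closed_def by (auto simp: image_iff)
qed

text \<open>A shift-invariant class satisfies \<open>V[1] = V\<close>, so \<open>V\<close> is its
  own witness in the definition and both shift inclusions are automatic.\<close>

lemma t_structureI:
  assumes T: "shift_invariant U" "shift_invariant V" and full: "strictly_full D U" "strictly_full D V"
    and z: "\<And>A B u. \<lbrakk>A \<in> U; B \<in> V; u \<in> Hom D A B\<rbrakk> \<Longrightarrow> u = Zero D A B"
    and ex: "\<And>M. M \<in> Obj D \<Longrightarrow> \<exists>A B f g h. tri A M B f g h \<and> A \<in> U \<and> B \<in> V"
  shows "t_structure D U V"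
  unfolding t_structure_def
proof (intro exI[of _ V] conjI ballI)
  have UV: "U \<subseteq> Obj D" "V \<subseteq> Obj D" using T by (auto simp: shift_invariant_def)
  show "V = Sh D ` V" "Sh D ` U \<subseteq> U" using shift_invariant_image T by auto
  show "{B \<in> Obj D. Sh D B \<in> V} \<subseteq> V" using T(2) by (auto simp: shift_invariant_def)
  show "strictly_full D U" "strictly_full D V" by (fact full)+
  show "Hom D A B = {Zero D A B}" if "A \<in> U" "B \<in> V" for A B
  proof -
    have "A \<in> Obj D" "B \<in> Obj D" using that UV by auto
    then have "Zero D A B \<in> Hom D A B" by (simp add: Hom_iff)
    then show ?thesis using z[OF that] by blast
  qed
  show "\<exists>f g h. (f, g, h) \<in> Tri D \<and> Dom D f \<in> U \<and> Cod D f = M \<and> Cod D g \<in> V" if M: "M \<in> Obj D" for M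
  proof -
    obtain A B f g h where t: "tri A M B f g h" and AB: "A \<in> U" "B \<in> V" using ex[OF M] by blast
    have "Dom D f = A" "Cod D f = M" "Cod D g = B" using triD(2,3)[OF t] by (simp_all add: Hom_iff)
    then show ?thesis using triD(1)[OF t] AB by blast
  qed
qed

lemma right_perp_of_cell_approx:
  assumes Q: "small \<kappa> Q" "shift_closed Q" "Q \<subseteq> T" and T: "localizing T"
    and compact: "\<And>B. B \<in> Q \<Longrightarrow> rel_compact T B" and M: "M \<in> Obj D"
  obtains X Z m k l where "cell Q X" "tri X M Z m k l" "Z \<in> right_perp Q"
proof -
  have QO: "Q \<subseteq> Obj D" using Q(3) localizingD(2)[OF T] by blast
  obtain X m where app: "cell_approx Q M X m" using cell_approx_ex[OF Q(1) QO M] .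
  then have X: "cell Q X" and m: "m \<in> Hom D X M" by (simp_all add: cell_approx_def)
  obtain Z k l where t: "tri X M Z m k l" using tri_cone[OF m] .
  have "u = Zero D B Z" if B: "B \<in> Q" and u: "u \<in> Hom D B Z" for B u
  proof -
    obtain A where A: "A \<in> Q" "Sh D A = B" using Q(2) B by (auto simp: shift_closed_def)
    then show ?thesis
      using cell_approx_cone_Hom_zero[OF app t T Q(3) compact[OF A(1)] A(1), of u] B u by simp
  qed
  then have "Z \<in> right_perp Q" using triD(7)[OF t] by (simp add: right_perp_def)
  with that X t show ?thesis by blast
qed

text \<open>If \<open>L\<close> is the reflection of a compact object \<open>A\<close> into \<open>T\<close>, then \<open>Hom(L, ?)\<close> and \<open>Hom(A, ?)\<close>
  agree on \<open>T\<close>, so \<open>L\<close> is compact relative to \<open>T\<close>.\<close>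

lemma reflection_Hom:
  assumes t: "tri X A L n \<eta> l" and T: "localizing T" and X: "X \<in> left_perp T" and Y: "Y \<in> T"
  shows "u \<in> Hom D L Y \<Longrightarrow> u \<cdot> \<eta> = Zero D A Y \<Longrightarrow> u = Zero D L Y"
    and "v \<in> Hom D A Y \<Longrightarrow> \<exists>u\<in>Hom D L Y. u \<cdot> \<eta> = v"
proof -
  note TT = triD[OF t]
  have lp: "localizing (left_perp T)" using localizing_left_perp localizingD(1)[OF T] .
  have ShX: "Sh D X \<in> left_perp T"
    using localizingD(1)[OF lp] X TT(5) by (simp add: shift_invariant_def)
  show "u = Zero D L Y" if u: "u \<in> Hom D L Y" "u \<cdot> \<eta> = Zero D A Y"
  proof -
    obtain w where w: "w \<in> Hom D (Sh D X) Y" "w \<cdot> l = u" using tri_extend2[OF t u] .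
    have "w = Zero D (Sh D X) Y" using ShX Y w(1) by (simp add: left_perp_def)
    then show ?thesis using w(2) TT(4) Hom_objs[OF u(1)] by (simp add: Hom_iff)
  qed
  show "\<exists>u\<in>Hom D L Y. u \<cdot> \<eta> = v" if v: "v \<in> Hom D A Y"
  proof -
    have "v \<cdot> n = Zero D X Y" using X Y Comp_hom[OF TT(2) v] by (simp add: left_perp_def)
    then obtain u where "u \<in> Hom D L Y" "u \<cdot> \<eta> = v" using tri_extend[OF t v] by blast
    then show ?thesis by blast
  qed
qed

lemma reflection_rel_compact:
  assumes t: "tri X A L n \<eta> l" and T: "localizing T" and X: "X \<in> left_perp T"
    and A: "rel_compact (Obj D) A"
  shows "rel_compact T L"
  unfolding rel_compact_def
proof (intro conjI allI impI)
  note TT = triD[OF t]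
  show "L \<in> Obj D" by (fact TT)
  fix J :: "'u set" and V S \<iota> u
  assume as: "small \<kappa> J \<and> is_coproduct D J V S \<iota> \<and> (\<forall>j\<in>J. V j \<in> T) \<and> u \<in> Hom D L S"
  then have cp: "is_coproduct D J V S \<iota>" and u: "u \<in> Hom D L S" by auto
  note CP = is_coproductD[OF cp]
  \<comment> \<open>Closure under coproducts keeps \<open>S\<close> in \<open>T\<close>, where maps
    from \<open>L\<close> are determined by their composite with \<open>\<eta>\<close>; a cut fixing
    \<open>u \<eta>\<close> must then fix \<open>u\<close>.\<close>
  have "coproduct_of T S" by (rule coproduct_ofI[OF _ cp]) (use as in auto)
  then have S: "S \<in> T" by (rule localizingD(4)[OF T])
  have u\<eta>: "u \<cdot> \<eta> \<in> Hom D A S" using Comp_hom[OF TT(3) u] .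
  have "fin_supp J S \<iota> (u \<cdot> \<eta>)" using rel_compactD[OF A _ cp CP(2) u\<eta>] as by blast
  then obtain F e where F: "finite F" "F \<subseteq> J" and e: "is_cut J S \<iota> F e" "e \<cdot> u \<cdot> \<eta> = u \<cdot> \<eta>"
    by (auto simp: fin_supp_def)
  have eH: "e \<in> Hom D S S" using e(1) by (simp add: is_cut_def)
  have eu: "e \<cdot> u \<in> Hom D L S" using Comp_hom[OF u eH] .
  have d: "e \<cdot> u \<boxminus> u \<in> Hom D L S" using eu u by (simp add: Hom_iff)
  have "(e \<cdot> u \<boxminus> u) \<cdot> \<eta> = e \<cdot> u \<cdot> \<eta> \<boxminus> u \<cdot> \<eta>" using eH u TT(3) by (simp add: Hom_iff)
  also have "\<dots> = Zero D A S" unfolding e(2) using u\<eta> by (simp add: Hom_def)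
  finally have "e \<cdot> u \<boxminus> u = Zero D L S" using reflection_Hom(1)[OF t T X S d] by blast
  then have "e \<cdot> u = u" using sub_eq_Zero_iff[OF eu u] by blast
  then show "fin_supp J S \<iota> u" using F e(1) by (auto simp: fin_supp_def)
qed

text \<open>Membership in \<open>T\<close> and compactness relative to it are both shift-invariant,
  so adjoining all integer shifts stays within relatively compact members;
  \<open>small_closure\<close> is used with an operation ignoring its second argument.\<close>

lemma shift_closure_ex:
  assumes "small \<kappa> G" "G \<subseteq> T" "localizing T" "\<And>B. B \<in> G \<Longrightarrow> rel_compact T B"
  obtains Q where "small \<kappa> Q" "G \<subseteq> Q" "Q \<subseteq> T" "shift_closed Q" "\<And>B. B \<in> Q \<Longrightarrow> rel_compact T B"
proof -
  note T = localizingD(1,2)[OF assms(3)]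
  define K where "K = {B \<in> T. rel_compact T B}"
  let ?unsh = "inv_into (Obj D) (Sh D)"
  have "small \<kappa> {Sh D A, ?unsh A} \<and> {Sh D A, ?unsh A} \<subseteq> K" if A: "A \<in> K" for A
  proof -
    have AO: "A \<in> Obj D" using A T(2) by (auto simp: K_def)
    have "Sh D A \<in> K" "?unsh A \<in> K"
      using A Sh_inv[OF AO] AO T(1) rel_compact_Sh_iff[OF T(1) AO] rel_compact_Sh_iff[OF T(1) Sh_inv(1)[OF AO]]
      by (auto simp: K_def shift_invariant_def)
    moreover have "small \<kappa> {Sh D A, ?unsh A}" by (rule small_finite[OF inaccessible]) simp
    ultimately show ?thesis by simp
  qed
  moreover have "G \<subseteq> K" using assms(2,4) by (auto simp: K_def)
  ultimately obtain Q where Q: "small \<kappa> Q" "G \<subseteq> Q" "Q \<subseteq> K"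
    "\<And>A B. A \<in> Q \<Longrightarrow> B \<in> Q \<Longrightarrow> {Sh D A, ?unsh A} \<subseteq> Q"
    using small_closure[OF inaccessible assms(1), of K "\<lambda>A B. {Sh D A, ?unsh A}"] by metis
  have QT: "Q \<subseteq> T" using Q(3) by (auto simp: K_def)
  have "Sh D (?unsh A) = A" if "A \<in> Q" for A using Sh_inv(2) that QT T(2) by blast
  then have "shift_closed Q" unfolding shift_closed_def using Q(4) by blast
  moreover have "rel_compact T B" if "B \<in> Q" for B using Q(3) that by (auto simp: K_def)
  ultimately show ?thesis using that Q(1,2) QT by blast
qed

text \<open>The reflections of the compact generators generate \<open>T\<close>, which yields the second t-structure.\<close>

lemma t_structure_right_perp:
  assumes T: "localizing T"
    and refl: "\<And>M. M \<in> Obj D \<Longrightarrow> \<exists>X L n \<eta> l. tri X M L n \<eta> l \<and> X \<in> left_perp T \<and> L \<in> T"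
  shows "t_structure D T (right_perp T)"
proof -
  note TO = localizingD(1,2)[OF T]
  obtain H where H: "compact_core H" using compact_core_ex .
  note HO = core_obj[OF H]
  have "\<exists>L. \<exists>X n \<eta> l. tri X A L n \<eta> l \<and> X \<in> left_perp T \<and> L \<in> T" if "A \<in> H" for A
    using refl HO that by blast
  then obtain L where L: "\<And>A. A \<in> H \<Longrightarrow> \<exists>X n \<eta> l. tri X A (L A) n \<eta> l \<and> X \<in> left_perp T \<and> L A \<in> T" by metis
  have "rel_compact T B" if "B \<in> L ` H" for B
    using that L reflection_rel_compact[OF _ T] core_compact[OF H] by blast
  moreover have "L ` H \<subseteq> T" using L by blast
  moreover have "small \<kappa> (L ` H)" using small_image[OF core_small[OF H]] .
  ultimately obtain Q where Q: "small \<kappa> Q" "L ` H \<subseteq> Q" "Q \<subseteq> T" "shift_closed Q"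
    and Qc: "\<And>B. B \<in> Q \<Longrightarrow> rel_compact T B"
    using shift_closure_ex[OF _ _ T] by metis
  \<comment> \<open>A map from a core object \<open>A\<close> to an object of \<open>T\<close>
    extends to the reflection \<open>L A\<close>, which belongs to \<open>Q\<close>. So an object of
    \<open>T\<close> orthogonal to \<open>Q\<close> receives no nonzero map from the core.\<close>
  have zero: "zero_object D W" if W: "W \<in> T" "W \<in> right_perp Q" for W
  proof (rule core_generates[OF H])
    show "W \<in> Obj D" using W TO by blast
    fix A u assume A: "A \<in> H" and u: "u \<in> Hom D A W"
    obtain X n \<eta> l where t: "tri X A (L A) n \<eta> l" and X: "X \<in> left_perp T" using L[OF A] by blast
    obtain v where v: "v \<in> Hom D (L A) W" "v \<cdot> \<eta> = u" using reflection_Hom(2)[OF t T X W(1) u] by blast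
    have "v = Zero D (L A) W" using W(2) Q(2) A v(1) by (auto simp: right_perp_def)
    then show "u = Zero D A W" using v(2) triD(3)[OF t] Hom_objs[OF u] by (simp add: Hom_iff)
  qed
  have rQ: "shift_invariant (right_perp Q)"
    by (rule right_perp_shift_invariant[OF Q(4)]) (use Q(3) TO in blast)
  \<comment> \<open>Orthogonality to \<open>Q\<close> implies orthogonality to all of
    \<open>T\<close>: for \<open>Y\<close> in \<open>T\<close> the cone of its approximation lies in
    \<open>T\<close> and is orthogonal to \<open>Q\<close>, hence is zero, and \<open>Y\<close> is a
    retract of an object built from \<open>Q\<close>.\<close>
  have perp: "Z \<in> right_perp T" if Z: "Z \<in> right_perp Q" for Z
  proof -
    have Zo: "Z \<in> Obj D" using Z by (simp add: right_perp_def)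
    have "u = Zero D Y Z" if Y: "Y \<in> T" and u: "u \<in> Hom D Y Z" for Y u
    proof -
      have Yo: "Y \<in> Obj D" using Y TO by blast
      obtain X W m k l where X: "cell Q X" and t: "tri X Y W m k l" and W: "W \<in> right_perp Q"
        using right_perp_of_cell_approx[OF Q(1,4,3) T Qc Yo] .
      have "X \<in> T" using cell_localizing[OF T Q(3) X] .
      then have "W \<in> T" using localizingD(3)[OF T t] Y by blast
      then obtain s where s: "s \<in> Hom D Y X" "m \<cdot> s = Ident D Y"
        using tri_zero_cone_section[OF t zero] W by blast
      \<comment> \<open>The left orthogonal of \<open>right_perp Q\<close> is localizing and
        contains \<open>Q\<close>, so it contains every object built from \<open>Q\<close>.\<close>
      have "Q \<subseteq> left_perp (right_perp Q)"
        using Q(3) TO by (auto simp: left_perp_def right_perp_def)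
      then have XL: "X \<in> left_perp (right_perp Q)" using cell_localizing[OF localizing_left_perp[OF rQ] _ X] by blast
      have m: "m \<in> Hom D X Y" using triD(2)[OF t] .
      have um: "u \<cdot> m = Zero D X Z" using XL Z Comp_hom[OF m u] by (simp add: left_perp_def)
      have "u = (u \<cdot> m) \<cdot> s" using Comp_assoc[OF s(1) m u] s(2) Comp_Ident[OF u] by simp
      then show ?thesis unfolding um using s(1) Zo by (simp add: Hom_iff)
    qed
    then show ?thesis using Zo by (simp add: right_perp_def)
  qed
  show ?thesis
  proof (rule t_structureI[OF TO(1) _ localizing_strictly_full[OF T] right_perp_strictly_full])
    show "shift_invariant (right_perp T)"
      by (rule right_perp_shift_invariant[OF shift_invariant_closed[OF TO(1)] TO(2)])
    show "u = Zero D A B" if "A \<in> T" "B \<in> right_perp T" "u \<in> Hom D A B" for A B u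
      using that by (simp add: right_perp_def)
    fix M assume M: "M \<in> Obj D"
    obtain X Z m k l where X: "cell Q X" and t: "tri X M Z m k l" and Z: "Z \<in> right_perp Q"
      using right_perp_of_cell_approx[OF Q(1,4,3) T Qc M] .
    then show "\<exists>A B f g h. tri A M B f g h \<and> A \<in> T \<and> B \<in> right_perp T"
      using cell_localizing[OF T Q(3) X] perp by blast
  qed
qed

section \<open>Assembly of the TTF triple\<close>

lemma ideal_TTF_triple:
  assumes ideal: "compact_ideal \<kappa> D I" and idem: "idempotent_ideal \<kappa> D I" and shift: "ShM D ` I = I"
  obtains P where "small \<kappa> P" "\<And>C. C \<in> P \<Longrightarrow> \<exists>M g. (\<forall>n. g n \<in> I) \<and> Milnor_colimit D M g C"
    "\<And>f. f \<in> compact_arrows \<kappa> D \<Longrightarrow> f \<in> I \<longleftrightarrow> (\<exists>C\<in>P. factors_through D f C)"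
    "TTF_triple D (Tria \<kappa> D P) (right_orthogonal D I) (right_perp (right_orthogonal D I))"
proof -
  note I = ideal idem shift
  let ?Y = "right_orthogonal D I"
  have Y: "localizing ?Y" using localizing_right_orthogonal[OF I] .
  note YO = localizingD(1,2)[OF Y]
  obtain P where P: "small \<kappa> P" "P \<subseteq> Obj D"
    and mil: "\<And>C. C \<in> P \<Longrightarrow> \<exists>M g. (\<forall>n. g n \<in> I) \<and> Milnor_colimit D M g C"
    and via: "\<And>f A B. \<lbrakk>f \<in> Hom D A B; rel_compact (Obj D) A; rel_compact (Obj D) B\<rbrakk> \<Longrightarrow> f \<in> I \<longleftrightarrow> factors_via P f"
    by (rule milnor_set_ex[OF I]) (rule that)
  have fac: "factors_via P f" if "f \<in> I" for f
    using via ideal_arr[OF I that] that by blast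
  \<comment> \<open>Maps into \<open>Z\<close> must vanish on the transition maps and on their
    shifts; the shifted ones lie in \<open>I\<close> as well.\<close>
  have "P \<subseteq> left_perp ?Y"
  proof
    fix C assume C: "C \<in> P"
    obtain M g where g: "\<And>n. g n \<in> I" and "Milnor_colimit D M g C" using mil[OF C] by blast
    then obtain c where c: "milnor_cocone M g C c" using Milnor_colimit_iff by blast
    have gH: "g n \<in> Hom D (M n) (M (Suc n))" for n using c by (rule milnor_cocone_Hom)
    have "u = Zero D C Z" if Z: "Z \<in> ?Y" and u: "u \<in> Hom D C Z" for Z u
      by (rule milnor_cocone_Hom_zero[OF c u right_orthogonalD(2)[OF I Z g gH]
            right_orthogonalD(2)[OF I Z ideal_ShM[OF I g] ShM_hom[OF gH]]])
    then show "C \<in> left_perp ?Y" using C P(2) by (auto simp: left_perp_def)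
  qed
  then have TP: "Tria \<kappa> D P \<subseteq> left_perp ?Y"
    by (rule localizing_Tria(2)[OF localizing_left_perp[OF YO(1)]])
  \<comment> \<open>Here \<open>P\<close> need not be shift-closed nor consist of compact objects,
    so the cone is tested on morphisms of \<open>I\<close>, whose domains and codomains are compact,
    and not on objects of \<open>P\<close>.\<close>
  have approx: "\<exists>X Z m k l. tri X M Z m k l \<and> X \<in> Tria \<kappa> D P \<and> Z \<in> ?Y" if M: "M \<in> Obj D" for M
  proof -
    obtain X m where app: "cell_approx P M X m" using cell_approx_ex[OF P M] .
    then have X: "cell P X" and m: "m \<in> Hom D X M" by (simp_all add: cell_approx_def)
    obtain Z k l where t: "tri X M Z m k l" using tri_cone[OF m] .
    have "Z \<in> ?Y"
    proof (rule right_orthogonalI[OF I triD(7)[OF t]])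
      fix f A B u assume f: "f \<in> I" "f \<in> Hom D A B" and u: "u \<in> Hom D B Z"
      obtain C a b where ab: "a \<in> I" "a \<in> Hom D A C" "b \<in> I" "b \<in> Hom D C B" "f = b \<cdot> a"
        using ideal_factor[OF I f] .
      \<comment> \<open>The first test morphism of \<open>cell_approx_cone\<close> enters through
        its shift, so \<open>b\<close> is desuspended within \<open>I\<close>.\<close>
      obtain b' where b': "b' \<in> I" "ShM D b' = b" using ideal_unShM[OF I ab(3)] .
      have b'H: "b' \<in> Hom D (Dom D b') (Cod D b')" using ideal_arr(1)[OF I b'(1)] .
      have sh: "Sh D (Dom D b') = C" "Sh D (Cod D b') = B"
        using ShM_hom[OF b'H] b'(2) ab(4) by (simp_all add: Hom_iff)
      have "u \<cdot> ShM D b' \<cdot> a = Zero D A Z"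
        by (rule cell_approx_cone[OF app t localizing_Obj P(2) ideal_arr(3)[OF I b'(1)] b'H fac[OF b'(1)] _ fac[OF ab(1)]])
          (use ab(2) u sh in simp_all)
      then show "u \<cdot> f = Zero D A Z" using b'(2) ab(5) by simp
    qed
    then show ?thesis using t cell_Tria[OF P(2) X] by blast
  qed
  have LT: "localizing (Tria \<kappa> D P)" using localizing_Tria(3)[OF P(2)] .
  have "t_structure D (Tria \<kappa> D P) ?Y"
  proof (rule t_structureI[OF localizingD(1)[OF LT] YO(1) localizing_strictly_full[OF LT] localizing_strictly_full[OF Y]])
    show "u = Zero D A B" if "A \<in> Tria \<kappa> D P" "B \<in> ?Y" "u \<in> Hom D A B" for A B u
      using that TP by (auto simp: left_perp_def)
    show "\<exists>A B f g h. tri A M B f g h \<and> A \<in> Tria \<kappa> D P \<and> B \<in> ?Y" if "M \<in> Obj D" for M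
      using approx[OF that] .
  qed
  \<comment> \<open>The triangles just found are at the same time reflections into
    \<open>right_orthogonal D I\<close>, which is the input required for the second
    t-structure.\<close>
  moreover have "t_structure D ?Y (right_perp ?Y)"
  proof (rule t_structure_right_perp[OF Y])
    show "\<exists>X L n \<eta> l. tri X M L n \<eta> l \<and> X \<in> left_perp ?Y \<and> L \<in> ?Y" if "M \<in> Obj D" for M
      using approx[OF that] TP by blast
  qed
  ultimately have ttf: "TTF_triple D (Tria \<kappa> D P) ?Y (right_perp ?Y)" by (simp add: TTF_triple_def)
  show ?thesis
  proof (rule that[OF P(1) _ _ ttf])
    show "\<exists>M g. (\<forall>n. g n \<in> I) \<and> Milnor_colimit D M g C" if "C \<in> P" for C
      using that by (rule mil)
    show "f \<in> I \<longleftrightarrow> (\<exists>C\<in>P. factors_through D f C)" if "f \<in> compact_arrows \<kappa> D" for f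
      using via[of f "Dom D f" "Cod D f"] that
      by (simp add: compact_arrows_def compact_object_iff Hom_iff factors_via_def)
  qed
qed

end

theorem theorem5p5p8:
  fixes \<kappa> :: "'u rel" and D :: "('o, 'm) triang_data" and I :: "'m set"
  assumes "inaccessible_cardinal \<kappa>"
    and "compactly_generated_category \<kappa> D"
    and "compact_ideal \<kappa> D I"
    and "idempotent_ideal \<kappa> D I"
    and "ShM D ` I = I"
  shows "\<exists>X Y Z P.
    TTF_triple D X Y Z \<and>
    small \<kappa> P \<and>
    (\<forall>C \<in> P. \<exists>M f. (\<forall>n. f n \<in> I) \<and> Milnor_colimit D M f C) \<and>
    X = Tria \<kappa> D P \<and>
    Y = right_orthogonal D I \<and>
    (\<forall>f \<in> compact_arrows \<kappa> D. f \<in> I \<longleftrightarrow> (\<exists>C \<in> P. factors_through D f C))"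
proof -
  interpret inaccessible_compactly_generated \<kappa> D
    using assms(1,2) by (intro inaccessible_compactly_generated.intro
        inaccessible_compactly_generated_axioms.intro)
  obtain P where P: "small \<kappa> P"
    "\<And>C. C \<in> P \<Longrightarrow> \<exists>M g. (\<forall>n. g n \<in> I) \<and> Milnor_colimit D M g C"
    "\<And>f. f \<in> compact_arrows \<kappa> D \<Longrightarrow> f \<in> I \<longleftrightarrow> (\<exists>C\<in>P. factors_through D f C)"
    "TTF_triple D (Tria \<kappa> D P) (right_orthogonal D I) (right_perp (right_orthogonal D I))"
    by (rule ideal_TTF_triple[OF assms(3-5)]) (rule that)
  show ?thesis
    by (intro exI[of _ "Tria \<kappa> D P"] exI[of _ "right_orthogonal D I"]
        exI[of _ "right_perp (right_orthogonal D I)"] exI[of _ P] conjI ballI P refl)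
qed

end
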